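(* Let $m>0$, let $n\ge 1$ be an integer, and let $\{\varphi_j\}_{j=1}^n\subset \dot H^1(\mathbb{S}^2)$ be a family of zero mean functions that is orthonormal in the sense that $$m^2(\varphi_i,\varphi_j)+(\nabla\varphi_i,\nabla\varphi_j)=\delta_{ij},\qquad 1\le i,j\le n.$$ Then for every $1\le p<\infty$ the function $\rho(x):=\sum_{j=1}^n|\varphi_j(x)|^2$ satisfies $$\|\rho\|_{L^p(\mathbb{S}^2)}\le \mathrm{B}_p\, m^{-2/p}\,n^{1/p},\qquad\text{where}\qquad \mathrm{B}_p\le\left(\frac{p-1}{4\pi}\right)^{(p-1)/p};$$ that is, the inequality $\|\rho\|_{L^p(\mathbb{S}^2)}\le\left(\frac{p-1}{4\pi}\right)^{(p-1)/p}m^{-2/p}n^{1/p}$ holds, where for $p=1$ the constant $\left(\frac{p-1}{4\pi}\right)^{(p-1)/p}$ is understood as $1$.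
   Context: $\mathbb{S}^2$ is the unit two-dimensional sphere with its standard round metric and the natural (non-normalized) surface measure $d\sigma$, of total mass $4\pi$. All $L^p$-norms are with respect to $d\sigma$, and $\nabla$ is the gradient with respect to the round metric. Functions are real-valued. $(\cdot,\cdot)$ denotes the $L^2(\mathbb{S}^2)$ scalar product of functions or of tangent vector fields. $\dot H^1(\mathbb{S}^2)$ is the space of $\varphi\in H^1(\mathbb{S}^2)$ with $\int_{\mathbb{S}^2}\varphi\,d\sigma=0$. *)

theory Defs
  imports "HOL-Analysis.Analysis"
begin

text \<open>
  Functions and vector fields on the sphere are represented by functions on
  \<^typ>\<open>real^3\<close> of which only the values on \<open>S2\<close> matter (test fields are \<open>C\<^sup>1\<close> on a
  neighbourhood of \<open>S2\<close>).
\<close>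

abbreviation S2 :: "(real^3) set" where
  "S2 \<equiv> sphere 0 1"

text \<open>
  The surface measure of \<open>A\<close> is \<open>d = 3\<close> times the Lebesgue measure of the cone
  \<open>{x. 0 < |x| < 1, x / |x| \<in> A}\<close>; this is the normalization for which polar integration reads
  \<open>dx = r\<^sup>2 dr d\<sigma>\<close>.  The lemma \<open>emeasure_surface_measure_S2\<close> below confirms the total mass.
\<close>

definition surface_measure :: "(real^3) measure" where
  "surface_measure =
     scale_measure 3
       (distr (restrict_space lborel (ball 0 1 - {0})) (restrict_space borel S2)
          (\<lambda>x. x /\<^sub>R norm x))"

lemma space_surface_measure [simp]: "space surface_measure = S2"
  by (simp add: surface_measure_def space_scale_measure space_restrict_space)

lemma sets_surface_measure [simp, measurable_cong]:
  "sets surface_measure = sets (restrict_space borel S2)"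
  by (simp add: surface_measure_def)

lemma measurable_radial_projection:
  "(\<lambda>x::real^3. x /\<^sub>R norm x)
     \<in> measurable (restrict_space lborel (ball 0 1 - {0})) (restrict_space borel S2)"
  by (rule measurable_restrict_space2)
    (auto simp: space_restrict_space intro!: measurable_restrict_space1)

lemma emeasure_surface_measure_S2: "emeasure surface_measure S2 = ennreal (4 * pi)"
proof -
  have vol: "emeasure lborel (ball (0::real^3) 1 - {0}) = ennreal (4 / 3 * pi)"
  proof -
    have "emeasure lborel (ball (0::real^3) 1 - {0}) = emeasure lborel (ball (0::real^3) 1)"
      by (rule emeasure_Diff_null_set) auto
    also have "\<dots> = ennreal (4 / 3 * pi)"
      by (subst emeasure_ball) (auto simp: unit_ball_vol_3)
    finally show ?thesis .
  qed
  have pre: "(\<lambda>x::real^3. x /\<^sub>R norm x) -` S2 \<inter> space (restrict_space lborel (ball 0 1 - {0}))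
      = ball 0 1 - {0}"
    by (auto simp: space_restrict_space)
  have S2: "S2 \<in> sets (restrict_space borel S2)"
    by (metis sets.top space_restrict_space2 sets_borel borel_closed closed_sphere)
  have "emeasure surface_measure S2
      = 3 * emeasure (restrict_space lborel (ball 0 1 - {0})) (ball (0::real^3) 1 - {0})"
    unfolding surface_measure_def emeasure_scale_measure
    by (subst emeasure_distr[OF measurable_radial_projection S2]) (simp only: pre)
  also have "\<dots> = 3 * ennreal (4 / 3 * pi)"
    by (subst emeasure_restrict_space) (auto simp: vol)
  also have "\<dots> = ennreal (4 * pi)"
    by (simp flip: ennreal_numeral ennreal_mult)
  finally show ?thesis .
qed

definition S2_Lp :: "real \<Rightarrow> (real^3 \<Rightarrow> 'a::euclidean_space) \<Rightarrow> bool" where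
  "S2_Lp p f \<longleftrightarrow> f \<in> borel_measurable surface_measure \<and>
     integrable surface_measure (\<lambda>x. norm (f x) powr p)"

text \<open>Only meaningful for functions satisfying \<open>S2_Lp p\<close>.\<close>

definition S2_Lp_norm :: "real \<Rightarrow> (real^3 \<Rightarrow> 'a::euclidean_space) \<Rightarrow> real" where
  "S2_Lp_norm p f = (\<integral>x. norm (f x) powr p \<partial>surface_measure) powr (1 / p)"

text \<open>The \<open>L\<^sup>2\<close> scalar product, both for functions and for vector fields.\<close>

definition S2_inner ::
  "(real^3 \<Rightarrow> 'a::euclidean_space) \<Rightarrow> (real^3 \<Rightarrow> 'a) \<Rightarrow> real" where
  "S2_inner f g = (\<integral>x. f x \<bullet> g x \<partial>surface_measure)"

definition S2_tangent :: "(real^3 \<Rightarrow> real^3) \<Rightarrow> bool" where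
  "S2_tangent v \<longleftrightarrow> (\<forall>x\<in>S2. v x \<bullet> x = 0)"

definition S2_C1 :: "(real^3 \<Rightarrow> real^3) \<Rightarrow> bool" where
  "S2_C1 v \<longleftrightarrow> (\<exists>U D. open U \<and> S2 \<subseteq> U \<and> continuous_on U D \<and>
     (\<forall>x\<in>U. (v has_derivative blinfun_apply (D x)) (at x)))"

text \<open>
  The Riemannian divergence of a tangent field is the trace of its covariant derivative, i.e. of
  the derivative projected to the tangent plane: the full trace minus the contribution of the unit
  normal \<open>x\<close>.  It depends only on the restriction of \<open>v\<close> to \<open>S2\<close>.
\<close>

definition S2_div :: "(real^3 \<Rightarrow> real^3) \<Rightarrow> real^3 \<Rightarrow> real" where
  "S2_div v x =
     (\<Sum>b\<in>Basis. frechet_derivative v (at x) b \<bullet> b) - frechet_derivative v (at x) x \<bullet> x"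

text \<open>
  \<open>g\<close> is the weak gradient of \<open>\<phi>\<close>: the two satisfy the divergence theorem against all \<open>C\<^sup>1\<close>
  tangent fields (as the sphere has no boundary, no support condition is needed).
\<close>

definition S2_weak_gradient :: "(real^3 \<Rightarrow> real) \<Rightarrow> (real^3 \<Rightarrow> real^3) \<Rightarrow> bool" where
  "S2_weak_gradient \<phi> g \<longleftrightarrow> S2_Lp 2 g \<and> S2_tangent g \<and>
     (\<forall>v. S2_C1 v \<and> S2_tangent v \<longrightarrow> S2_inner \<phi> (S2_div v) = - S2_inner g v)"

definition S2_H1 :: "(real^3 \<Rightarrow> real) \<Rightarrow> bool" where
  "S2_H1 \<phi> \<longleftrightarrow> S2_Lp 2 \<phi> \<and> (\<exists>g. S2_weak_gradient \<phi> g)"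

text \<open>
  Weak gradients are unique up to null sets, so the scalar products of the gradients do not depend
  on the choice made here.
\<close>

definition S2_grad :: "(real^3 \<Rightarrow> real) \<Rightarrow> real^3 \<Rightarrow> real^3" where
  "S2_grad \<phi> = (SOME g. S2_weak_gradient \<phi> g)"

definition S2_H1_dot :: "(real^3 \<Rightarrow> real) \<Rightarrow> bool" where
  "S2_H1_dot \<phi> \<longleftrightarrow> S2_H1 \<phi> \<and> (\<integral>x. \<phi> x \<partial>surface_measure) = 0"

end

theory Submission
  imports Defs "HOL-Complex_Analysis.Complex_Analysis" "HOL-Library.Discrete_Functions"
begin

text \<open>
  For \<open>p > 1\<close> let \<open>q = p / (p - 1)\<close>. By duality it suffices to bound \<open>\<integral> V \<rho>\<close> by
  \<open>n\<^sup>1\<^sup>/\<^sup>p (C \<integral> V\<^sup>q)\<^sup>1\<^sup>/\<^sup>q\<close> for simple \<open>V \<ge> 0\<close>, where \<open>C\<close> is the value on the diagonal of the kernel of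
  \<open>(m\<^sup>2 - \<Delta>)\<^sup>-\<^sup>q\<close> on zero mean functions. Instead of the Araki-Lieb-Thirring inequality, Hadamard's three
  lines theorem is applied to an exponential sum in \<open>z\<close>: expand the \<open>\<phi>\<^sub>j\<close> in spherical harmonics, replace
  \<open>V\<close> by \<open>V\<^sup>q\<^sup>z\<close>, and multiply the layer of degree \<open>k\<close> by \<open>(m\<^sup>2 + k (k + 1))\<close> to the power \<open>(1 - q z) / 2\<close>.
  At \<open>z = 1 / q\<close> this is \<open>\<integral> V \<rho>\<close>; on \<open>Re z = 0\<close> Bessel's inequality bounds it by \<open>n\<close>; on \<open>Re z = 1\<close> Bessel's
  inequality for the dual family and the addition theorem bound it by \<open>C \<integral> V\<^sup>q\<close>. The constant \<open>C\<close> is estimated by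
  comparing the sum of \<open>(2 k + 1) (m\<^sup>2 + k (k + 1))\<^sup>-\<^sup>q\<close> over \<open>k \<ge> 1\<close> with an integral.

  Spherical harmonics are obtained by orthonormalizing the monomials by degree. Integration by parts
  along the rotation fields makes them eigenfunctions and shows that the sum of squares over one
  degree is constant on the sphere.
\<close>

section \<open>Integration on the sphere\<close>

text \<open>Hadamard's theorem needs an entire function that is bounded on the strip. Hence the
  expansions are cut off at a degree \<open>N\<close> and \<open>V\<close> is simple: all that
  occurs is then a finite sum of exponentials in z. The bounds do not depend on \<open>N\<close>,
  and Fatou's lemma removes the cutoff. The cutoff also makes the integral K of
  \<open>\<rho>\<close> to the power p finite beforehand: letting \<open>V\<close> increase to the
  power p - 1 of the density gives K \<le> n^(1/p) (C K)^(1/q), and only a finite K can be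
  cancelled. Zero mean removes the degree k = 0. Its term m^(-2 q) alone exceeds m^(2 - 2 q) / (q -
  1) for small m, and the comparison with an integral breaks down there. Origin of the constant: the
  addition theorem gives (2 k + 1) / (4 pi) for each degree and the eigenvalue sum is at most m^(2 -
  2 q) / (q - 1), so C = m^(2 - 2 q) / (4 pi (q - 1)); since 1 / (q - 1) = p - 1, its power 1 / q is
  the asserted constant times m^(-2 / p). For p = 1 there is no finite q, and the bound is read off
  from the orthonormality relations.\<close>

lemma finite_measure_surface: "finite_measure surface_measure"
  by (rule finite_measureI) (simp add: emeasure_surface_measure_S2)

interpretation surface: finite_measure surface_measure
  by (rule finite_measure_surface)

lemma measure_surface_space: "measure surface_measure S2 = 4 * pi"
  by (simp add: measure_def emeasure_surface_measure_S2)

lemma borel_measurable_surface_continuous [intro]: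
  fixes f :: "real^3 \<Rightarrow> 'b::euclidean_space"
  assumes "continuous_on S2 f"
  shows "f \<in> borel_measurable surface_measure"
  using borel_measurable_continuous_on_restrict[OF assms]
  by (simp add: measurable_cong_sets[OF sets_surface_measure refl])

lemma bounded_measurable_integrable:
  fixes f :: "real^3 \<Rightarrow> 'b::euclidean_space"
  assumes "f \<in> borel_measurable surface_measure" "\<And>x. x \<in> S2 \<Longrightarrow> norm (f x) \<le> B"
  shows "integrable surface_measure f"
  using assms by (intro surface.integrable_const_bound[where B = B]) auto

lemma integrable_surface_continuous [intro]:
  fixes f :: "real^3 \<Rightarrow> 'b::euclidean_space"
  assumes "continuous_on S2 f"
  shows "integrable surface_measure f"
proof -
  have "bounded (f ` S2)"
    by (intro compact_imp_bounded compact_continuous_image assms compact_sphere)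
  then obtain B where "\<forall>x\<in>S2. norm (f x) \<le> B"
    by (auto simp: bounded_iff)
  then show ?thesis
    by (intro bounded_measurable_integrable[where B = B] borel_measurable_surface_continuous assms) auto
qed

section \<open>Surface measure through cones, and its invariance under orthogonal maps\<close>

lemma emeasure_surface_cone:
  assumes "A \<in> sets surface_measure"
  shows "emeasure surface_measure A =
    3 * emeasure lborel {x \<in> ball 0 1 - {0}. x /\<^sub>R norm x \<in> A}"
proof -
  have [measurable]: "A \<in> sets (restrict_space borel S2)" using assms by simp
  have "(\<lambda>x. x /\<^sub>R norm x) -` A \<inter> space (restrict_space lborel (ball 0 1 - {0}))
     = {x \<in> ball 0 1 - {0}. x /\<^sub>R norm x \<in> A}"
    by (auto simp: space_restrict_space)
  moreover have "emeasure (restrict_space lborel (ball 0 1 - {0})) {x \<in> ball 0 1 - {0}. x /\<^sub>R norm x \<in> A}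
     = emeasure lborel {x \<in> ball 0 1 - {0}. x /\<^sub>R norm x \<in> A}"
    by (rule emeasure_restrict_space) auto
  ultimately show ?thesis
    unfolding surface_measure_def emeasure_scale_measure
    by (subst emeasure_distr[OF measurable_radial_projection]) simp_all
qed

lemma sets_surface_cone:
  assumes "A \<in> sets surface_measure"
  shows "{x \<in> ball 0 1 - {0}. x /\<^sub>R norm x \<in> A} \<in> sets borel"
proof -
  have "(\<lambda>x. x /\<^sub>R norm x) -` A \<inter> space (restrict_space lborel (ball 0 1 - {0}))
     \<in> sets (restrict_space lborel (ball (0::real^3) 1 - {0}))"
    using assms by (intro measurable_sets[OF measurable_radial_projection]) auto
  moreover have "(\<lambda>x. x /\<^sub>R norm x) -` A \<inter> space (restrict_space lborel (ball 0 1 - {0}))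
     = {x \<in> ball 0 1 - {0}. x /\<^sub>R norm x \<in> A}"
    by (auto simp: space_restrict_space)
  ultimately show ?thesis
    by (subst (asm) sets_restrict_space_iff) auto
qed

lemma orthogonal_transformation_measurable:
  assumes R: "orthogonal_transformation (R :: real^3 \<Rightarrow> real^3)"
  shows "R \<in> measurable surface_measure surface_measure"
proof -
  have "continuous_on UNIV R"
    using R by (simp add: linear_continuous_on linear_linear orthogonal_transformation_linear)
  then have "R \<in> borel_measurable borel" by (rule borel_measurable_continuous_onI)
  then have "R \<in> measurable (restrict_space borel S2) (restrict_space borel S2)"
    using R by (intro measurable_restrict_space2 measurable_restrict_space1)
      (auto simp: space_restrict_space orthogonal_transformation_norm)
  then show ?thesis
    using measurable_cong_sets[OF sets_surface_measure sets_surface_measure] by blast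
qed

text \<open>\<open>R\<close> carries the cone over the preimage of \<open>A\<close> onto the cone
  over \<open>A\<close>, and it preserves Lebesgue measure.\<close>

lemma distr_surface_orthogonal:
  assumes R: "orthogonal_transformation (R :: real^3 \<Rightarrow> real^3)"
  shows "distr surface_measure surface_measure R = surface_measure"
proof (rule measure_eqI)
  fix A assume "A \<in> sets (distr surface_measure surface_measure R)"
  then have A: "A \<in> sets surface_measure" by simp
  have Rm: "R \<in> measurable surface_measure surface_measure"
    by (rule orthogonal_transformation_measurable[OF R])
  define C where "C B = {x \<in> ball 0 1 - {0}. x /\<^sub>R norm x \<in> B}" for B :: "(real^3) set"
  define B where "B = R -` A \<inter> space surface_measure"
  have B: "B \<in> sets surface_measure" unfolding B_def by (rule measurable_sets[OF Rm A])
  have lin: "linear R" using R by (rule orthogonal_transformation_linear)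
  have norm: "norm (R x) = norm x" for x using R by (rule orthogonal_transformation_norm)
  have surj: "surj R" using R by (rule orthogonal_transformation_surj)
  have R0: "R x = 0 \<longleftrightarrow> x = 0" for x using norm[of x] by (metis norm_eq_zero)
  have eq: "C A = R ` C B"
  proof (intro set_eqI iffI)
    fix y assume y: "y \<in> C A"
    obtain x where x: "y = R x" using surj by (metis surjD)
    have "R (x /\<^sub>R norm x) = y /\<^sub>R norm y"
      using x norm lin by (simp add: linear_cmul)
    with y x show "y \<in> R ` C B" by (auto simp: C_def B_def norm R0)
  next
    fix y assume "y \<in> R ` C B"
    then obtain x where x: "y = R x" "x \<in> C B" by auto
    have "R (x /\<^sub>R norm x) = y /\<^sub>R norm y"
      using x norm lin by (simp add: linear_cmul)
    with x show "y \<in> C A" by (auto simp: C_def B_def norm R0)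
  qed
  have CB: "C B \<in> sets borel" "C A \<in> sets borel"
    unfolding C_def using sets_surface_cone A B by auto
  have fin: "emeasure lborel (C B) < \<infinity>" for B
    by (rule emeasure_bounded_finite, rule bounded_subset[of "ball 0 1"]) (auto simp: C_def)
  have "C B \<in> lmeasurable"
    using CB fin by (auto simp: fmeasurable_def)
  then have "measure lebesgue (C A) = measure lebesgue (C B)"
    unfolding eq using measure_orthogonal_image[OF R] by blast
  then have "measure lborel (C A) = measure lborel (C B)"
    using CB by (simp add: measure_completion)
  then have "emeasure lborel (C A) = emeasure lborel (C B)"
    using fin by (metis emeasure_eq_ennreal_measure less_irrefl infinity_ennreal_def)
  then have "emeasure surface_measure A = emeasure surface_measure B"
    using emeasure_surface_cone[OF A] emeasure_surface_cone[OF B] by (simp add: C_def)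
  then show "emeasure (distr surface_measure surface_measure R) A = emeasure surface_measure A"
    by (subst emeasure_distr[OF Rm A]) (simp add: B_def)
qed simp

lemma integral_surface_orthogonal:
  fixes f :: "real^3 \<Rightarrow> real"
  assumes R: "orthogonal_transformation R" and f: "f \<in> borel_measurable surface_measure"
  shows "(\<integral>x. f (R x) \<partial>surface_measure) = (\<integral>x. f x \<partial>surface_measure)"
  using integral_distr[OF orthogonal_transformation_measurable[OF R] f]
  by (simp add: distr_surface_orthogonal[OF R])

text \<open>Every nonempty relatively open subset of the sphere spans an open cone, so it is not null.\<close>

lemma continuous_AE_zero_surface:
  fixes f :: "real^3 \<Rightarrow> real"
  assumes f: "continuous_on S2 f" and ae: "AE x in surface_measure. f x = 0" and x: "x \<in> S2"
  shows "f x = 0"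
proof (rule ccontr)
  assume ne: "f x \<noteq> 0"
  define A where "A = {x \<in> S2. f x \<noteq> 0}"
  have fm: "f \<in> borel_measurable surface_measure" using f by blast
  have "A = f -` (- {0}) \<inter> space surface_measure" by (auto simp: A_def)
  then have A: "A \<in> sets surface_measure" using measurable_sets[OF fm, of "- {0}"] by auto
  have "emeasure surface_measure A = 0"
    using ae A by (subst (asm) AE_iff_measurable[of A]) (auto simp: A_def)
  define C where "C = {x \<in> ball 0 1 - {0}. x /\<^sub>R norm x \<in> A}"
  have "emeasure lborel C = 0"
    using \<open>emeasure surface_measure A = 0\<close> emeasure_surface_cone[OF A] by (simp add: C_def)
  then have "C \<in> null_sets lborel"
    using sets_surface_cone[OF A] by (auto simp: C_def null_sets_def)
  then have neg: "negligible C"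
    using null_sets_completionI negligible_iff_null_sets by blast
  have co: "continuous_on (ball 0 1 - {0}) (\<lambda>x. f (x /\<^sub>R norm x))"
    by (rule continuous_on_compose2[OF f]) (auto intro!: continuous_intros, metis left_inverse norm_eq_zero)
  have "open ((ball 0 1 - {0}) \<inter> (\<lambda>x. f (x /\<^sub>R norm x)) -` (- {0}))"
    by (rule continuous_open_preimage[OF co]) auto
  moreover have "(ball 0 1 - {0}) \<inter> (\<lambda>x. f (x /\<^sub>R norm x)) -` (- {0}) = C"
    by (auto simp: C_def A_def)
  ultimately have "open C" by simp
  moreover have "x /\<^sub>R 2 \<in> C" using x ne by (auto simp: C_def A_def)
  ultimately show False using neg open_not_negligible by blast
qed

text \<open>Upgrades vanishing in L^2 to vanishing at every point. This lets a null remainder of the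
  Gram-Schmidt process be dropped from pointwise identities.\<close>

lemma continuous_square_integral_zero:
  fixes f :: "real^3 \<Rightarrow> real"
  assumes f: "continuous_on S2 f" and i: "(\<integral>x. f x * f x \<partial>surface_measure) = 0" and x: "x \<in> S2"
  shows "f x = 0"
proof -
  have "integrable surface_measure (\<lambda>x. f x * f x)"
    by (intro integrable_surface_continuous continuous_intros f)
  then have "AE x in surface_measure. f x * f x = 0"
    using i by (subst (asm) integral_nonneg_eq_0_iff_AE) auto
  then show ?thesis using continuous_AE_zero_surface[OF f _ x] by simp
qed

section \<open>Rotation fields acting on polynomials\<close>

definition rot :: "3 \<Rightarrow> real^3 \<Rightarrow> real^3" where
  "rot j x = cross3 (axis j 1) x"

text \<open>Up to a factor i these are the angular momentum operators, since \<open>rot j\<close> is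
  the velocity field of the rotation about the axis \<open>j\<close>.\<close>

definition Lie :: "3 \<Rightarrow> (real^3 \<Rightarrow> real) \<Rightarrow> real^3 \<Rightarrow> real" where
  "Lie j f x = frechet_derivative f (at x) (rot j x)"

lemma linear_rot: "linear (rot j)"
  by (auto simp: rot_def cross_add_right cross_mult_right intro!: linearI)

lemma bounded_linear_rot: "bounded_linear (rot j)"
  using linear_rot linear_conv_bounded_linear by blast

lemma rot_inner [simp]: "rot j x \<bullet> x = 0" "x \<bullet> rot j x = 0"
  by (simp_all add: rot_def dot_cross_self)

lemma norm_rot_le: "norm (rot j x) \<le> norm x"
proof -
  have "(norm (rot j x))\<^sup>2 \<le> (norm x)\<^sup>2"
    using norm_cross_dot[of "axis j 1" x] zero_le_power2[of "axis j 1 \<bullet> x"]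
    unfolding rot_def norm_axis_1 mult_1 by linarith
  then show ?thesis by simp
qed

lemma Lie_eqI: "(f has_derivative f') (at x) \<Longrightarrow> Lie j f x = f' (rot j x)"
  unfolding Lie_def by (simp add: frechet_derivative_at[symmetric])

lemma Lie_linear: "bounded_linear f \<Longrightarrow> Lie j f x = f (rot j x)"
  by (rule Lie_eqI) (rule bounded_linear_imp_has_derivative)

lemma Lie_const [simp]: "Lie j (\<lambda>x. c) x = 0"
  by (rule Lie_eqI[OF has_derivative_const])

lemma poly_has_derivative:
  assumes "real_polynomial_function f"
  shows "(f has_derivative frechet_derivative f (at x)) (at x)"
  using differentiable_at_real_polynomial_function[OF assms] by (simp only: frechet_derivative_works)

lemma Lie_add:
  assumes "real_polynomial_function f" "real_polynomial_function g"
  shows "Lie j (\<lambda>x. f x + g x) x = Lie j f x + Lie j g x"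
  using Lie_eqI[OF has_derivative_add[OF assms[THEN poly_has_derivative]]] by (simp add: Lie_def)

lemma Lie_mult:
  assumes "real_polynomial_function f" "real_polynomial_function g"
  shows "Lie j (\<lambda>x. f x * g x) x = f x * Lie j g x + Lie j f x * g x"
  using Lie_eqI[OF has_derivative_mult[OF assms[THEN poly_has_derivative]]] by (simp add: Lie_def)

lemma Lie_cmult:
  assumes "real_polynomial_function f"
  shows "Lie j (\<lambda>x. c * f x) x = c * Lie j f x"
  using Lie_mult[of "\<lambda>x. c" f j x] assms by (simp add: real_polynomial_function.intros)

lemma Lie_sum:
  assumes "finite I" "\<And>i. i \<in> I \<Longrightarrow> real_polynomial_function (f i)"
  shows "Lie j (\<lambda>x. \<Sum>i\<in>I. f i x) x = (\<Sum>i\<in>I. Lie j (f i) x)"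
  using assms
proof (induction I)
  case (insert i I)
  then have "real_polynomial_function (\<lambda>x. \<Sum>i\<in>I. f i x)" by auto
  with insert show ?case by (simp add: Lie_add)
qed simp

lemma poly_Lie [intro]:
  assumes "real_polynomial_function f"
  shows "real_polynomial_function (Lie j f)"
  using assms
proof induction
  case (linear f)
  then have "Lie j f = (\<lambda>x. f (rot j x))" by (auto simp: Lie_linear)
  then show ?case
    using bounded_linear_compose[OF linear bounded_linear_rot] by auto
next
  case (const c)
  have "Lie j (\<lambda>x. c) = (\<lambda>x. 0)" by auto
  then show ?case by auto
next
  case (add f g)
  then have "Lie j (\<lambda>x. f x + g x) = (\<lambda>x. Lie j f x + Lie j g x)" by (auto simp: Lie_add)
  with add show ?case by auto
next
  case (mult f g)
  then have "Lie j (\<lambda>x. f x * g x) = (\<lambda>x. f x * Lie j g x + Lie j f x * g x)"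
    by (auto simp: Lie_mult)
  with mult show ?case by auto
qed

lemma poly_continuous_on:
  assumes "real_polynomial_function (f :: real^3 \<Rightarrow> real)"
  shows "continuous_on S f"
  using assms by (simp add: continuous_on_polymonial_function real_polynomial_function_eq)

lemma poly_bounded_sphere:
  assumes "real_polynomial_function (f :: real^3 \<Rightarrow> real)"
  obtains B where "B \<ge> 0" "\<And>x. x \<in> S2 \<Longrightarrow> \<bar>f x\<bar> \<le> B"
proof -
  have "bounded (f ` S2)"
    by (intro compact_imp_bounded compact_continuous_image poly_continuous_on assms compact_sphere)
  then obtain B where "\<forall>x\<in>S2. \<bar>f x\<bar> \<le> B"
    by (auto simp: bounded_iff)
  then show ?thesis using that[of "max B 0"] by fastforce
qed

section \<open>Rotations and integration by parts along their velocity fields\<close>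

definition rotation :: "3 \<Rightarrow> real \<Rightarrow> real^3 \<Rightarrow> real^3" where
  "rotation j t x = x + sin t *\<^sub>R rot j x + (1 - cos t) *\<^sub>R rot j (rot j x)"

text \<open>\<open>rotation\<close> is Rodrigues' formula for the rotation by the angle
  \<open>t\<close> about the axis \<open>j\<close>. The map \<open>rot j\<close> is skew and acts as
  a quarter turn on the plane orthogonal to the axis, so preservation of the norm reduces to a
  relation between sine and cosine.\<close>

lemma orthogonal_rotation: "orthogonal_transformation (rotation j t)"
proof -
  have rot: "rot j (rot j x) \<bullet> x = - (rot j x \<bullet> rot j x)"
    "rot j (rot j x) \<bullet> rot j (rot j x) = rot j x \<bullet> rot j x" for x
    using exhaust_3[of j] unfolding rot_def
    by (auto simp: cross3_simps axis_def)
  have "norm (rotation j t x) = norm x" for x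
  proof -
    define a s u where "a = rot j x \<bullet> rot j x" "s = sin t" "u = 1 - cos t"
    have "rotation j t x \<bullet> rotation j t x = x \<bullet> x + a * (s\<^sup>2 + u\<^sup>2 - 2 * u)"
      unfolding rotation_def a_s_u_def[symmetric]
      unfolding inner_add_left inner_add_right inner_scaleR_left inner_scaleR_right
      by (simp add: rot inner_commute[of x "rot j (rot j x)"] power2_eq_square algebra_simps
          flip: a_s_u_def)
    also have "s\<^sup>2 + u\<^sup>2 - 2 * u = 0"
      using sin_cos_squared_add[of t] unfolding a_s_u_def power2_eq_square by argo
    finally show ?thesis by (simp add: norm_eq_sqrt_inner)
  qed
  moreover have "linear (rotation j t)"
    unfolding rotation_def
    by (intro linear_compose_add linear_compose_scale_right linear_rot
          linear_compose[OF linear_rot linear_rot, unfolded o_def] linear_ident)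
  ultimately show ?thesis by (simp add: orthogonal_transformation)
qed

lemma rotation_sphere: "x \<in> S2 \<Longrightarrow> rotation j t x \<in> S2"
  using orthogonal_transformation_norm[OF orthogonal_rotation, of j t x] by simp

lemma abs_sin_minus_le:
  fixes t :: real
  assumes "\<bar>t\<bar> \<le> 1"
  shows "\<bar>sin t - t\<bar> \<le> t\<^sup>2"
proof -
  have "\<bar>sin t - t\<bar> \<le> \<bar>sin t - t\<bar> * 2" by simp
  also have "\<dots> \<le> t * t"
    using Maclaurin_sin_bound[of t 2] by (simp add: numeral_2_eq_2 sin_coeff_def)
  finally show ?thesis by (simp add: power2_eq_square)
qed

lemma abs_one_minus_cos_le: "\<bar>1 - cos t\<bar> \<le> (t::real)\<^sup>2"
proof -
  have "1 - cos t = 2 * (sin (t/2))\<^sup>2"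
    using cos_double_sin[of "t/2"] by simp
  moreover have "(sin (t/2))\<^sup>2 \<le> (t/2)\<^sup>2"
    using abs_sin_le_one abs_sin_x_le_abs_x[of "t/2"] by (metis abs_le_square_iff)
  moreover have "(t/2)\<^sup>2 = t\<^sup>2 / 4" by (simp add: power_divide)
  ultimately show ?thesis using zero_le_power2[of "sin (t/2)"] by linarith
qed

text \<open>A quadratic remainder that is uniform on the sphere replaces differentiation under the
  integral sign in \<open>integral_Lie_zero\<close>.\<close>

lemma rotation_second_order:
  assumes "real_polynomial_function f"
  shows "\<exists>C. \<forall>x\<in>S2. \<forall>t. \<bar>t\<bar> \<le> 1 \<longrightarrow> \<bar>f (rotation j t x) - f x - t * Lie j f x\<bar> \<le> C * t\<^sup>2"
  using assms
proof induction
  case (linear f)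
  then obtain K where K: "K \<ge> 0" "\<And>x. \<bar>f x\<bar> \<le> norm x * K"
    using bounded_linear.nonneg_bounded by fastforce
  have "\<bar>f (rotation j t x) - f x - t * Lie j f x\<bar> \<le> (K + K) * t\<^sup>2" if x: "x \<in> S2" and t: "\<bar>t\<bar> \<le> 1" for x t
  proof -
    have "\<bar>f (rot j x)\<bar> \<le> K" "\<bar>f (rot j (rot j x))\<bar> \<le> K"
      using x K norm_rot_le[of j x] norm_rot_le[of j "rot j x"]
      by (auto intro: order_trans[OF K(2)] intro!: mult_left_le_one_le)
    then have "\<bar>(sin t - t) * f (rot j x)\<bar> + \<bar>(1 - cos t) * f (rot j (rot j x))\<bar> \<le> t\<^sup>2 * K + t\<^sup>2 * K"
      unfolding abs_mult using abs_sin_minus_le[OF t] abs_one_minus_cos_le[of t]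
      by (intro add_mono mult_mono) auto
    moreover have "f (rotation j t x) - f x - t * Lie j f x =
        (sin t - t) * f (rot j x) + (1 - cos t) * f (rot j (rot j x))"
      using linear unfolding rotation_def Lie_linear[OF linear]
      by (simp add: linear_simps algebra_simps)
    ultimately show ?thesis by (simp add: algebra_simps)
  qed
  then show ?case by (intro exI[of _ "K + K"]) simp
next
  case (const c)
  show ?case by (rule exI[of _ 0]) simp
next
  case (add f g)
  from add.IH(1) obtain C where
    C: "\<forall>x\<in>S2. \<forall>t. \<bar>t\<bar> \<le> 1 \<longrightarrow> \<bar>f (rotation j t x) - f x - t * Lie j f x\<bar> \<le> C * t\<^sup>2" ..
  note C = C[rule_format]
  from add.IH(2) obtain D where
    D: "\<forall>x\<in>S2. \<forall>t. \<bar>t\<bar> \<le> 1 \<longrightarrow> \<bar>g (rotation j t x) - g x - t * Lie j g x\<bar> \<le> D * t\<^sup>2" ..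
  note D = D[rule_format]
  have "\<bar>f (rotation j t x) + g (rotation j t x) - (f x + g x)
      - t * Lie j (\<lambda>x. f x + g x) x\<bar> \<le> (C + D) * t\<^sup>2" if "x \<in> S2" "\<bar>t\<bar> \<le> 1" for x t
  proof -
    have "f (rotation j t x) + g (rotation j t x) - (f x + g x) - t * Lie j (\<lambda>x. f x + g x) x
      = (f (rotation j t x) - f x - t * Lie j f x) + (g (rotation j t x) - g x - t * Lie j g x)"
      by (simp add: Lie_add[OF add.hyps] algebra_simps)
    then show ?thesis
      using order_trans[OF abs_triangle_ineq add_mono[OF C[OF that] D[OF that]]]
      by (simp only: distrib_right)
  qed
  then show ?case by (intro exI[of _ "C + D"]) simp
next
  case (mult f g)
  from mult.IH(1) obtain C where
    C: "\<forall>x\<in>S2. \<forall>t. \<bar>t\<bar> \<le> 1 \<longrightarrow> \<bar>f (rotation j t x) - f x - t * Lie j f x\<bar> \<le> C * t\<^sup>2" ..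
  note C = C[rule_format]
  from mult.IH(2) obtain D where
    D: "\<forall>x\<in>S2. \<forall>t. \<bar>t\<bar> \<le> 1 \<longrightarrow> \<bar>g (rotation j t x) - g x - t * Lie j g x\<bar> \<le> D * t\<^sup>2" ..
  note D = D[rule_format]
  obtain F where F: "F \<ge> 0" "\<And>x. x \<in> S2 \<Longrightarrow> \<bar>f x\<bar> \<le> F" using poly_bounded_sphere[OF mult.hyps(1)] by metis
  obtain G where G: "G \<ge> 0" "\<And>x. x \<in> S2 \<Longrightarrow> \<bar>g x\<bar> \<le> G" using poly_bounded_sphere[OF mult.hyps(2)] by metis
  obtain F' where F': "F' \<ge> 0" "\<And>x. x \<in> S2 \<Longrightarrow> \<bar>Lie j f x\<bar> \<le> F'"
    using poly_bounded_sphere[OF poly_Lie[OF mult.hyps(1)]] by metis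
  obtain G' where G': "G' \<ge> 0" "\<And>x. x \<in> S2 \<Longrightarrow> \<bar>Lie j g x\<bar> \<le> G'"
    using poly_bounded_sphere[OF poly_Lie[OF mult.hyps(2)]] by metis
  have "\<bar>f (rotation j t x) * g (rotation j t x) - f x * g x - t * Lie j (\<lambda>x. f x * g x) x\<bar>
      \<le> (C * G + F' * G' + (F + F') * D) * t\<^sup>2" if x: "x \<in> S2" and t: "\<bar>t\<bar> \<le> 1" for x t
  proof -
    define r where "r = f (rotation j t x) - f x - t * Lie j f x"
    define s where "s = g (rotation j t x) - g x - t * Lie j g x"
    have r: "\<bar>r\<bar> \<le> C * t\<^sup>2" and s: "\<bar>s\<bar> \<le> D * t\<^sup>2" using C[OF x t] D[OF x t] by (auto simp: r_def s_def)
    \<comment> \<open>The product is expanded with both remainders isolated, so that each of the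
      three summands is of second order in \<open>t\<close>.\<close>
    have "f (rotation j t x) * g (rotation j t x) - f x * g x - t * Lie j (\<lambda>x. f x * g x) x
      = r * g (rotation j t x) + t\<^sup>2 * (Lie j f x * Lie j g x) + (f x + t * Lie j f x) * s"
      unfolding Lie_mult[OF mult.hyps] r_def s_def by (simp add: algebra_simps power2_eq_square)
    also have "\<bar>\<dots>\<bar> \<le> \<bar>r\<bar> * \<bar>g (rotation j t x)\<bar> + t\<^sup>2 * (\<bar>Lie j f x\<bar> * \<bar>Lie j g x\<bar>) + (\<bar>f x\<bar> + \<bar>t\<bar> * \<bar>Lie j f x\<bar>) * \<bar>s\<bar>"
    proof -
      have *: "\<bar>f x + t * Lie j f x\<bar> * \<bar>s\<bar> \<le> (\<bar>f x\<bar> + \<bar>t\<bar> * \<bar>Lie j f x\<bar>) * \<bar>s\<bar>"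
        by (intro mult_right_mono order_trans[OF abs_triangle_ineq]) (simp_all add: abs_mult)
      have tri: "\<bar>a + b + c\<bar> \<le> \<bar>a\<bar> + \<bar>b\<bar> + \<bar>c\<bar>" for a b c :: real by simp
      show ?thesis
        by (rule order_trans[OF tri], unfold abs_mult abs_power2, intro add_mono order_refl *)
    qed
    also have "\<dots> \<le> (C * t\<^sup>2) * G + t\<^sup>2 * (F' * G') + (F + 1 * F') * (D * t\<^sup>2)"
      using r s F G F' G' x t rotation_sphere[OF x]
      by (intro add_mono mult_mono) auto
    finally show ?thesis by (simp add: algebra_simps)
  qed
  then show ?case by (intro exI[of _ "C * G + F' * G' + (F + F') * D"]) simp
qed

text \<open>By rotation invariance \<open>f\<close> and its rotated copy have the same integral, so
  \<open>t\<close> times the integral in question is minus the integral of the second order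
  remainder. Dividing by \<open>t\<close> leaves a bound that is linear in \<open>t\<close>.\<close>

lemma integral_Lie_zero:
  assumes f: "real_polynomial_function f"
  shows "(\<integral>x. Lie j f x \<partial>surface_measure) = 0"
proof -
  let ?I = "\<integral>x. Lie j f x \<partial>surface_measure"
  obtain C where C: "\<And>x t. x \<in> S2 \<Longrightarrow> \<bar>t\<bar> \<le> 1 \<Longrightarrow> \<bar>f (rotation j t x) - f x - t * Lie j f x\<bar> \<le> C * t\<^sup>2"
    using rotation_second_order[OF f] by blast
  have int: "integrable surface_measure f" "integrable surface_measure (Lie j f)"
    using f by (auto intro!: integrable_surface_continuous poly_continuous_on)
  have bound: "\<bar>?I\<bar> \<le> 4 * pi * C * t" if t: "0 < t" "t \<le> 1" for t
  proof -
    have "continuous_on UNIV (rotation j t)"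
      using orthogonal_rotation[of j t] by (simp add: linear_continuous_on linear_linear orthogonal_transformation_linear)
    then have "continuous_on S2 (\<lambda>x. f (rotation j t x))"
      by (intro continuous_on_compose2[OF poly_continuous_on[OF f]]) (auto intro: continuous_on_subset)
    then have i: "integrable surface_measure (\<lambda>x. f (rotation j t x))" by blast
    have "t * ?I = - (\<integral>x. f (rotation j t x) - f x - t * Lie j f x \<partial>surface_measure)"
      using int i integral_surface_orthogonal[OF orthogonal_rotation, of f j t] by simp
    also have "\<bar>\<dots>\<bar> \<le> (\<integral>x. C * t\<^sup>2 \<partial>surface_measure)"
      unfolding abs_minus_cancel
      by (rule order_trans[OF integral_abs_bound integral_mono]) (use int i C t in auto)
    also have "\<dots> = 4 * pi * C * t\<^sup>2" by (simp add: measure_surface_space)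
    finally show ?thesis using t by (simp add: abs_mult power2_eq_square field_simps)
  qed
  show ?thesis
  proof (rule ccontr)
    assume "?I \<noteq> 0"
    then have pos: "\<bar>?I\<bar> > 0" by simp
    \<comment> \<open>Chosen so that the linear bound is at most half of the integral; the summand 1
      keeps the denominator positive when \<open>C\<close> is zero.\<close>
    define t where "t = min 1 (\<bar>?I\<bar> / (2 * (4 * pi * \<bar>C\<bar> + 1)))"
    have t: "0 < t" "t \<le> 1" using pos by (auto simp: t_def intro!: divide_pos_pos add_nonneg_pos)
    have "\<bar>?I\<bar> \<le> (4 * pi * \<bar>C\<bar> + 1) * t"
      using bound[OF t] t by (smt (verit, ccfv_SIG) mult_mono mult_nonneg_nonneg pi_gt_zero mult_right_mono mult_left_mono)
    also have "\<dots> \<le> (4 * pi * \<bar>C\<bar> + 1) * (\<bar>?I\<bar> / (2 * (4 * pi * \<bar>C\<bar> + 1)))"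
      by (intro mult_left_mono) (auto simp: t_def)
    also have "\<dots> = \<bar>?I\<bar> / 2"
      using add_nonneg_pos[of "4 * pi * \<bar>C\<bar>" 1] by (simp add: field_simps)
    finally show False using pos by simp
  qed
qed

lemma integral_Lie_by_parts:
  assumes "real_polynomial_function f" "real_polynomial_function g"
  shows "(\<integral>x. Lie j f x * g x \<partial>surface_measure) = - (\<integral>x. f x * Lie j g x \<partial>surface_measure)"
proof -
  have "integrable surface_measure (\<lambda>x. f x * Lie j g x)" "integrable surface_measure (\<lambda>x. Lie j f x * g x)"
    using assms by (auto intro!: integrable_surface_continuous poly_continuous_on)
  then show ?thesis
    using integral_Lie_zero[of "\<lambda>x. f x * g x" j] assms by (simp add: Lie_mult real_polynomial_function.intros)
qed

section \<open>Density of polynomials\<close>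

lemma integrable_mult_square:
  fixes f g :: "real^3 \<Rightarrow> real"
  assumes "f \<in> borel_measurable surface_measure" "g \<in> borel_measurable surface_measure"
    and "integrable surface_measure (\<lambda>x. (f x)\<^sup>2)" "integrable surface_measure (\<lambda>x. (g x)\<^sup>2)"
  shows "integrable surface_measure (\<lambda>x. f x * g x)"
proof (rule Bochner_Integration.integrable_bound[where f = "\<lambda>x. (f x)\<^sup>2 + (g x)\<^sup>2"])
  have "\<bar>f x\<bar> * \<bar>g x\<bar> \<le> (f x)\<^sup>2 + (g x)\<^sup>2" for x
  proof -
    have "\<bar>f x\<bar> * \<bar>g x\<bar> \<le> 2 * (\<bar>f x\<bar> * \<bar>g x\<bar>)" by simp
    also have "\<dots> \<le> (f x)\<^sup>2 + (g x)\<^sup>2"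
      using sum_squares_bound[of "\<bar>f x\<bar>" "\<bar>g x\<bar>"] by (simp add: mult.assoc)
    finally show ?thesis .
  qed
  then show "AE x in surface_measure. norm (f x * g x) \<le> norm ((f x)\<^sup>2 + (g x)\<^sup>2)"
    by (simp add: abs_mult)
qed (use assms in auto)

lemma integrable_square_lincomb:
  fixes f g :: "real^3 \<Rightarrow> real"
  assumes "f \<in> borel_measurable surface_measure" "g \<in> borel_measurable surface_measure"
    and "integrable surface_measure (\<lambda>x. (f x)\<^sup>2)" "integrable surface_measure (\<lambda>x. (g x)\<^sup>2)"
  shows "integrable surface_measure (\<lambda>x. (a * f x + b * g x)\<^sup>2)"
proof -
  have "(\<lambda>x. (a * f x + b * g x)\<^sup>2) = (\<lambda>x. a\<^sup>2 * (f x)\<^sup>2 + b\<^sup>2 * (g x)\<^sup>2 + 2 * a * b * (f x * g x))"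
    by (auto simp: power2_eq_square algebra_simps)
  then show ?thesis using assms integrable_mult_square[OF assms] by simp
qed

lemma integral_square_add_le:
  fixes f g :: "real^3 \<Rightarrow> real"
  assumes "f \<in> borel_measurable surface_measure" "g \<in> borel_measurable surface_measure"
    and "integrable surface_measure (\<lambda>x. (f x)\<^sup>2)" "integrable surface_measure (\<lambda>x. (g x)\<^sup>2)"
  shows "(\<integral>x. (f x + g x)\<^sup>2 \<partial>surface_measure) \<le>
    2 * (\<integral>x. (f x)\<^sup>2 \<partial>surface_measure) + 2 * (\<integral>x. (g x)\<^sup>2 \<partial>surface_measure)"
proof -
  have "(\<integral>x. (f x + g x)\<^sup>2 \<partial>surface_measure) \<le> (\<integral>x. 2 * (f x)\<^sup>2 + 2 * (g x)\<^sup>2 \<partial>surface_measure)"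
  proof (rule integral_mono)
    show "integrable surface_measure (\<lambda>x. (f x + g x)\<^sup>2)"
      using integrable_square_lincomb[OF assms, of 1 1] by simp
    show "(f x + g x)\<^sup>2 \<le> 2 * (f x)\<^sup>2 + 2 * (g x)\<^sup>2" for x
      using zero_le_power2[of "f x - g x"] by (simp add: power2_eq_square algebra_simps)
  qed (use assms in simp)
  then show ?thesis using assms by simp
qed

text \<open>Density in L^2, stated for a single function. This class is closed under limits and
  linear combinations, so it can be enlarged from continuous functions to indicators and then to all
  of L^2.\<close>

definition poly_approximable :: "(real^3 \<Rightarrow> real) \<Rightarrow> bool" where
  "poly_approximable f \<longleftrightarrow> f \<in> borel_measurable surface_measure \<and>
     integrable surface_measure (\<lambda>x. (f x)\<^sup>2) \<and>
     (\<forall>e>0. \<exists>g. real_polynomial_function g \<and> (\<integral>x. (f x - g x)\<^sup>2 \<partial>surface_measure) < e)"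

lemma poly_square_integrable:
  assumes "real_polynomial_function g"
  shows "g \<in> borel_measurable surface_measure" "integrable surface_measure (\<lambda>x. (g x)\<^sup>2)"
  using assms by (auto intro!: integrable_surface_continuous poly_continuous_on continuous_intros)

lemma poly_approximable_limit:
  assumes f: "f \<in> borel_measurable surface_measure" "integrable surface_measure (\<lambda>x. (f x)\<^sup>2)"
    and lim: "\<And>e. e > 0 \<Longrightarrow> \<exists>h. poly_approximable h \<and> (\<integral>x. (f x - h x)\<^sup>2 \<partial>surface_measure) < e"
  shows "poly_approximable f"
  unfolding poly_approximable_def
proof (intro conjI allI impI f)
  fix e :: real assume e: "e > 0"
  obtain h where h: "poly_approximable h" "(\<integral>x. (f x - h x)\<^sup>2 \<partial>surface_measure) < e / 4"
    using lim[of "e / 4"] e by auto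
  obtain g where g: "real_polynomial_function g" "(\<integral>x. (h x - g x)\<^sup>2 \<partial>surface_measure) < e / 4"
    using h(1) e unfolding poly_approximable_def by (meson divide_pos_pos zero_less_numeral)
  have hm: "h \<in> borel_measurable surface_measure" "integrable surface_measure (\<lambda>x. (h x)\<^sup>2)"
    using h by (auto simp: poly_approximable_def)
  note gm = poly_square_integrable[OF g(1)]
  have "(\<integral>x. ((f x - h x) + (h x - g x))\<^sup>2 \<partial>surface_measure) \<le>
    2 * (\<integral>x. (f x - h x)\<^sup>2 \<partial>surface_measure) + 2 * (\<integral>x. (h x - g x)\<^sup>2 \<partial>surface_measure)"
    using f hm gm integrable_square_lincomb[of f h 1 "-1"] integrable_square_lincomb[of h g 1 "-1"]
    by (intro integral_square_add_le) auto
  also have "\<dots> < e" using h g by simp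
  finally show "\<exists>g. real_polynomial_function g \<and> (\<integral>x. (f x - g x)\<^sup>2 \<partial>surface_measure) < e"
    using g(1) by auto
qed

lemma poly_approximable_continuous:
  assumes f: "continuous_on S2 f"
  shows "poly_approximable f"
  unfolding poly_approximable_def
proof (intro conjI allI impI)
  show "f \<in> borel_measurable surface_measure" using f by blast
  show "integrable surface_measure (\<lambda>x. (f x)\<^sup>2)"
    using f by (intro integrable_surface_continuous continuous_intros)
  fix e :: real assume e: "e > 0"
  define d where "d = sqrt (e / (8 * pi))"
  have d: "d > 0" "d\<^sup>2 = e / (8 * pi)" using e by (auto simp: d_def)
  obtain g where g: "real_polynomial_function g" "\<And>x. x \<in> S2 \<Longrightarrow> \<bar>f x - g x\<bar> < d"
    using Stone_Weierstrass_real_polynomial_function[OF compact_sphere f d(1)] by metis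
  have "(\<integral>x. (f x - g x)\<^sup>2 \<partial>surface_measure) \<le> (\<integral>x. d\<^sup>2 \<partial>surface_measure)"
  proof (rule integral_mono)
    show "integrable surface_measure (\<lambda>x. (f x - g x)\<^sup>2)"
      by (intro integrable_surface_continuous continuous_on_power continuous_on_diff f
          poly_continuous_on[OF g(1)])
    show "(f x - g x)\<^sup>2 \<le> d\<^sup>2" if "x \<in> space surface_measure" for x
      using g(2)[of x] that d(1) by (simp add: abs_le_square_iff[symmetric] less_imp_le)
  qed simp
  also have "\<dots> < e" using e by (simp add: measure_surface_space d)
  finally show "\<exists>g. real_polynomial_function g \<and> (\<integral>x. (f x - g x)\<^sup>2 \<partial>surface_measure) < e"
    using g(1) by auto
qed

lemma poly_approximable_lincomb:
  assumes f: "poly_approximable f" and g: "poly_approximable g"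
  shows "poly_approximable (\<lambda>x. a * f x + b * g x)"
  unfolding poly_approximable_def
proof (intro conjI allI impI)
  have fm: "f \<in> borel_measurable surface_measure" "integrable surface_measure (\<lambda>x. (f x)\<^sup>2)"
    and gm: "g \<in> borel_measurable surface_measure" "integrable surface_measure (\<lambda>x. (g x)\<^sup>2)"
    using f g by (auto simp: poly_approximable_def)
  show "(\<lambda>x. a * f x + b * g x) \<in> borel_measurable surface_measure"
    using fm gm by measurable
  show "integrable surface_measure (\<lambda>x. (a * f x + b * g x)\<^sup>2)"
    by (rule integrable_square_lincomb[OF fm(1) gm(1) fm(2) gm(2)])
  fix e :: real assume e: "e > 0"
  define d where "d = e / (2 * (a\<^sup>2 + b\<^sup>2 + 1))"
  have pos: "a\<^sup>2 + b\<^sup>2 + 1 > 0" by (simp add: add_nonneg_pos)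
  then have d: "d > 0" using e by (simp add: d_def)
  obtain F where F: "real_polynomial_function F" "(\<integral>x. (f x - F x)\<^sup>2 \<partial>surface_measure) < d"
    using f d by (auto simp: poly_approximable_def)
  obtain G where G: "real_polynomial_function G" "(\<integral>x. (g x - G x)\<^sup>2 \<partial>surface_measure) < d"
    using g d by (auto simp: poly_approximable_def)
  note Fm = poly_square_integrable[OF F(1)] and Gm = poly_square_integrable[OF G(1)]
  have i: "integrable surface_measure (\<lambda>x. (f x - F x)\<^sup>2)" "integrable surface_measure (\<lambda>x. (g x - G x)\<^sup>2)"
    using fm gm Fm Gm integrable_square_lincomb[of f F 1 "-1"] integrable_square_lincomb[of g G 1 "-1"]
    by auto
  have "(\<integral>x. (a * (f x - F x) + b * (g x - G x))\<^sup>2 \<partial>surface_measure) \<le>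
    2 * (\<integral>x. (a * (f x - F x))\<^sup>2 \<partial>surface_measure) + 2 * (\<integral>x. (b * (g x - G x))\<^sup>2 \<partial>surface_measure)"
    using fm gm Fm Gm i by (intro integral_square_add_le) (auto simp: power_mult_distrib)
  also have "\<dots> = 2 * (a\<^sup>2 * (\<integral>x. (f x - F x)\<^sup>2 \<partial>surface_measure) + b\<^sup>2 * (\<integral>x. (g x - G x)\<^sup>2 \<partial>surface_measure))"
    by (simp add: power_mult_distrib)
  also have "\<dots> \<le> 2 * (a\<^sup>2 * d + b\<^sup>2 * d)"
    using F G by (intro mult_left_mono add_mono) auto
  also have "\<dots> < 2 * ((a\<^sup>2 + b\<^sup>2 + 1) * d)" using d by (simp add: algebra_simps)
  also have "\<dots> = e" using less_imp_neq[OF pos] unfolding d_def by (simp only: times_divide_eq_right) (simp add: field_simps)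
  finally have "(\<integral>x. (a * f x + b * g x - (a * F x + b * G x))\<^sup>2 \<partial>surface_measure) < e"
    by (simp add: algebra_simps)
  moreover have "real_polynomial_function (\<lambda>x. a * F x + b * G x)"
    using F(1) G(1) by (simp add: real_polynomial_function.intros)
  ultimately show "\<exists>h. real_polynomial_function h \<and> (\<integral>x. (a * f x + b * g x - h x)\<^sup>2 \<partial>surface_measure) < e"
    by blast
qed

lemma poly_approximable_sum:
  assumes "finite I" "\<And>i. i \<in> I \<Longrightarrow> poly_approximable (f i)"
  shows "poly_approximable (\<lambda>x. \<Sum>i\<in>I. c i * f i x)"
  using assms
proof (induction I)
  case empty
  show ?case using poly_approximable_continuous[OF continuous_on_const[of S2 0]] by simp
next
  case (insert i I)
  then show ?case using poly_approximable_lincomb[of "f i" "\<lambda>x. \<Sum>i\<in>I. c i * f i x" "c i" 1] by simp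
qed

lemma poly_approximable_indicator_closed:
  assumes K: "closed K"
  shows "poly_approximable (indicator K)"
proof (cases "K = {}")
  case True
  then have "indicator K = (\<lambda>x::real^3. 0::real)" by auto
  then show ?thesis using poly_approximable_continuous[OF continuous_on_const[of S2 0]] by simp
next
  case False
  have Km: "(indicator K :: real^3 \<Rightarrow> real) \<in> borel_measurable surface_measure"
  proof -
    have "K \<inter> S2 \<in> sets surface_measure"
      using K by (simp add: sets_restrict_space_iff borel_closed)
    then show ?thesis by (simp add: borel_measurable_indicator_iff)
  qed
  \<comment> \<open>Tent functions: 1 on \<open>K\<close> and, for n > 0, zero at distance 1 / n and
    beyond. As \<open>K\<close> is closed, they converge to its indicator at every point.\<close>
  define u where "u n x = max 0 (1 - real n * infdist x K)" for n and x :: "real^3"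
  have u: "continuous_on S2 (u n)" for n
    unfolding u_def by (intro continuous_intros)
  have lim: "(\<lambda>n. u n x) \<longlonglongrightarrow> indicator K x" for x
  proof (cases "x \<in> K")
    case True then show ?thesis by (simp add: u_def)
  next
    case False
    then have pos: "infdist x K > 0"
      using K \<open>K \<noteq> {}\<close> in_closed_iff_infdist_zero infdist_nonneg by (metis order_le_less)
    obtain N :: nat where N: "1 / infdist x K < real N" using reals_Archimedean2 by blast
    have "u n x = 0" if "n \<ge> N" for n
    proof -
      have "1 < real N * infdist x K" using N pos by (simp add: field_simps)
      also have "\<dots> \<le> real n * infdist x K" using that pos by (intro mult_right_mono) auto
      finally show ?thesis by (simp add: u_def)
    qed
    then have "eventually (\<lambda>n. u n x = 0) sequentially"
      by (auto simp: eventually_sequentially)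
    then show ?thesis using False by (simp add: tendsto_eventually)
  qed
  have bnd: "\<bar>u n x\<bar> \<le> 1" for n x by (auto simp: u_def infdist_nonneg)
  have "(\<lambda>n. \<integral>x. (indicator K x - u n x)\<^sup>2 \<partial>surface_measure) \<longlonglongrightarrow> (\<integral>x. 0 \<partial>surface_measure)"
  proof (rule integral_dominated_convergence[where w = "\<lambda>x. 4"])
    show "(\<lambda>x. (indicator K x - u n x)\<^sup>2) \<in> borel_measurable surface_measure" for n
      using Km borel_measurable_surface_continuous[OF u[of n]] by measurable
    have "(\<lambda>n. (indicator K x - u n x)\<^sup>2) \<longlonglongrightarrow> (indicator K x - indicator K x)\<^sup>2" for x
      by (intro tendsto_intros lim)
    then show "AE x in surface_measure. (\<lambda>n. (indicator K x - u n x)\<^sup>2) \<longlonglongrightarrow> 0" by simp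
    have "\<bar>indicator K x - u n x\<bar> \<le> 2" for n x
      using bnd[of n x] by (auto simp: indicator_def)
    then have "(indicator K x - u n x)\<^sup>2 \<le> 2\<^sup>2" for n x
      by (metis abs_le_square_iff abs_numeral)
    then show "AE x in surface_measure. norm ((indicator K x - u n x)\<^sup>2) \<le> 4" for n by simp
  qed simp_all
  then have conv: "(\<lambda>n. \<integral>x. (indicator K x - u n x)\<^sup>2 \<partial>surface_measure) \<longlonglongrightarrow> 0" by simp
  show ?thesis
  proof (rule poly_approximable_limit[OF Km])
    show "integrable surface_measure (\<lambda>x. (indicator K x :: real)\<^sup>2)"
      using borel_measurable_power[OF Km, of 2] by (intro bounded_measurable_integrable[where B = 1]) (auto simp: indicator_def)
    fix e :: real assume "e > 0"
    then have "eventually (\<lambda>n. (\<integral>x. (indicator K x - u n x)\<^sup>2 \<partial>surface_measure) < e) sequentially"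
      using order_tendstoD(2)[OF conv] by simp
    then obtain n where "(\<integral>x. (indicator K x - u n x)\<^sup>2 \<partial>surface_measure) < e"
      by (auto simp: eventually_sequentially)
    then show "\<exists>h. poly_approximable h \<and> (\<integral>x. (indicator K x - h x)\<^sup>2 \<partial>surface_measure) < e"
      using poly_approximable_continuous[OF u[of n]] by blast
  qed
qed

lemma poly_approximable_indicator:
  assumes A: "A \<in> sets surface_measure"
  shows "poly_approximable (indicator A)"
proof (rule poly_approximable_limit)
  show Am: "(indicator A :: real^3 \<Rightarrow> real) \<in> borel_measurable surface_measure" using A by simp
  show "integrable surface_measure (\<lambda>x. (indicator A x :: real)\<^sup>2)"
    using borel_measurable_power[OF Am, of 2]
    by (intro bounded_measurable_integrable[where B = 1]) (auto simp: indicator_def)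
  fix e :: real assume e: "e > 0"
  have AS: "A \<subseteq> S2" "A \<in> sets borel"
    using A by (auto simp: sets_restrict_space_iff borel_closed)
  \<comment> \<open>\<open>inner_regular\<close> speaks of a finite measure on the Borel sets of the
    whole space, so the surface measure is pushed forward along the inclusion.\<close>
  define N where "N = distr surface_measure borel (\<lambda>x::real^3. x)"
  have idm: "(\<lambda>x::real^3. x) \<in> measurable surface_measure borel"
    by (rule borel_measurable_surface_continuous) (rule continuous_on_id)
  have N: "emeasure N B = emeasure surface_measure (B \<inter> S2)" if "B \<in> sets borel" for B
    unfolding N_def by (subst emeasure_distr[OF idm that]) (simp add: vimage_def Int_def)
  have "sets N = sets borel" "emeasure N (space N) \<noteq> \<infinity>"
    using N[of UNIV] by (auto simp: N_def emeasure_surface_measure_S2)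
  from inner_regular[OF this AS(2)] have sup: "emeasure N A = (SUP K \<in> {K. K \<subseteq> A \<and> compact K}. emeasure N K)" .
  have "\<exists>K. K \<subseteq> A \<and> compact K \<and> emeasure N A < emeasure N K + ennreal e"
  proof (cases "emeasure N A = 0")
    case True
    then show ?thesis using e by (intro exI[of _ "{}"]) auto
  next
    case False
    define a where "a = measure surface_measure (A \<inter> S2)"
    have a: "emeasure N A = ennreal a"
      using N[OF AS(2)] by (simp add: a_def surface.emeasure_eq_measure)
    then have "a > 0" using False by (simp add: ennreal_eq_0_iff)
    \<comment> \<open>If \<open>a - e\<close> is negative, \<open>ennreal\<close> sends it to 0,
      which is still below the supremum because \<open>a > 0\<close>.\<close>
    then have "ennreal (a - e) < (SUP K \<in> {K. K \<subseteq> A \<and> compact K}. emeasure N K)"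
      using e unfolding sup[symmetric] a by (intro ennreal_lessI) auto
    then obtain K where K: "K \<subseteq> A" "compact K" "ennreal (a - e) < emeasure N K"
      unfolding less_SUP_iff by auto
    define k where "k = measure surface_measure (K \<inter> S2)"
    have k: "emeasure N K = ennreal k" "k \<ge> 0"
      using N[of K] K(2) by (simp_all add: k_def surface.emeasure_eq_measure borel_compact)
    have "a - e < k"
      using K(3) unfolding k(1) by (metis ennreal_leI leD not_le_imp_less)
    then have "ennreal a < ennreal (k + e)" using k e by (intro ennreal_lessI) auto
    then show ?thesis using K k e a by (intro exI[of _ K]) (simp add: ennreal_plus)
  qed
  then obtain K where K: "K \<subseteq> A" "compact K" "emeasure N A < emeasure N K + ennreal e" by blast
  have Kb: "K \<in> sets borel" using K by (simp add: borel_compact)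
  have Ks: "K \<in> sets surface_measure" using K AS by (simp add: sets_restrict_space_iff borel_closed Kb)
  have "emeasure surface_measure A < emeasure surface_measure K + ennreal e"
    using K N[OF AS(2)] N[OF Kb] AS by (simp add: Int_absorb2 inf_absorb1 order_trans[OF K(1) AS(1)])
  then have lt: "measure surface_measure A < measure surface_measure K + e"
    using e by (simp add: surface.emeasure_eq_measure ennreal_plus[symmetric] ennreal_less_iff del: ennreal_plus)
  have "(\<integral>x. (indicator A x - indicator K x)\<^sup>2 \<partial>surface_measure) = (\<integral>x. (indicator (A - K) x :: real) \<partial>surface_measure)"
    using K(1) by (intro Bochner_Integration.integral_cong) (auto simp: indicator_def)
  also have "\<dots> = measure surface_measure (A - K)"
  proof -
    have "(A - K) \<inter> S2 = A - K" using AS(1) by auto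
    then show ?thesis by simp
  qed
  also have "\<dots> < e" using lt A Ks K(1) by (simp add: surface.finite_measure_Diff)
  finally show "\<exists>h. poly_approximable h \<and> (\<integral>x. (indicator A x - h x)\<^sup>2 \<partial>surface_measure) < e"
    using poly_approximable_indicator_closed[OF compact_imp_closed[OF K(2)]] by blast
qed

theorem poly_dense_L2:
  assumes f: "f \<in> borel_measurable surface_measure" "integrable surface_measure (\<lambda>x. (f x)\<^sup>2)"
  shows "poly_approximable f"
proof -
  obtain F where F: "\<And>i. simple_function surface_measure (F i)"
    "\<And>x. x \<in> S2 \<Longrightarrow> (\<lambda>i. F i x) \<longlonglongrightarrow> f x"
    "\<And>i x. x \<in> S2 \<Longrightarrow> dist (F i x) 0 \<le> 2 * dist (f x) 0"
    using borel_measurable_implies_sequence_metric[OF f(1), of 0]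
    unfolding space_surface_measure by metis
  \<comment> \<open>Agrees with \<open>F i\<close> on the sphere, but is visibly a finite
    combination of indicators.\<close>
  define h where "h i x = (\<Sum>y\<in>F i ` S2. y * indicator (F i -` {y} \<inter> S2) x)" for i x
  have h: "poly_approximable (h i)" for i
    unfolding h_def
  proof (rule poly_approximable_sum)
    show "finite (F i ` S2)" using simple_functionD(1)[OF F(1), of i] by simp
    show "poly_approximable (indicator (F i -` {y} \<inter> S2))" for y
      using simple_functionD(2)[OF F(1), of i "{y}"] by (intro poly_approximable_indicator) simp
  qed
  have hF: "h i x = F i x" if "x \<in> S2" for i x
  proof -
    have "h i x = (\<Sum>y\<in>F i ` S2. if y = F i x then y else 0)"
      unfolding h_def using that by (intro sum.cong) (auto simp: indicator_def)
    also have "\<dots> = F i x" using that simple_functionD(1)[OF F(1), of i] by (subst sum.delta) auto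
    finally show ?thesis .
  qed
  have "(\<lambda>n. \<integral>x. (f x - h n x)\<^sup>2 \<partial>surface_measure) \<longlonglongrightarrow> (\<integral>x. 0 \<partial>surface_measure)"
  \<comment> \<open>\<open>F n\<close> is at most \<open>2 * \<bar>f\<bar>\<close> in modulus, so
    the difference is at most \<open>3 * \<bar>f\<bar>\<close>; hence the factor 9.\<close>
  proof (rule integral_dominated_convergence[where w = "\<lambda>x. 9 * (f x)\<^sup>2"])
    show "(\<lambda>x. (f x - h n x)\<^sup>2) \<in> borel_measurable surface_measure" for n
    proof -
      have "h n \<in> borel_measurable surface_measure" using h[of n] by (simp only: poly_approximable_def)
      with f(1) show ?thesis by measurable
    qed
    have "(\<lambda>n. (f x - h n x)\<^sup>2) \<longlonglongrightarrow> (f x - f x)\<^sup>2" if "x \<in> S2" for x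
      unfolding hF[OF that] by (intro tendsto_intros F(2) that)
    then show "AE x in surface_measure. (\<lambda>n. (f x - h n x)\<^sup>2) \<longlonglongrightarrow> 0" by (auto intro!: AE_I2)
    have "(f x - h n x)\<^sup>2 \<le> 9 * (f x)\<^sup>2" if "x \<in> S2" for n x
    proof -
      have "\<bar>f x - h n x\<bar> \<le> \<bar>3 * f x\<bar>"
        using F(3)[OF that, of n] by (simp add: hF[OF that] dist_real_def)
      then show ?thesis by (simp add: abs_le_square_iff power_mult_distrib)
    qed
    then show "AE x in surface_measure. norm ((f x - h n x)\<^sup>2) \<le> 9 * (f x)\<^sup>2" for n
      by (intro AE_I2) simp
  qed (use f in simp_all)
  then have conv: "(\<lambda>n. \<integral>x. (f x - h n x)\<^sup>2 \<partial>surface_measure) \<longlonglongrightarrow> 0" by simp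
  show ?thesis
  proof (rule poly_approximable_limit[OF f])
    fix e :: real assume "e > 0"
    then have "eventually (\<lambda>n. (\<integral>x. (f x - h n x)\<^sup>2 \<partial>surface_measure) < e) sequentially"
      using order_tendstoD(2)[OF conv] by simp
    then obtain n where "(\<integral>x. (f x - h n x)\<^sup>2 \<partial>surface_measure) < e"
      by (auto simp: eventually_sequentially)
    then show "\<exists>h. poly_approximable h \<and> (\<integral>x. (f x - h x)\<^sup>2 \<partial>surface_measure) < e"
      using h by blast
  qed
qed

section \<open>Orthonormal systems\<close>

lemma S2_Lp_2_iff:
  "S2_Lp 2 f \<longleftrightarrow> f \<in> borel_measurable surface_measure \<and>
     integrable surface_measure (\<lambda>x. f x \<bullet> f x)"
proof -
  have "norm (f x) powr 2 = f x \<bullet> f x" for x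
    by (cases "f x = 0") (simp_all add: powr_numeral dot_square_norm)
  then show ?thesis by (simp add: S2_Lp_def)
qed

lemma L2_measurable: "S2_Lp 2 f \<Longrightarrow> f \<in> borel_measurable surface_measure"
  by (simp add: S2_Lp_def)

lemma L2_integrable_inner:
  assumes "S2_Lp 2 f" "S2_Lp 2 g"
  shows "integrable surface_measure (\<lambda>x. f x \<bullet> g x)"
proof (rule Bochner_Integration.integrable_bound[where f = "\<lambda>x. f x \<bullet> f x + g x \<bullet> g x"])
  have "\<bar>f x \<bullet> g x\<bar> \<le> f x \<bullet> f x + g x \<bullet> g x" for x
  proof -
    have "0 \<le> (f x - g x) \<bullet> (f x - g x)" "0 \<le> (f x + g x) \<bullet> (f x + g x)"
      by (rule inner_ge_zero)+
    then have "2 * \<bar>f x \<bullet> g x\<bar> \<le> f x \<bullet> f x + g x \<bullet> g x"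
      unfolding inner_diff_left inner_diff_right inner_add_left inner_add_right
      by (simp add: inner_commute[of "g x" "f x"])
    then show ?thesis by (rule order_trans[rotated]) simp
  qed
  then show "AE x in surface_measure. norm (f x \<bullet> g x) \<le> norm (f x \<bullet> f x + g x \<bullet> g x)"
    by (auto simp: abs_of_nonneg intro: order_trans)
qed (use assms in \<open>auto simp: S2_Lp_2_iff\<close>)

lemma L2_zero: "S2_Lp 2 (\<lambda>x. 0)"
  by (simp add: S2_Lp_2_iff)

lemma L2_scaleR:
  assumes "S2_Lp 2 f"
  shows "S2_Lp 2 (\<lambda>x. c *\<^sub>R f x)"
  using assms by (auto simp: S2_Lp_2_iff)

lemma L2_add:
  assumes "S2_Lp 2 f" "S2_Lp 2 g"
  shows "S2_Lp 2 (\<lambda>x. f x + g x)"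
  using assms L2_integrable_inner[OF assms] L2_integrable_inner[OF assms(2,1)]
  by (auto simp: S2_Lp_2_iff inner_add_left inner_add_right)

lemma L2_sum:
  assumes "\<And>i. i \<in> I \<Longrightarrow> S2_Lp 2 (f i)"
  shows "S2_Lp 2 (\<lambda>x. \<Sum>i\<in>I. c i *\<^sub>R f i x)"
  using assms
proof (induction I rule: infinite_finite_induct)
  case (insert i I)
  then show ?case using L2_add[OF L2_scaleR, of "f i" "\<lambda>x. \<Sum>i\<in>I. c i *\<^sub>R f i x" "c i"] by simp
qed (simp_all add: L2_zero)

lemma L2_diff:
  assumes "S2_Lp 2 f" "S2_Lp 2 g"
  shows "S2_Lp 2 (\<lambda>x. f x - g x)"
  using L2_add[OF assms(1) L2_scaleR[OF assms(2)], of "-1"] by simp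

lemma S2_inner_commute: "S2_inner f g = S2_inner g f"
  by (simp add: S2_inner_def inner_commute)

lemma S2_inner_nonneg: "S2_inner f f \<ge> 0"
  by (simp add: S2_inner_def)

lemma S2_inner_cong:
  assumes "\<And>x. x \<in> S2 \<Longrightarrow> f x = f' x" "\<And>x. x \<in> S2 \<Longrightarrow> g x = g' x"
  shows "S2_inner f g = S2_inner f' g'"
  unfolding S2_inner_def by (rule Bochner_Integration.integral_cong) (use assms in auto)

lemma S2_inner_zero [simp]: "S2_inner (\<lambda>x. 0) g = 0" "S2_inner g (\<lambda>x. 0) = 0"
  by (simp_all add: S2_inner_def)

lemma S2_inner_add_left:
  assumes "S2_Lp 2 f" "S2_Lp 2 f'" "S2_Lp 2 g"
  shows "S2_inner (\<lambda>x. f x + f' x) g = S2_inner f g + S2_inner f' g"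
  using assms by (simp add: S2_inner_def inner_add_left L2_integrable_inner)

lemma S2_inner_scaleR_left: "S2_inner (\<lambda>x. c *\<^sub>R f x) g = c * S2_inner f g"
  by (simp add: S2_inner_def)

lemma S2_inner_sum_left:
  assumes "\<And>i. i \<in> I \<Longrightarrow> S2_Lp 2 (f i)" "S2_Lp 2 g"
  shows "S2_inner (\<lambda>x. \<Sum>i\<in>I. c i *\<^sub>R f i x) g = (\<Sum>i\<in>I. c i * S2_inner (f i) g)"
  using assms
proof (induction I rule: infinite_finite_induct)
  case (insert i I)
  then show ?case
    using S2_inner_add_left[OF L2_scaleR L2_sum, of "f i" I f g "c i" c]
    by (simp add: S2_inner_scaleR_left)
qed simp_all

lemma S2_inner_sum_right:
  assumes "\<And>i. i \<in> I \<Longrightarrow> S2_Lp 2 (f i)" "S2_Lp 2 g"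
  shows "S2_inner g (\<lambda>x. \<Sum>i\<in>I. c i *\<^sub>R f i x) = (\<Sum>i\<in>I. c i * S2_inner g (f i))"
  using S2_inner_sum_left[OF assms] by (simp add: S2_inner_commute)

lemma S2_inner_diff_left:
  assumes "S2_Lp 2 f" "S2_Lp 2 f'" "S2_Lp 2 g"
  shows "S2_inner (\<lambda>x. f x - f' x) g = S2_inner f g - S2_inner f' g"
  using S2_inner_add_left[OF assms(1) L2_scaleR[OF assms(2)] assms(3), of "-1"]
  by (simp add: S2_inner_def)

lemma S2_inner_diff_right:
  assumes "S2_Lp 2 f" "S2_Lp 2 f'" "S2_Lp 2 g"
  shows "S2_inner g (\<lambda>x. f x - f' x) = S2_inner g f - S2_inner g f'"
  using S2_inner_diff_left[OF assms] by (simp add: S2_inner_commute)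

text \<open>Vectors of norm zero are admitted, so that no linear independence is ever needed.\<close>

definition orthonormal0 :: "'i set \<Rightarrow> ('i \<Rightarrow> real^3 \<Rightarrow> 'a::euclidean_space) \<Rightarrow> bool" where
  "orthonormal0 I u \<longleftrightarrow> (\<forall>i\<in>I. S2_Lp 2 (u i) \<and> S2_inner (u i) (u i) \<in> {0, 1}) \<and>
     (\<forall>i\<in>I. \<forall>j\<in>I. i \<noteq> j \<longrightarrow> S2_inner (u i) (u j) = 0)"

lemma S2_inner_sums:
  assumes "orthonormal0 I u" "finite I"
  shows "S2_inner (\<lambda>x. \<Sum>i\<in>I. c i *\<^sub>R u i x) (\<lambda>x. \<Sum>i\<in>I. d i *\<^sub>R u i x)
    = (\<Sum>i\<in>I. c i * d i * S2_inner (u i) (u i))"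
proof -
  have L: "S2_Lp 2 (u i)" if "i \<in> I" for i using assms(1) that by (auto simp: orthonormal0_def)
  have "S2_inner (\<lambda>x. \<Sum>i\<in>I. c i *\<^sub>R u i x) (\<lambda>x. \<Sum>i\<in>I. d i *\<^sub>R u i x)
    = (\<Sum>i\<in>I. c i * (\<Sum>j\<in>I. d j * S2_inner (u i) (u j)))"
    using L by (simp add: S2_inner_sum_left S2_inner_sum_right L2_sum)
  also have "\<dots> = (\<Sum>i\<in>I. c i * (\<Sum>j\<in>I. if j = i then d i * S2_inner (u i) (u i) else 0))"
    using assms(1) by (intro sum.cong refl arg_cong2[where f = "(*)"]) (auto simp: orthonormal0_def)
  also have "\<dots> = (\<Sum>i\<in>I. c i * d i * S2_inner (u i) (u i))"
    using assms(2) by (simp add: mult.assoc)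
  finally show ?thesis .
qed

text \<open>The coefficients \<open>d\<close> stay free at vectors of norm zero:
  \<open>best_approximation\<close> applies the identity with coefficients that may differ there
  from the inner products.\<close>

lemma bessel_identity:
  assumes u: "orthonormal0 I u" "finite I" and f: "S2_Lp 2 f"
    and eq: "\<And>i. i \<in> I \<Longrightarrow> d i * S2_inner (u i) (u i) = S2_inner f (u i) * S2_inner (u i) (u i)"
    and ne: "\<And>i. i \<in> I \<Longrightarrow> S2_inner (u i) (u i) = 0 \<Longrightarrow> S2_inner f (u i) = 0"
  shows "S2_inner (\<lambda>x. f x - (\<Sum>i\<in>I. d i *\<^sub>R u i x)) (\<lambda>x. f x - (\<Sum>i\<in>I. d i *\<^sub>R u i x))
    = S2_inner f f - (\<Sum>i\<in>I. (S2_inner f (u i))\<^sup>2)"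
proof -
  define s where "s x = (\<Sum>i\<in>I. d i *\<^sub>R u i x)" for x
  have L: "S2_Lp 2 (u i)" if "i \<in> I" for i using u(1) that by (auto simp: orthonormal0_def)
  then have Ls: "S2_Lp 2 s" unfolding s_def by (rule L2_sum)
  have d: "d i * S2_inner f (u i) = (S2_inner f (u i))\<^sup>2"
    "d i * d i * S2_inner (u i) (u i) = (S2_inner f (u i))\<^sup>2" if "i \<in> I" for i
    using u(1) that eq[OF that] ne[OF that] by (auto simp: orthonormal0_def power2_eq_square)
  have "S2_inner f s = (\<Sum>i\<in>I. (S2_inner f (u i))\<^sup>2)"
    unfolding s_def using L f d by (simp add: S2_inner_sum_right)
  moreover have "S2_inner s s = (\<Sum>i\<in>I. (S2_inner f (u i))\<^sup>2)"
    unfolding s_def S2_inner_sums[OF u] using d by simp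
  moreover have "S2_inner (\<lambda>x. f x - s x) (\<lambda>x. f x - s x) = S2_inner f f - 2 * S2_inner f s + S2_inner s s"
    using f Ls by (simp add: S2_inner_diff_left S2_inner_diff_right L2_diff S2_inner_commute[of s f])
  ultimately show ?thesis by (simp add: s_def)
qed

lemma S2_inner_null:
  assumes "S2_Lp 2 f" "S2_Lp 2 g" "S2_inner g g = 0"
  shows "S2_inner f g = 0"
proof -
  have "AE x in surface_measure. g x \<bullet> g x = 0"
    using assms(2,3) L2_integrable_inner[OF assms(2,2)] unfolding S2_inner_def
    by (subst (asm) integral_nonneg_eq_0_iff_AE) auto
  then have "AE x in surface_measure. f x \<bullet> g x = 0" by eventually_elim simp
  then show ?thesis unfolding S2_inner_def by (rule integral_eq_zero_AE)
qed

lemma bessel_identity':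
  assumes u: "orthonormal0 I u" "finite I" and f: "S2_Lp 2 f"
  shows "S2_inner (\<lambda>x. f x - (\<Sum>i\<in>I. S2_inner f (u i) *\<^sub>R u i x))
      (\<lambda>x. f x - (\<Sum>i\<in>I. S2_inner f (u i) *\<^sub>R u i x))
    = S2_inner f f - (\<Sum>i\<in>I. (S2_inner f (u i))\<^sup>2)"
  using u f by (intro bessel_identity) (auto simp: orthonormal0_def intro: S2_inner_null)

lemma bessel:
  assumes "orthonormal0 I u" "finite I" "S2_Lp 2 f"
  shows "(\<Sum>i\<in>I. (S2_inner f (u i))\<^sup>2) \<le> S2_inner f f"
  using bessel_identity'[OF assms]
    S2_inner_nonneg[of "\<lambda>x. f x - (\<Sum>i\<in>I. S2_inner f (u i) *\<^sub>R u i x)"] by simp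

text \<open>For g = f - \<Sum> c_i u_i, subtracting the projection of g leaves the same vector as
  subtracting the projection of f. Bessel's identity for g therefore shows that the two sides differ
  by a sum of squares.\<close>

lemma best_approximation:
  assumes u: "orthonormal0 I u" "finite I" and f: "S2_Lp 2 f"
  shows "S2_inner (\<lambda>x. f x - (\<Sum>i\<in>I. S2_inner f (u i) *\<^sub>R u i x))
      (\<lambda>x. f x - (\<Sum>i\<in>I. S2_inner f (u i) *\<^sub>R u i x))
    \<le> S2_inner (\<lambda>x. f x - (\<Sum>i\<in>I. c i *\<^sub>R u i x)) (\<lambda>x. f x - (\<Sum>i\<in>I. c i *\<^sub>R u i x))"
proof -
  define g where "g x = f x - (\<Sum>i\<in>I. c i *\<^sub>R u i x)" for x
  have L: "S2_Lp 2 (u i)" if "i \<in> I" for i using u(1) that by (auto simp: orthonormal0_def)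
  have g: "S2_Lp 2 g" unfolding g_def using L by (intro L2_diff f L2_sum)
  define N where "N i = S2_inner (u i) (u i)" for i
  have gu: "S2_inner g (u i) = S2_inner f (u i) - c i * N i" if i: "i \<in> I" for i
  proof -
    have "S2_inner (\<lambda>x. \<Sum>j\<in>I. c j *\<^sub>R u j x) (u i) = (\<Sum>j\<in>I. c j * S2_inner (u j) (u i))"
      using L i by (intro S2_inner_sum_left) auto
    also have "\<dots> = (\<Sum>j\<in>I. if j = i then c i * N i else 0)"
      using u(1) i by (intro sum.cong) (auto simp: orthonormal0_def N_def)
    also have "\<dots> = c i * N i" using i u(2) by simp
    finally show ?thesis
      unfolding g_def using S2_inner_diff_left[OF f L2_sum L[OF i], of I u c] L by simp
  qed
  have null: "S2_inner f (u i) = 0" if "i \<in> I" "N i = 0" for i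
    using S2_inner_null[OF f L[OF that(1)]] that by (simp add: N_def)
  have N01: "N i \<in> {0, 1}" if "i \<in> I" for i using u(1) that by (auto simp: orthonormal0_def N_def)
  have "S2_inner (\<lambda>x. g x - (\<Sum>i\<in>I. (S2_inner f (u i) - c i) *\<^sub>R u i x))
      (\<lambda>x. g x - (\<Sum>i\<in>I. (S2_inner f (u i) - c i) *\<^sub>R u i x))
    = S2_inner g g - (\<Sum>i\<in>I. (S2_inner g (u i))\<^sup>2)"
  proof (rule bessel_identity[OF u g])
    fix i assume i: "i \<in> I"
    show "(S2_inner f (u i) - c i) * S2_inner (u i) (u i) = S2_inner g (u i) * S2_inner (u i) (u i)"
      using N01[OF i] gu[OF i] by (auto simp: N_def)
    show "S2_inner g (u i) = 0" if "S2_inner (u i) (u i) = 0"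
      using gu[OF i] null[OF i] that by (simp add: N_def)
  qed
  moreover have "(\<lambda>x. g x - (\<Sum>i\<in>I. (S2_inner f (u i) - c i) *\<^sub>R u i x))
    = (\<lambda>x. f x - (\<Sum>i\<in>I. S2_inner f (u i) *\<^sub>R u i x))"
    by (auto simp: g_def scaleR_diff_left sum_subtractf)
  moreover have "(\<Sum>i\<in>I. (S2_inner g (u i))\<^sup>2) \<ge> 0" by (simp add: sum_nonneg)
  ultimately show ?thesis by (simp add: g_def[abs_def])
qed

section \<open>The spherical Laplacian on monomials\<close>

lemma poly_L2:
  assumes "real_polynomial_function (f :: real^3 \<Rightarrow> real)"
  shows "S2_Lp 2 f"
  unfolding S2_Lp_2_iff using assms
  by (auto intro!: borel_measurable_surface_continuous integrable_surface_continuous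
      poly_continuous_on)

lemma Lie_adjoint:
  assumes "real_polynomial_function f" "real_polynomial_function g"
  shows "S2_inner (Lie j f) g = - S2_inner f (Lie j g)"
  using integral_Lie_by_parts[OF assms] by (simp add: S2_inner_def)

text \<open>On the sphere this is the Laplace-Beltrami operator.\<close>

definition Lap :: "(real^3 \<Rightarrow> real) \<Rightarrow> real^3 \<Rightarrow> real" where
  "Lap f x = (\<Sum>j\<in>UNIV. Lie j (Lie j f) x)"

lemma poly_Lap [intro]: "real_polynomial_function f \<Longrightarrow> real_polynomial_function (Lap f)"
proof -
  assume "real_polynomial_function f"
  then have "real_polynomial_function (\<lambda>x. \<Sum>j\<in>UNIV. Lie j (Lie j f) x)"
    by (intro real_polynomial_function_sum poly_Lie) auto
  then show ?thesis by (simp add: Lap_def[abs_def])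
qed

lemma Lie_sum_fun:
  assumes "finite I" "\<And>i. i \<in> I \<Longrightarrow> real_polynomial_function (f i)"
  shows "Lie j (\<lambda>x. \<Sum>i\<in>I. c i * f i x) = (\<lambda>x. \<Sum>i\<in>I. c i * Lie j (f i) x)"
  using assms by (auto simp: Lie_sum Lie_cmult real_polynomial_function.intros)

lemma Lap_sum:
  assumes "finite I" "\<And>i. i \<in> I \<Longrightarrow> real_polynomial_function (f i)"
  shows "Lap (\<lambda>x. \<Sum>i\<in>I. c i * f i x) x = (\<Sum>i\<in>I. c i * Lap (f i) x)"
proof -
  have *: "Lie j (Lie j (\<lambda>x. \<Sum>i\<in>I. c i * f i x)) x = (\<Sum>i\<in>I. c i * Lie j (Lie j (f i)) x)" for j
    using assms by (simp add: Lie_sum_fun poly_Lie)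
  show ?thesis
    unfolding Lap_def * sum_distrib_left by (rule sum.swap)
qed

lemma S2_inner_real_sum_left:
  assumes "\<And>i. i \<in> I \<Longrightarrow> real_polynomial_function (f i)" "real_polynomial_function g"
  shows "S2_inner (\<lambda>x. \<Sum>i\<in>I. c i * f i x) g = (\<Sum>i\<in>I. c i * S2_inner (f i) g)"
  using S2_inner_sum_left[of I f g c] assms poly_L2 by auto

lemma Lap_adjoint:
  assumes "real_polynomial_function f" "real_polynomial_function g"
  shows "S2_inner (Lap f) g = - (\<Sum>j\<in>UNIV. S2_inner (Lie j f) (Lie j g))"
proof -
  have "S2_inner (Lap f) g = S2_inner (\<lambda>x. \<Sum>j\<in>UNIV. 1 * Lie j (Lie j f) x) g"
    by (simp add: Lap_def[abs_def])
  also have "\<dots> = (\<Sum>j\<in>UNIV. S2_inner (Lie j (Lie j f)) g)"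
    using assms poly_Lie by (subst S2_inner_real_sum_left) auto
  also have "\<dots> = - (\<Sum>j\<in>UNIV. S2_inner (Lie j f) (Lie j g))"
    using assms by (simp add: Lie_adjoint poly_Lie sum_negf)
  finally show ?thesis .
qed

lemma Lap_symmetric:
  assumes "real_polynomial_function f" "real_polynomial_function g"
  shows "S2_inner (Lap f) g = S2_inner f (Lap g)"
  using Lap_adjoint[OF assms] Lap_adjoint[OF assms(2,1)] by (simp add: S2_inner_commute)

section \<open>Monomials, their degrees and the action of the rotation fields on them\<close>

definition mon :: "nat \<Rightarrow> nat \<Rightarrow> nat \<Rightarrow> real^3 \<Rightarrow> real" where
  "mon a b c x = x $ 1 ^ a * x $ 2 ^ b * x $ 3 ^ c"

lemma poly_coord [intro]: "real_polynomial_function (\<lambda>x::real^3. x $ i)"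
  by (rule real_polynomial_function.intros) (rule bounded_linear_vec_nth)

lemma poly_coord_power [intro]: "real_polynomial_function (\<lambda>x::real^3. x $ i ^ n)"
  by (intro real_polynomial_function_power poly_coord)

lemma poly_mon [intro]: "real_polynomial_function (mon a b c)"
  unfolding mon_def[abs_def] by (intro real_polynomial_function.intros(4) poly_coord_power)

lemma rot_components:
  "rot 1 x $ 1 = 0" "rot 1 x $ 2 = - x $ 3" "rot 1 x $ 3 = x $ 2"
  "rot 2 x $ 1 = x $ 3" "rot 2 x $ 2 = 0" "rot 2 x $ 3 = - x $ 1"
  "rot 3 x $ 1 = - x $ 2" "rot 3 x $ 2 = x $ 1" "rot 3 x $ 3 = 0"
  by (simp_all add: rot_def cross3_simps axis_def)

lemma Lie_coord: "Lie j (\<lambda>x. x $ i) x = rot j x $ i"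
  by (rule Lie_linear[OF bounded_linear_vec_nth])

lemma Lie_coord_power: "Lie j (\<lambda>x. x $ i ^ n) x = real n * x $ i ^ (n - 1) * rot j x $ i"
proof (induction n)
  case (Suc n)
  have "Lie j (\<lambda>x. x $ i ^ Suc n) x = x $ i * (real n * x $ i ^ (n - 1) * rot j x $ i) + rot j x $ i * x $ i ^ n"
    using Suc by (simp add: Lie_mult poly_coord poly_coord_power Lie_coord)
  also have "\<dots> = real (Suc n) * x $ i ^ n * rot j x $ i"
    by (cases n) (simp_all add: algebra_simps)
  finally show ?case by simp
qed simp

lemma Lie_mon:
  "Lie j (mon a b c) x = real a * mon (a - 1) b c x * rot j x $ 1
     + real b * mon a (b - 1) c x * rot j x $ 2 + real c * mon a b (c - 1) x * rot j x $ 3"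
  unfolding mon_def[abs_def]
  by (simp add: Lie_mult poly_coord_power real_polynomial_function.intros Lie_coord_power algebra_simps)

lemma Lie_mon_expand:
  "Lie 1 (mon a b c) = (\<lambda>x. (- real b) * mon a (b - 1) (c + 1) x + real c * mon a (b + 1) (c - 1) x)"
  "Lie 2 (mon a b c) = (\<lambda>x. real a * mon (a - 1) b (c + 1) x + (- real c) * mon (a + 1) b (c - 1) x)"
  "Lie 3 (mon a b c) = (\<lambda>x. (- real a) * mon (a - 1) (b + 1) c x + real b * mon (a + 1) (b - 1) c x)"
  by (auto simp: Lie_mon rot_components mon_def)

lemma Lie_mon_comb:
  "Lie j (\<lambda>x. p * mon a1 b1 c1 x + q * mon a2 b2 c2 x)
    = (\<lambda>x. p * Lie j (mon a1 b1 c1) x + q * Lie j (mon a2 b2 c2) x)"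
  by (auto simp: Lie_add Lie_cmult poly_mon real_polynomial_function.intros)

text \<open>On homogeneous polynomials of degree d the sum of the squared rotation fields is |x|^2
  times the Euclidean Laplacian minus d (d + 1). The first three terms are that Laplacian; where a
  truncated exponent would be wrong, its coefficient vanishes.\<close>

lemma Lap_mon:
  assumes x: "x \<in> S2"
  shows "Lap (mon a b c) x =
    real a * real (a - 1) * mon (a - 2) b c x + real b * real (b - 1) * mon a (b - 2) c x
    + real c * real (c - 1) * mon a b (c - 2) x
    - real (a + b + c) * real (a + b + c + 1) * mon a b c x"
proof -
  define X Y Z where "X = x $ 1" and "Y = x $ 2" and "Z = x $ 3"
  have XYZ: "X * X + Y * Y + Z * Z = 1"
    using x by (simp add: X_def Y_def Z_def norm_eq_sqrt_inner inner_vec_def sum_3)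
  \<comment> \<open>\<open>p\<close>, \<open>q\<close>, \<open>r\<close> are the one-variable
    factors of the monomial and \<open>p2\<close>, \<open>q2\<close>, \<open>r2\<close> their second
    derivatives.\<close>
  define p p2 where "p = X ^ a" and "p2 = real a * real (a - 1) * X ^ (a - 2)"
  define q q2 where "q = Y ^ b" and "q2 = real b * real (b - 1) * Y ^ (b - 2)"
  define r r2 where "r = Z ^ c" and "r2 = real c * real (c - 1) * Z ^ (c - 2)"
  have pow: "real n * real (n - 1) * y ^ (n - 2) * y * y = real n * (real n - 1) * y ^ n" for n and y :: real
    by (cases n; cases "n - 1") (simp_all add: numeral_2_eq_2 algebra_simps)
  have e: "p2 * X * X = a * (real a - 1) * p" "q2 * Y * Y = b * (real b - 1) * q"
    "r2 * Z * Z = c * (real c - 1) * r"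
    unfolding p_def p2_def q_def q2_def r_def r2_def by (rule pow)+
  note X = X_def[symmetric] and Y = Y_def[symmetric] and Z = Z_def[symmetric]
  have L1: "Lie 1 (Lie 1 (mon a b c)) x = p * (Z*Z*q2*r + Y*Y*q*r2 - (2 * real b * real c + real b + real c) * (q*r))"
    unfolding Lie_mon_expand(1) Lie_mon_comb unfolding p_def q_def r_def q2_def r2_def mon_def X Y Z
    by (cases b; cases c) (simp_all add: numeral_2_eq_2 algebra_simps)
  have L2: "Lie 2 (Lie 2 (mon a b c)) x = q * (Z*Z*p2*r + X*X*p*r2 - (2 * real a * real c + real a + real c) * (p*r))"
    unfolding Lie_mon_expand(2) Lie_mon_comb unfolding p_def q_def r_def p2_def r2_def mon_def X Y Z
    by (cases a; cases c) (simp_all add: numeral_2_eq_2 algebra_simps)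
  have L3: "Lie 3 (Lie 3 (mon a b c)) x = r * (Y*Y*p2*q + X*X*p*q2 - (2 * real a * real b + real a + real b) * (p*q))"
    unfolding Lie_mon_expand(3) Lie_mon_comb unfolding p_def q_def r_def p2_def q2_def mon_def X Y Z
    by (cases a; cases b) (simp_all add: numeral_2_eq_2 algebra_simps)
  \<comment> \<open>The terms \<open>X*X*p2\<close>, \<open>Y*Y*q2\<close> and
    \<open>Z*Z*r2\<close>, absent from the three squares, are added and subtracted so that the
    equation of the sphere can be used.\<close>
  have "Lap (mon a b c) x = (X*X+Y*Y+Z*Z) * (p2*q*r + p*q2*r + p*q*r2)
     - (p2*X*X)*q*r - p*(q2*Y*Y)*r - p*q*(r2*Z*Z)
     - (2 * (real a * real b + real a * real c + real b * real c) + 2 * (real a + real b + real c)) * (p*q*r)"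
    unfolding Lap_def sum_3 L1 L2 L3 by (simp add: algebra_simps)
  also have "\<dots> = p2*q*r + p*q2*r + p*q*r2 - real (a + b + c) * real (a + b + c + 1) * (p*q*r)"
    unfolding e XYZ by (simp add: algebra_simps)
  finally show ?thesis
    by (simp add: mon_def p_def q_def r_def p2_def q2_def r2_def X_def Y_def Z_def)
qed

text \<open>A spanning sequence of the polynomials on the sphere (\<open>x\<^sub>3\<^sup>2 = 1 - x\<^sub>1\<^sup>2 - x\<^sub>2\<^sup>2\<close> makes the
  exponents \<open>0, 1\<close> of \<open>x\<^sub>3\<close> sufficient): the \<open>2 k + 1\<close> monomials of degree \<open>k\<close> have the
  indices \<open>k\<^sup>2, \<dots>, k\<^sup>2 + 2 k\<close>.\<close>

definition bas :: "nat \<Rightarrow> real^3 \<Rightarrow> real" where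
  "bas s = (let k = floor_sqrt s; l = s - k\<^sup>2 in
     if l \<le> k then mon l (k - l) 0 else mon (l - k - 1) (2 * k - l) 1)"

lemma floor_sqrt_level: "l \<le> 2 * k \<Longrightarrow> floor_sqrt (k\<^sup>2 + l) = k"
  by (rule floor_sqrt_unique) (auto simp: power2_eq_square)

lemma floor_sqrt_less_iff: "floor_sqrt s < k \<longleftrightarrow> s < k\<^sup>2"
  by (metis floor_sqrt_le_iff leD le_less_linear le_floor_sqrt_iff)

lemma bas_mon:
  obtains a b c where "bas s = mon a b c" "a + b + c = floor_sqrt s"
proof -
  define k where "k = floor_sqrt s"
  define l where "l = s - k\<^sup>2"
  have "s < (Suc k)\<^sup>2" unfolding k_def by (rule Suc_floor_sqrt_power2_gt)
  then have l: "l \<le> 2 * k" by (auto simp: l_def power2_eq_square)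
  show ?thesis
  proof (cases "l \<le> k")
    case True
    then show ?thesis using that[of l "k - l" 0] by (simp add: bas_def k_def l_def Let_def)
  next
    case False
    then show ?thesis using l that[of "l - k - 1" "2 * k - l" 1] by (simp add: bas_def k_def l_def Let_def)
  qed
qed

lemma poly_bas [intro]: "real_polynomial_function (bas s)"
  using bas_mon[of s] poly_mon by metis

definition bspan :: "nat \<Rightarrow> (real^3 \<Rightarrow> real) \<Rightarrow> bool" where
  "bspan n f \<longleftrightarrow> (\<exists>c. \<forall>x\<in>S2. f x = (\<Sum>s<n. c s * bas s x))"

lemma bspan_cong: "bspan n f \<Longrightarrow> (\<And>x. x \<in> S2 \<Longrightarrow> g x = f x) \<Longrightarrow> bspan n g"
  by (auto simp: bspan_def)

lemma bspan_zero: "bspan n (\<lambda>x. 0)"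
  unfolding bspan_def by (rule exI[of _ "\<lambda>s. 0"]) simp

lemma bspan_lincomb:
  assumes "bspan n f" "bspan n g"
  shows "bspan n (\<lambda>x. a * f x + b * g x)"
proof -
  obtain c d where "\<And>x. x \<in> S2 \<Longrightarrow> f x = (\<Sum>s<n. c s * bas s x)" "\<And>x. x \<in> S2 \<Longrightarrow> g x = (\<Sum>s<n. d s * bas s x)"
    using assms by (auto simp: bspan_def)
  then show ?thesis unfolding bspan_def
    by (intro exI[of _ "\<lambda>s. a * c s + b * d s"]) (simp add: algebra_simps sum.distrib sum_distrib_left)
qed

lemma bspan_cmult: "bspan n f \<Longrightarrow> bspan n (\<lambda>x. a * f x)"
  using bspan_lincomb[of n f f a 0] by simp

lemma bspan_sum:
  assumes "\<And>i. i \<in> I \<Longrightarrow> bspan n (f i)"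
  shows "bspan n (\<lambda>x. \<Sum>i\<in>I. c i * f i x)"
  using assms
proof (induction I rule: infinite_finite_induct)
  case (insert i I)
  then show ?case using bspan_lincomb[of n "f i" "\<lambda>x. \<Sum>i\<in>I. c i * f i x" "c i" 1] by simp
qed (simp_all add: bspan_zero)

lemma bspan_bas: "s < n \<Longrightarrow> bspan n (bas s)"
  unfolding bspan_def by (rule exI[of _ "\<lambda>t. if t = s then 1 else 0"]) (simp add: if_distrib[of "\<lambda>u. u * _"] cong: if_cong)

lemma bspan_mono:
  assumes "bspan n f" "n \<le> m"
  shows "bspan m f"
proof -
  obtain c where c: "\<And>x. x \<in> S2 \<Longrightarrow> f x = (\<Sum>s<n. c s * bas s x)"
    using assms by (auto simp: bspan_def)
  have "bspan m (\<lambda>x. \<Sum>s<n. c s * bas s x)"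
    using assms(2) by (intro bspan_sum bspan_bas) auto
  then show ?thesis by (rule bspan_cong) (simp add: c)
qed

text \<open>The induction is on the third exponent alone: the exchange lowers it by two, and the new
  monomials have the same total degree or a smaller one.\<close>

lemma bspan_mon: "a + b + c \<le> k \<Longrightarrow> bspan ((Suc k)\<^sup>2) (mon a b c)"
proof (induction c arbitrary: a b k rule: less_induct)
  case (less c)
  define d where "d = a + b + c"
  have dk: "(Suc d)\<^sup>2 \<le> (Suc k)\<^sup>2" using less.prems by (auto simp: d_def intro: power_mono)
  consider "c = 0" | "c = 1" | "c \<ge> 2" by linarith
  then have "bspan ((Suc d)\<^sup>2) (mon a b c)"
  proof cases
    case 1
    have "bas (d\<^sup>2 + a) = mon a b c" and "d\<^sup>2 + a < (Suc d)\<^sup>2"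
      using 1 floor_sqrt_level[of a d] by (auto simp: bas_def d_def Let_def power2_eq_square)
    then show ?thesis using bspan_bas by metis
  next
    case 2
    have "bas (d\<^sup>2 + (d + 1 + a)) = mon a b c" and "d\<^sup>2 + (d + 1 + a) < (Suc d)\<^sup>2"
      using 2 floor_sqrt_level[of "d + 1 + a" d] by (auto simp: bas_def d_def Let_def power2_eq_square)
    then show ?thesis using bspan_bas by metis
  next
    case 3
    have "bspan ((Suc d)\<^sup>2) (\<lambda>x. 1 * (1 * mon a b (c - 2) x + (-1) * mon (a + 2) b (c - 2) x) + (-1) * mon a (b + 2) (c - 2) x)"
      using 3 by (intro bspan_lincomb less.IH) (auto simp: d_def)
    moreover have "mon a b c x = 1 * (1 * mon a b (c - 2) x + (-1) * mon (a + 2) b (c - 2) x) + (-1) * mon a (b + 2) (c - 2) x"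
      if "x \<in> S2" for x
    proof -
      have "x $ 1 * x $ 1 + x $ 2 * x $ 2 + x $ 3 * x $ 3 = 1"
        using that by (simp add: norm_eq_sqrt_inner inner_vec_def sum_3)
      then have z: "x $ 3 * x $ 3 = 1 - x $ 1 * x $ 1 - x $ 2 * x $ 2" by linarith
      obtain c' where c': "c = Suc (Suc c')" using 3 by (metis One_nat_def add_2_eq_Suc le_Suc_ex)
      have "mon a b c x = x $ 1 ^ a * x $ 2 ^ b * x $ 3 ^ c' * (x $ 3 * x $ 3)"
        by (simp add: mon_def c')
      also have "\<dots> = 1 * (1 * mon a b (c - 2) x + (-1) * mon (a + 2) b (c - 2) x) + (-1) * mon a (b + 2) (c - 2) x"
        unfolding z by (simp add: mon_def c' algebra_simps)
      finally show ?thesis .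
    qed
    ultimately show ?thesis by (rule bspan_cong)
  qed
  then show ?case using dk by (rule bspan_mono)
qed

text \<open>The degree bound is demanded only for a nonzero coefficient, because truncated
  subtraction can produce monomials of too high a degree with coefficient zero.\<close>

lemma bspan_cmon: "(r \<noteq> 0 \<Longrightarrow> a + b + c \<le> k) \<Longrightarrow> bspan ((Suc k)\<^sup>2) (\<lambda>x. r * mon a b c x)"
  using bspan_zero bspan_cmult[OF bspan_mon] by (cases "r = 0") auto

lemma bspan_Lie_bas: "bspan ((Suc (floor_sqrt s))\<^sup>2) (Lie j (bas s))"
proof -
  obtain a b c where *: "bas s = mon a b c" "a + b + c = floor_sqrt s" by (rule bas_mon)
  have lc: "bspan n f \<Longrightarrow> bspan n g \<Longrightarrow> bspan n (\<lambda>x. f x + g x)" for n f g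
    using bspan_lincomb[of n f g 1 1] by simp
  consider "j = 1" | "j = 2" | "j = 3" using exhaust_3 by blast
  then show ?thesis
    using *(2) unfolding *(1) by cases (auto simp only: Lie_mon_expand intro!: lc bspan_cmon)
qed

text \<open>Triangularity: by \<open>Lap_mon\<close> the operator acts on degree k as - k (k + 1)
  modulo lower degrees, and exactly the first \<open>k\<^sup>2\<close> elements of
  \<open>bas\<close> have degree below k.\<close>

lemma bspan_Lap_bas:
  "bspan ((floor_sqrt s)\<^sup>2) (\<lambda>x. Lap (bas s) x + real (floor_sqrt s) * real (floor_sqrt s + 1) * bas s x)"
proof -
  obtain a b c where *: "bas s = mon a b c" "a + b + c = floor_sqrt s" by (rule bas_mon)
  define k where "k = floor_sqrt s"
  have lc: "bspan n f \<Longrightarrow> bspan n g \<Longrightarrow> bspan n (\<lambda>x. f x + g x)" for n f g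
    using bspan_lincomb[of n f g 1 1] by simp
  have low: "bspan (k\<^sup>2) (\<lambda>x. r * mon a' b' c' x)" if "r \<noteq> 0 \<Longrightarrow> a' + b' + c' < k" for r a' b' c'
  proof (cases k)
    case 0
    with that have "r = 0" by auto
    then show ?thesis using bspan_zero by simp
  next
    case (Suc k')
    then show ?thesis using bspan_cmon[of r a' b' c' k'] that by force
  qed
  have "bspan (k\<^sup>2) (\<lambda>x. (real a * real (a - 1)) * mon (a - 2) b c x + (real b * real (b - 1)) * mon a (b - 2) c x
    + (real c * real (c - 1)) * mon a b (c - 2) x)"
    using *(2) by (intro lc low) (auto simp: k_def)
  then show ?thesis
    unfolding k_def[symmetric] by (rule bspan_cong) (use * in \<open>simp add: Lap_mon k_def\<close>)
qed

text \<open>The product case of the induction rests on the fact that a product of two monomials is a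
  monomial.\<close>

lemma poly_bspan:
  assumes "real_polynomial_function f"
  shows "\<exists>n. bspan n f"
proof -
  have mono: "bspan n f \<Longrightarrow> bspan (max n m) f" "bspan m f \<Longrightarrow> bspan (max n m) f" for n m f
    by (auto intro: bspan_mono)
  have prod: "\<exists>m. bspan m (\<lambda>x. bas s x * bas t x)" for s t
  proof -
    obtain a b c where 1: "bas s = mon a b c" "a + b + c = floor_sqrt s" by (rule bas_mon)
    obtain a' b' c' where 2: "bas t = mon a' b' c'" "a' + b' + c' = floor_sqrt t" by (rule bas_mon)
    have "(\<lambda>x. bas s x * bas t x) = mon (a + a') (b + b') (c + c')"
      unfolding 1 2 by (auto simp: mon_def power_add)
    then show ?thesis using bspan_mon[OF order_refl] by metis
  qed
  have sums: "\<exists>m. bspan m (\<lambda>x. \<Sum>i\<in>I. c i * g i x)"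
    if "finite I" "\<And>i. i \<in> I \<Longrightarrow> \<exists>m. bspan m (g i)" for I :: "(nat \<times> nat) set" and c g
    using that
  proof (induction I)
    case empty
    show ?case using bspan_zero by auto
  next
    case (insert i I)
    have "\<exists>m. bspan m (g i)" "\<exists>m. bspan m (\<lambda>x. \<Sum>i\<in>I. c i * g i x)"
      using insert.IH insert.prems by blast+
    then obtain m m' where "bspan m (g i)" "bspan m' (\<lambda>x. \<Sum>i\<in>I. c i * g i x)" by blast
    then have "bspan (max m m') (\<lambda>x. c i * g i x + 1 * (\<Sum>i\<in>I. c i * g i x))"
      by (intro bspan_lincomb mono)
    with insert.hyps show ?case by auto
  qed
  show ?thesis
    using assms
  proof induction
    case (linear f)
    have fx: "f x = f (axis 1 1) * mon 1 0 0 x + (f (axis 2 1) * mon 0 1 0 x + f (axis 3 1) * mon 0 0 1 x)" for x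
    proof -
      have "x = x $ 1 *\<^sub>R axis 1 1 + x $ 2 *\<^sub>R axis 2 1 + x $ 3 *\<^sub>R axis 3 1"
        by (simp add: vec_eq_iff forall_3 axis_def)
      then have "f x = f (x $ 1 *\<^sub>R axis 1 1 + x $ 2 *\<^sub>R axis 2 1 + x $ 3 *\<^sub>R axis 3 1)" by simp
      also have "\<dots> = f (axis 1 1) * mon 1 0 0 x + (f (axis 2 1) * mon 0 1 0 x + f (axis 3 1) * mon 0 0 1 x)"
        using linear by (simp add: linear_simps mon_def)
      finally show ?thesis .
    qed
    have "bspan ((Suc 1)\<^sup>2) (\<lambda>x. f (axis 1 1) * mon 1 0 0 x + 1 * (f (axis 2 1) * mon 0 1 0 x + f (axis 3 1) * mon 0 0 1 x))"
      by (intro bspan_lincomb bspan_mon) auto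
    then have "bspan ((Suc 1)\<^sup>2) f" by (rule bspan_cong, intro trans[OF fx]) simp
    then show ?case by blast
  next
    case (const c)
    have "bspan ((Suc 0)\<^sup>2) (\<lambda>x. c * mon 0 0 0 x)" by (intro bspan_cmult bspan_mon) auto
    then show ?case by (auto simp: mon_def)
  next
    case (add f g)
    from add.IH obtain n m where "bspan n f" "bspan m g" by blast
    then have "bspan (max n m) (\<lambda>x. 1 * f x + 1 * g x)" by (intro bspan_lincomb mono)
    then show ?case by auto
  next
    case (mult f g)
    from mult.IH obtain n m where "bspan n f" "bspan m g" by blast
    then obtain c d where c: "\<And>x. x \<in> S2 \<Longrightarrow> f x = (\<Sum>s<n. c s * bas s x)"
      and d: "\<And>x. x \<in> S2 \<Longrightarrow> g x = (\<Sum>s<m. d s * bas s x)"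
      by (auto simp: bspan_def)
    have "\<exists>N. bspan N (\<lambda>x. \<Sum>p\<in>{..<n} \<times> {..<m}. (c (fst p) * d (snd p)) * (bas (fst p) x * bas (snd p) x))"
      using prod by (intro sums) auto
    then obtain N where "bspan N (\<lambda>x. \<Sum>p\<in>{..<n} \<times> {..<m}. (c (fst p) * d (snd p)) * (bas (fst p) x * bas (snd p) x))" ..
    then have "bspan N (\<lambda>x. f x * g x)"
      by (rule bspan_cong) (simp add: c d sum_product sum.cartesian_product case_prod_beta mult_ac)
    then show ?case by blast
  qed
qed

section \<open>Spherical harmonics\<close>

text \<open>For a null remainder the result is the zero function itself and not just some null
  function, so the term can be discarded at every point. That these functions are eigenfunctions is
  not built in; it is derived in \<open>Lap_sph_harm\<close>.\<close>

function sph_harm :: "nat \<Rightarrow> real^3 \<Rightarrow> real" where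
  "sph_harm s = (let u = (\<lambda>x. bas s x - (\<Sum>t<s. S2_inner (bas s) (sph_harm t) * sph_harm t x))
     in if S2_inner u u = 0 then (\<lambda>x. 0) else (\<lambda>x. u x / sqrt (S2_inner u u)))"
  by pat_completeness auto
termination by (relation "Wellfounded.measure id") auto

declare sph_harm.simps [simp del]

definition gram_schmidt :: "nat \<Rightarrow> real^3 \<Rightarrow> real" where
  "gram_schmidt s x = bas s x - (\<Sum>t<s. S2_inner (bas s) (sph_harm t) * sph_harm t x)"

lemma sph_harm_eq: "sph_harm s = (if S2_inner (gram_schmidt s) (gram_schmidt s) = 0 then (\<lambda>x. 0) else (\<lambda>x. gram_schmidt s x / sqrt (S2_inner (gram_schmidt s) (gram_schmidt s))))"
  by (subst sph_harm.simps) (simp only: gram_schmidt_def[abs_def] Let_def)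

text \<open>Gram-Schmidt is triangular; this transfers degree statements from \<open>bas\<close> to
  \<open>sph_harm\<close>.\<close>

lemma sph_harm_lincomb: "\<exists>c. sph_harm s = (\<lambda>x. \<Sum>t\<le>s. c t * bas t x)"
proof (induction s rule: less_induct)
  case (less s)
  then obtain c where c: "\<And>t. t < s \<Longrightarrow> sph_harm t = (\<lambda>x. \<Sum>r\<le>t. c t r * bas r x)" by metis
  define d where "d r = (\<Sum>t\<in>{r..<s}. S2_inner (bas s) (sph_harm t) * c t r)" for r
  have "(\<Sum>t<s. S2_inner (bas s) (sph_harm t) * sph_harm t x) = (\<Sum>r<s. d r * bas r x)" for x
  proof -
    have "(\<Sum>t<s. S2_inner (bas s) (sph_harm t) * sph_harm t x) = (\<Sum>t<s. \<Sum>r\<le>t. S2_inner (bas s) (sph_harm t) * c t r * bas r x)"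
      using c by (intro sum.cong) (auto simp: sum_distrib_left mult.assoc)
    also have "\<dots> = (\<Sum>r<s. \<Sum>t\<in>{r..<s}. S2_inner (bas s) (sph_harm t) * c t r * bas r x)"
      unfolding sum.Sigma[OF finite_lessThan ballI[OF finite_atMost]] sum.Sigma[OF finite_lessThan ballI[OF finite_atLeastLessThan]]
      by (rule sum.reindex_bij_witness[of _ "\<lambda>(a, b). (b, a)" "\<lambda>(a, b). (b, a)"]) auto
    finally show ?thesis by (simp add: d_def sum_distrib_right)
  qed
  then have "gram_schmidt s = (\<lambda>x. \<Sum>t\<le>s. (if t = s then 1 else - d t) * bas t x)"
    by (auto simp: gram_schmidt_def lessThan_Suc_atMost[symmetric] sum_negf)
  then obtain e where "gram_schmidt s = (\<lambda>x. \<Sum>t\<le>s. e t * bas t x)" by (rule that)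
  then have e: "gram_schmidt s x / r = (\<Sum>t\<le>s. (e t / r) * bas t x)" for r x
    by (simp add: sum_divide_distrib)
  show ?case
  proof (cases "S2_inner (gram_schmidt s) (gram_schmidt s) = 0")
    case True
    then show ?thesis unfolding sph_harm_eq[of s] by (intro exI[of _ "\<lambda>_. 0"]) simp
  next
    case False
    then show ?thesis unfolding sph_harm_eq[of s]
      by (intro exI[of _ "\<lambda>t. e t / sqrt (S2_inner (gram_schmidt s) (gram_schmidt s))"]) (simp add: e)
  qed
qed

lemma poly_sph_harm [intro]: "real_polynomial_function (sph_harm s)"
proof -
  obtain c where "sph_harm s = (\<lambda>x. \<Sum>t\<le>s. c t * bas t x)" using sph_harm_lincomb by blast
  then show ?thesis
    by (auto intro!: real_polynomial_function_sum real_polynomial_function.intros(2,4) poly_bas)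
qed

lemma poly_gram_schmidt: "real_polynomial_function (gram_schmidt s)"
  unfolding gram_schmidt_def[abs_def]
  by (intro real_polynomial_function_diff real_polynomial_function_sum
      real_polynomial_function.intros(2,4) poly_bas poly_sph_harm) auto

lemma S2_inner_cmult_left: "S2_inner (\<lambda>x. c * f x) g = c * S2_inner f (g :: real^3 \<Rightarrow> real)"
  by (simp add: S2_inner_def mult.assoc)

lemma S2_inner_divide: "S2_inner (\<lambda>x. f x / c) g = S2_inner f (g :: real^3 \<Rightarrow> real) / c"
  "S2_inner g (\<lambda>x. f x / c) = S2_inner g f / c"
  by (simp_all add: S2_inner_def)

lemma sph_harm_norm: "S2_inner (sph_harm s) (sph_harm s) \<in> {0, 1}"
proof (cases "S2_inner (gram_schmidt s) (gram_schmidt s) = 0")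
  case False
  then have "S2_inner (gram_schmidt s) (gram_schmidt s) > 0" using S2_inner_nonneg[of "gram_schmidt s"] by simp
  then show ?thesis by (simp add: sph_harm_eq S2_inner_divide)
qed (simp add: sph_harm_eq)

lemma sph_harm_null: "S2_inner (sph_harm s) (sph_harm s) = 0 \<Longrightarrow> sph_harm s = (\<lambda>x. 0)"
proof (rule ccontr)
  assume 0: "S2_inner (sph_harm s) (sph_harm s) = 0" and "sph_harm s \<noteq> (\<lambda>x. 0)"
  then have ne: "S2_inner (gram_schmidt s) (gram_schmidt s) \<noteq> 0" by (auto simp: sph_harm_eq)
  then have "S2_inner (gram_schmidt s) (gram_schmidt s) > 0" using S2_inner_nonneg[of "gram_schmidt s"] by simp
  with 0 show False by (simp add: sph_harm_eq S2_inner_divide)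
qed

lemma sph_harm_orthogonal_less: "t < s \<Longrightarrow> S2_inner (sph_harm s) (sph_harm t) = 0"
proof (induction s arbitrary: t rule: less_induct)
  case (less s)
  have orth: "S2_inner (sph_harm r) (sph_harm t) = 0" if "r < s" "r \<noteq> t" for r
    using less.IH[of r t] less.IH[of t r] less.prems that
    by (cases r t rule: linorder_cases) (auto simp: S2_inner_commute)
  have "S2_inner (gram_schmidt s) (sph_harm t) = S2_inner (bas s) (sph_harm t) - S2_inner (\<lambda>x. \<Sum>r<s. S2_inner (bas s) (sph_harm r) * sph_harm r x) (sph_harm t)"
    unfolding gram_schmidt_def[abs_def]
    by (intro S2_inner_diff_left poly_L2 poly_bas poly_sph_harm real_polynomial_function_sum
        real_polynomial_function.intros(2,4)) auto
  also have "S2_inner (\<lambda>x. \<Sum>r<s. S2_inner (bas s) (sph_harm r) * sph_harm r x) (sph_harm t)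
    = (\<Sum>r<s. S2_inner (bas s) (sph_harm r) * S2_inner (sph_harm r) (sph_harm t))"
    by (intro S2_inner_real_sum_left poly_sph_harm)
  also have "\<dots> = (\<Sum>r<s. if r = t then S2_inner (bas s) (sph_harm t) * S2_inner (sph_harm t) (sph_harm t) else 0)"
    by (intro sum.cong refl) (auto simp: orth)
  also have "\<dots> = S2_inner (bas s) (sph_harm t) * S2_inner (sph_harm t) (sph_harm t)" using less.prems by simp
  also have "\<dots> = S2_inner (bas s) (sph_harm t)"
    using sph_harm_norm[of t] sph_harm_null[of t] by auto
  finally show ?case by (simp add: sph_harm_eq[of s] S2_inner_divide)
qed

lemma sph_harm_orthogonal: "s \<noteq> t \<Longrightarrow> S2_inner (sph_harm s) (sph_harm t) = 0"
  by (cases s t rule: linorder_cases)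
    (simp_all add: sph_harm_orthogonal_less S2_inner_commute[THEN trans, OF sph_harm_orthogonal_less])

lemma orthonormal0_sph_harm: "orthonormal0 I sph_harm"
  unfolding orthonormal0_def using sph_harm_norm sph_harm_orthogonal poly_L2[OF poly_sph_harm] by simp

text \<open>The inverse triangular relation. It is claimed only on the sphere, since a remainder of
  norm zero is known to vanish only there.\<close>

lemma bas_in_sph_harm: "\<exists>d. \<forall>x\<in>S2. bas s x = (\<Sum>t\<le>s. d t * sph_harm t x)"
proof -
  define r where "r = sqrt (S2_inner (gram_schmidt s) (gram_schmidt s))"
  have "gram_schmidt s x = r * sph_harm s x" if "x \<in> S2" for x
  proof (cases "S2_inner (gram_schmidt s) (gram_schmidt s) = 0")
    case True
    then have "gram_schmidt s x = 0"
      using continuous_square_integral_zero[OF poly_continuous_on[OF poly_gram_schmidt] _ that]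
      by (simp add: S2_inner_def)
    then show ?thesis using True by (simp add: sph_harm_eq)
  next
    case False
    then show ?thesis by (simp add: sph_harm_eq r_def)
  qed
  then have "bas s x = (\<Sum>t\<le>s. (if t = s then r else S2_inner (bas s) (sph_harm t)) * sph_harm t x)" if "x \<in> S2" for x
    using that unfolding lessThan_Suc_atMost[symmetric] gram_schmidt_def by (simp add: algebra_simps)
  then show ?thesis
    by (intro exI[of _ "\<lambda>t. if t = s then r else S2_inner (bas s) (sph_harm t)"]) simp
qed

lemma bspan_expand:
  assumes "bspan n f" "x \<in> S2"
  shows "f x = (\<Sum>t<n. S2_inner f (sph_harm t) * sph_harm t x)"
proof -
  obtain c where c: "\<And>x. x \<in> S2 \<Longrightarrow> f x = (\<Sum>s<n. c s * bas s x)"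
    using assms by (auto simp: bspan_def)
  obtain d where d: "\<And>s x. x \<in> S2 \<Longrightarrow> bas s x = (\<Sum>t\<le>s. d s t * sph_harm t x)"
    using bas_in_sph_harm by metis
  define e where "e t = (\<Sum>s\<in>{t..<n}. c s * d s t)" for t
  have f: "f x = (\<Sum>t<n. e t * sph_harm t x)" if "x \<in> S2" for x
  proof -
    have "f x = (\<Sum>s<n. \<Sum>t\<le>s. c s * d s t * sph_harm t x)"
      using that by (simp add: c d sum_distrib_left mult.assoc)
    also have "\<dots> = (\<Sum>t<n. \<Sum>s\<in>{t..<n}. c s * d s t * sph_harm t x)"
      unfolding sum.Sigma[OF finite_lessThan ballI[OF finite_atMost]] sum.Sigma[OF finite_lessThan ballI[OF finite_atLeastLessThan]]
      by (rule sum.reindex_bij_witness[of _ "\<lambda>(a, b). (b, a)" "\<lambda>(a, b). (b, a)"]) auto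
    finally show ?thesis by (simp add: e_def sum_distrib_right)
  qed
  \<comment> \<open>The two coefficients may differ when \<open>sph_harm t\<close> has norm zero,
    but then it is the zero function; so the products are compared.\<close>
  have "S2_inner f (sph_harm t) * sph_harm t x = e t * sph_harm t x" if "t < n" for t
  proof -
    have "S2_inner f (sph_harm t) = S2_inner (\<lambda>x. \<Sum>s<n. e s * sph_harm s x) (sph_harm t)"
      by (rule S2_inner_cong) (use f in auto)
    also have "\<dots> = (\<Sum>s<n. e s * S2_inner (sph_harm s) (sph_harm t))"
      by (intro S2_inner_real_sum_left poly_sph_harm)
    also have "\<dots> = (\<Sum>s<n. if s = t then e t * S2_inner (sph_harm t) (sph_harm t) else 0)"
      by (intro sum.cong refl) (simp add: sph_harm_orthogonal)
    also have "\<dots> = e t * S2_inner (sph_harm t) (sph_harm t)" using that by simp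
    finally show ?thesis using sph_harm_norm[of t] sph_harm_null[of t] by auto
  qed
  then have "(\<Sum>t<n. S2_inner f (sph_harm t) * sph_harm t x) = (\<Sum>t<n. e t * sph_harm t x)"
    by (intro sum.cong) auto
  with f[OF assms(2)] show ?thesis by (rule trans[OF _ sym])
qed

lemma bspan_orthogonal:
  assumes f: "bspan n f" "real_polynomial_function f" and s: "n \<le> s"
  shows "S2_inner (sph_harm s) f = 0"
proof -
  have "S2_inner f (sph_harm s) = S2_inner (\<lambda>x. \<Sum>t<n. S2_inner f (sph_harm t) * sph_harm t x) (sph_harm s)"
    by (intro S2_inner_cong bspan_expand[OF f(1)] refl)
  also have "\<dots> = (\<Sum>t<n. S2_inner f (sph_harm t) * S2_inner (sph_harm t) (sph_harm s))"
    by (intro S2_inner_real_sum_left poly_sph_harm)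
  also have "\<dots> = 0" using s by (intro sum.neutral) (auto simp: sph_harm_orthogonal)
  finally show ?thesis by (simp add: S2_inner_commute)
qed

abbreviation lev :: "nat \<Rightarrow> nat" where "lev \<equiv> floor_sqrt"

lemma bspan_Lie_sph_harm: "bspan ((Suc (lev s))\<^sup>2) (Lie j (sph_harm s))"
proof -
  obtain c where c: "sph_harm s = (\<lambda>x. \<Sum>t\<le>s. c t * bas t x)" using sph_harm_lincomb by blast
  have "bspan ((Suc (lev s))\<^sup>2) (\<lambda>x. \<Sum>t\<le>s. c t * Lie j (bas t) x)"
  proof (rule bspan_sum)
    fix t assume "t \<in> {..s}"
    then have "lev t \<le> lev s" by (simp add: mono_floor_sqrt')
    then have "(Suc (lev t))\<^sup>2 \<le> (Suc (lev s))\<^sup>2" by (intro power_mono) auto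
    then show "bspan ((Suc (lev s))\<^sup>2) (Lie j (bas t))" by (rule bspan_mono[OF bspan_Lie_bas])
  qed
  then show ?thesis unfolding c by (subst Lie_sum_fun) (auto intro: poly_bas)
qed

lemma bspan_Lie_sph_harm_lower: "s < k\<^sup>2 \<Longrightarrow> bspan (k\<^sup>2) (Lie j (sph_harm s))"
proof -
  assume "s < k\<^sup>2"
  then have "lev s < k" by (simp add: floor_sqrt_less_iff)
  then have "(Suc (lev s))\<^sup>2 \<le> k\<^sup>2" by (intro power_mono) auto
  then show ?thesis by (rule bspan_mono[OF bspan_Lie_sph_harm])
qed

lemma bspan_Lap_bas_lower:
  assumes "t < k\<^sup>2"
  shows "bspan (k\<^sup>2) (Lap (bas t))"
proof -
  have "lev t < k" using assms by (simp add: floor_sqrt_less_iff)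
  then have le: "(lev t)\<^sup>2 \<le> k\<^sup>2" by (intro power_mono) auto
  have "bspan (k\<^sup>2) (\<lambda>x. 1 * (Lap (bas t) x + real (lev t) * real (lev t + 1) * bas t x)
     + (- (real (lev t) * real (lev t + 1))) * bas t x)"
    by (intro bspan_lincomb bspan_bas assms bspan_mono[OF bspan_Lap_bas le])
  then show ?thesis by simp
qed

lemma bspan_Lap_sph_harm_lower:
  assumes "s < k\<^sup>2"
  shows "bspan (k\<^sup>2) (Lap (sph_harm s))"
proof -
  obtain c where c: "sph_harm s = (\<lambda>x. \<Sum>t\<le>s. c t * bas t x)" using sph_harm_lincomb by blast
  have "Lap (sph_harm s) = (\<lambda>x. \<Sum>t\<le>s. c t * Lap (bas t) x)"
    unfolding c by (rule ext) (simp add: Lap_sum poly_bas)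
  then show ?thesis using assms by (auto intro!: bspan_sum bspan_Lap_bas_lower)
qed

definition ev :: "nat \<Rightarrow> real" where "ev k = real k * real (k + 1)"

text \<open>By triangularity the defect \<open>u\<close> of the eigenvalue equation lies in the span
  of lower degrees. As \<open>Lap\<close> is symmetric and preserves that span, to which
  \<open>sph_harm s\<close> is orthogonal, \<open>u\<close> is also orthogonal to it. Hence
  \<open>u\<close> vanishes.\<close>

lemma Lap_sph_harm:
  assumes x: "x \<in> S2"
  shows "Lap (sph_harm s) x = - ev (lev s) * sph_harm s x"
proof -
  define k where "k = lev s"
  define u where "u x = Lap (sph_harm s) x + ev k * sph_harm s x" for x
  have ks: "k\<^sup>2 \<le> s" by (simp add: k_def)
  have "bspan (k\<^sup>2) (\<lambda>x. Lap (bas t) x + ev k * bas t x)" if "t \<le> s" for t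
  proof (cases "lev t = k")
    case True
    then show ?thesis using bspan_Lap_bas[of t] by (simp add: ev_def)
  next
    case False
    then have "t < k\<^sup>2"
      using that mono_floor_sqrt'[of t s] by (simp add: k_def floor_sqrt_less_iff[symmetric])
    then show ?thesis
      using bspan_lincomb[OF bspan_Lap_bas_lower bspan_bas, of t k t 1 "ev k"] by simp
  qed
  moreover obtain c where c: "sph_harm s = (\<lambda>x. \<Sum>t\<le>s. c t * bas t x)" using sph_harm_lincomb by blast
  have "u = (\<lambda>x. \<Sum>t\<le>s. c t * (Lap (bas t) x + ev k * bas t x))"
    unfolding u_def[abs_def] c
    by (subst Lap_sum) (auto simp: poly_bas algebra_simps sum.distrib sum_distrib_left)
  ultimately have u: "bspan (k\<^sup>2) u"
    using bspan_sum[of "{..s}" "k\<^sup>2" "\<lambda>t x. Lap (bas t) x + ev k * bas t x" c] by simp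
  have "S2_inner u (sph_harm t) = 0" if t: "t < k\<^sup>2" for t
  proof -
    have "S2_inner u (sph_harm t) = S2_inner (Lap (sph_harm s)) (sph_harm t) + ev k * S2_inner (sph_harm s) (sph_harm t)"
    proof -
      have "S2_Lp 2 (Lap (sph_harm s))" "S2_Lp 2 (\<lambda>x. ev k * sph_harm s x)"
        by (intro poly_L2 poly_Lap poly_sph_harm real_polynomial_function.intros(2,4))+
      from S2_inner_add_left[OF this poly_L2[OF poly_sph_harm]] show ?thesis
        unfolding u_def[abs_def] S2_inner_cmult_left .
    qed
    also have "S2_inner (Lap (sph_harm s)) (sph_harm t) = S2_inner (sph_harm s) (Lap (sph_harm t))"
      by (rule Lap_symmetric[OF poly_sph_harm poly_sph_harm])
    also have "\<dots> = 0" by (rule bspan_orthogonal[OF bspan_Lap_sph_harm_lower[OF t] poly_Lap[OF poly_sph_harm] ks])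
    finally show ?thesis using t ks by (simp add: sph_harm_orthogonal)
  qed
  then have "u x = 0" using bspan_expand[OF u x] by simp
  then show ?thesis by (simp add: u_def k_def)
qed

section \<open>Addition theorem and weak gradients\<close>

definition shell :: "nat \<Rightarrow> nat set" where "shell k = {k\<^sup>2..<(Suc k)\<^sup>2}"

lemma finite_shell [simp]: "finite (shell k)"
  by (simp add: shell_def)

lemma card_shell: "card (shell k) = 2 * k + 1"
  by (simp add: shell_def power2_eq_square)

lemma lev_shell: "s \<in> shell k \<Longrightarrow> lev s = k"
  unfolding shell_def by (intro floor_sqrt_unique) auto

text \<open>A rotation field does not raise the degree; being skew-adjoint, it cannot produce
  components of lower degree either.\<close>

lemma Lie_sph_harm_shell:
  assumes s: "s \<in> shell k" and x: "x \<in> S2"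
  shows "Lie j (sph_harm s) x = (\<Sum>t\<in>shell k. S2_inner (Lie j (sph_harm s)) (sph_harm t) * sph_harm t x)"
proof -
  have ks: "k\<^sup>2 \<le> s" using s by (simp add: shell_def)
  have "bspan ((Suc k)\<^sup>2) (Lie j (sph_harm s))"
    using bspan_Lie_sph_harm[of s j] by (simp add: lev_shell[OF s])
  then have "Lie j (sph_harm s) x = (\<Sum>t<(Suc k)\<^sup>2. S2_inner (Lie j (sph_harm s)) (sph_harm t) * sph_harm t x)"
    by (rule bspan_expand[OF _ x])
  also have "\<dots> = (\<Sum>t\<in>shell k. S2_inner (Lie j (sph_harm s)) (sph_harm t) * sph_harm t x)"
  proof (rule sum.mono_neutral_right)
    show "shell k \<subseteq> {..<(Suc k)\<^sup>2}" by (auto simp: shell_def)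
    show "\<forall>t\<in>{..<(Suc k)\<^sup>2} - shell k. S2_inner (Lie j (sph_harm s)) (sph_harm t) * sph_harm t x = 0"
    proof
      fix t assume "t \<in> {..<(Suc k)\<^sup>2} - shell k"
      then have t: "t < k\<^sup>2" by (auto simp: shell_def)
      have "S2_inner (Lie j (sph_harm s)) (sph_harm t) = - S2_inner (sph_harm s) (Lie j (sph_harm t))"
        by (rule Lie_adjoint[OF poly_sph_harm poly_sph_harm])
      also have "\<dots> = 0"
        using bspan_orthogonal[OF bspan_Lie_sph_harm_lower[OF t] poly_Lie[OF poly_sph_harm] ks] by simp
      finally show "S2_inner (Lie j (sph_harm s)) (sph_harm t) * sph_harm t x = 0" by simp
    qed
  qed simp
  finally show ?thesis .
qed

definition shell_sum :: "nat \<Rightarrow> real^3 \<Rightarrow> real" where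
  "shell_sum k x = (\<Sum>s\<in>shell k. sph_harm s x * sph_harm s x)"

lemma poly_shell_sum: "real_polynomial_function (shell_sum k)"
  unfolding shell_sum_def[abs_def]
  by (intro real_polynomial_function_sum real_polynomial_function.intros(4) poly_sph_harm finite_shell)

text \<open>The rotation fields act on the span of a shell by skew-symmetric matrices.\<close>

lemma Lie_shell_sum:
  assumes x: "x \<in> S2"
  shows "Lie j (shell_sum k) x = 0"
proof -
  define A where "A s t = S2_inner (Lie j (sph_harm s)) (sph_harm t)" for s t
  have skew: "A t s = - A s t" for s t
    unfolding A_def using Lie_adjoint[OF poly_sph_harm poly_sph_harm, of j t s] by (simp add: S2_inner_commute)
  define R where "R = (\<Sum>s\<in>shell k. \<Sum>t\<in>shell k. A s t * sph_harm s x * sph_harm t x)"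
  \<comment> \<open>Exchanging the two indices changes the sign of \<open>R\<close>.\<close>
  have "R = (\<Sum>s\<in>shell k. \<Sum>t\<in>shell k. A t s * sph_harm t x * sph_harm s x)"
    unfolding R_def by (rule sum.swap)
  also have "\<dots> = - R"
    unfolding R_def sum_negf[symmetric] by (intro sum.cong refl, subst skew) (simp add: mult_ac)
  finally have R: "R = 0" by simp
  have "Lie j (shell_sum k) x = (\<Sum>s\<in>shell k. Lie j (\<lambda>x. sph_harm s x * sph_harm s x) x)"
    unfolding shell_sum_def[abs_def]
    by (intro Lie_sum real_polynomial_function.intros(4) poly_sph_harm finite_shell)
  also have "\<dots> = (\<Sum>s\<in>shell k. 2 * (sph_harm s x * Lie j (sph_harm s) x))"
    by (intro sum.cong refl) (simp add: Lie_mult[OF poly_sph_harm poly_sph_harm])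
  also have "\<dots> = 2 * (\<Sum>s\<in>shell k. sph_harm s x * (\<Sum>t\<in>shell k. A s t * sph_harm t x))"
    unfolding sum_distrib_left[symmetric] A_def
    by (intro arg_cong2[where f = "(*)"] sum.cong refl Lie_sph_harm_shell x)
  also have "\<dots> = 2 * R" unfolding R_def by (simp add: sum_distrib_left mult_ac)
  finally show ?thesis by (simp add: R)
qed

lemma sph_harm_0: "sph_harm 0 x = sph_harm 0 0"
proof -
  have "bas 0 = (\<lambda>x. 1)" by (auto simp: bas_def mon_def Let_def)
  then have "gram_schmidt 0 = (\<lambda>x. 1)" by (auto simp: gram_schmidt_def)
  then show ?thesis by (simp add: sph_harm_eq)
qed

text \<open>A polynomial annihilated by all rotation fields is orthogonal to every nonconstant eigenfunction.\<close>

lemma shell_sum_constant: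
  obtains K where "\<And>x. x \<in> S2 \<Longrightarrow> shell_sum k x = K"
proof -
  obtain n where "bspan n (shell_sum k)" using poly_bspan[OF poly_shell_sum] by blast
  then have b: "bspan (Suc n) (shell_sum k)" by (rule bspan_mono) simp
  have z: "S2_inner (shell_sum k) (sph_harm t) = 0" if "t > 0" for t
  proof -
    \<comment> \<open>Index 0 is the only one of degree 0, so every other eigenvalue is nonzero and
      can be divided out.\<close>
    have "ev (lev t) > 0" using that by (simp add: ev_def)
    have "- ev (lev t) * S2_inner (shell_sum k) (sph_harm t) = S2_inner (Lap (sph_harm t)) (shell_sum k)"
    proof -
      have "S2_inner (Lap (sph_harm t)) (shell_sum k) = S2_inner (\<lambda>x. - ev (lev t) * sph_harm t x) (shell_sum k)"
        by (rule S2_inner_cong) (simp_all add: Lap_sph_harm)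
      also have "\<dots> = - ev (lev t) * S2_inner (sph_harm t) (shell_sum k)"
        by (rule S2_inner_cmult_left)
      finally show ?thesis by (simp only: S2_inner_commute[of "shell_sum k"])
    qed
    also have "\<dots> = - (\<Sum>j\<in>UNIV. S2_inner (Lie j (sph_harm t)) (Lie j (shell_sum k)))"
      by (rule Lap_adjoint[OF poly_sph_harm poly_shell_sum])
    also have "\<dots> = 0"
    proof -
      have "S2_inner (Lie j (sph_harm t)) (Lie j (shell_sum k)) = S2_inner (Lie j (sph_harm t)) (\<lambda>x. 0)" for j
        by (rule S2_inner_cong) (simp_all add: Lie_shell_sum)
      then show ?thesis by simp
    qed
    finally show ?thesis using \<open>ev (lev t) > 0\<close> by simp
  qed
  have "shell_sum k x = S2_inner (shell_sum k) (sph_harm 0) * sph_harm 0 0" if x: "x \<in> S2" for x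
  proof -
    have "shell_sum k x = (\<Sum>t<Suc n. S2_inner (shell_sum k) (sph_harm t) * sph_harm t x)"
      by (rule bspan_expand[OF b x])
    also have "\<dots> = S2_inner (shell_sum k) (sph_harm 0) * sph_harm 0 x"
      unfolding sum.lessThan_Suc_shift by (simp add: z)
    finally show ?thesis using sph_harm_0[of x] by simp
  qed
  then show ?thesis by (rule that)
qed

text \<open>Integrating the constant over the sphere counts the nonzero members of the shell, and
  there are at most 2 k + 1 of them. Only an upper bound is claimed, as members that are zero have
  not been excluded.\<close>

lemma shell_sum_le:
  assumes "x \<in> S2"
  shows "shell_sum k x \<le> (2 * real k + 1) / (4 * pi)"
proof -
  obtain K where K: "\<And>x. x \<in> S2 \<Longrightarrow> shell_sum k x = K" using shell_sum_constant by metis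
  have "4 * pi * K = (\<integral>x. K \<partial>surface_measure)" by (simp add: measure_surface_space)
  also have "\<dots> = (\<integral>x. shell_sum k x \<partial>surface_measure)"
    by (intro Bochner_Integration.integral_cong) (auto simp: K)
  also have "\<dots> = (\<Sum>s\<in>shell k. S2_inner (sph_harm s) (sph_harm s))"
    unfolding shell_sum_def S2_inner_def inner_real_def
    by (intro Bochner_Integration.integral_sum integrable_surface_continuous continuous_intros
        poly_continuous_on poly_sph_harm)
  also have "\<dots> \<le> (\<Sum>s\<in>shell k. 1)"
  proof (rule sum_mono)
    show "S2_inner (sph_harm s) (sph_harm s) \<le> 1" for s using sph_harm_norm[of s] by auto
  qed
  also have "\<dots> = 2 * real k + 1" by (simp add: card_shell)
  finally show ?thesis using K[OF assms] by (simp add: field_simps)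
qed

section \<open>Polynomial test fields and weak gradients\<close>

lemma poly_C1:
  assumes "real_polynomial_function (f :: real^3 \<Rightarrow> real)"
  shows "\<exists>D. continuous_on UNIV D \<and> (\<forall>x. (f has_derivative blinfun_apply (D x)) (at x))"
  using assms
proof induction
  case (linear f)
  then show ?case
    by (intro exI[of _ "\<lambda>x. Blinfun f"])
      (simp add: bounded_linear_Blinfun_apply bounded_linear_imp_has_derivative)
next
  case (const c)
  show ?case by (intro exI[of _ "\<lambda>x. 0"]) simp
next
  case (add f g)
  from add.IH(1) obtain D where "continuous_on UNIV D \<and> (\<forall>x. (f has_derivative blinfun_apply (D x)) (at x))" ..
  then have D: "continuous_on UNIV D" "(f has_derivative blinfun_apply (D x)) (at x)" for x by simp_all
  from add.IH(2) obtain E where "continuous_on UNIV E \<and> (\<forall>x. (g has_derivative blinfun_apply (E x)) (at x))" ..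
  then have E: "continuous_on UNIV E" "(g has_derivative blinfun_apply (E x)) (at x)" for x by simp_all
  show ?case
  proof (intro exI[of _ "\<lambda>x. D x + E x"] conjI allI continuous_on_add D(1) E(1))
    show "((\<lambda>x. f x + g x) has_derivative blinfun_apply (D x + E x)) (at x)" for x
      by (rule has_derivative_eq_rhs[OF has_derivative_add[OF D(2) E(2)]])
        (simp add: fun_eq_iff blinfun.add_left)
  qed
next
  case (mult f g)
  from mult.IH(1) obtain D where "continuous_on UNIV D \<and> (\<forall>x. (f has_derivative blinfun_apply (D x)) (at x))" ..
  then have D: "continuous_on UNIV D" "(f has_derivative blinfun_apply (D x)) (at x)" for x by simp_all
  from mult.IH(2) obtain E where "continuous_on UNIV E \<and> (\<forall>x. (g has_derivative blinfun_apply (E x)) (at x))" ..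
  then have E: "continuous_on UNIV E" "(g has_derivative blinfun_apply (E x)) (at x)" for x by simp_all
  have "((\<lambda>x. f x * g x) has_derivative blinfun_apply (f x *\<^sub>R E x + g x *\<^sub>R D x)) (at x)" for x
    by (rule has_derivative_eq_rhs[OF has_derivative_mult[OF D(2) E(2)]])
      (simp add: fun_eq_iff blinfun.add_left blinfun.scaleR_left mult.commute)
  moreover have "continuous_on UNIV (\<lambda>x. f x *\<^sub>R E x + g x *\<^sub>R D x)"
    by (intro continuous_on_add continuous_on_scaleR D(1) E(1) poly_continuous_on mult.hyps)
  ultimately show ?case by (intro exI[of _ "\<lambda>x. f x *\<^sub>R E x + g x *\<^sub>R D x"]) simp
qed

definition rot_field :: "3 \<Rightarrow> (real^3 \<Rightarrow> real) \<Rightarrow> real^3 \<Rightarrow> real^3" where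
  "rot_field j f x = f x *\<^sub>R rot j x"

lemma rot_field_tangent: "S2_tangent (rot_field j f)"
  by (simp add: S2_tangent_def rot_field_def)

lemma rot_field_C1:
  assumes f: "real_polynomial_function f"
  shows "S2_C1 (rot_field j f)"
proof -
  obtain D where D: "continuous_on UNIV D" "\<And>x. (f has_derivative blinfun_apply (D x)) (at x)"
    using poly_C1[OF f] by auto
  define E where "E x = (blinfun_scaleR_left (rot j x) o\<^sub>L D x) + f x *\<^sub>R Blinfun (rot j)" for x
  have "(rot_field j f has_derivative blinfun_apply (E x)) (at x)" for x
    unfolding rot_field_def[abs_def]
    by (rule has_derivative_eq_rhs[OF has_derivative_scaleR[OF D(2)
          bounded_linear_imp_has_derivative[OF bounded_linear_rot]]])
      (simp add: fun_eq_iff E_def blinfun.add_left blinfun.scaleR_left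
        bounded_linear_Blinfun_apply[OF bounded_linear_rot] add.commute)
  moreover have "continuous_on UNIV (rot j)"
    using bounded_linear_rot by (simp add: linear_continuous_on)
  then have "continuous_on UNIV (\<lambda>x. blinfun_scaleR_left (rot j x))"
    by (rule bounded_linear.continuous_on[OF bounded_linear_blinfun_scaleR_left])
  then have "continuous_on UNIV E"
    unfolding E_def[abs_def]
    by (intro continuous_on_add continuous_on_scaleR continuous_on_const poly_continuous_on f
        bounded_bilinear.continuous_on[OF bounded_bilinear_blinfun_compose] D(1))
  ultimately show ?thesis unfolding S2_C1_def by blast
qed

text \<open>\<open>rot j\<close> is linear and skew, so it has neither divergence nor normal
  component; only the derivative of \<open>f\<close> along it survives.\<close>

lemma rot_field_div:
  assumes f: "real_polynomial_function f"
  shows "S2_div (rot_field j f) x = Lie j f x"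
proof -
  define f' where "f' = frechet_derivative f (at x)"
  have f': "(f has_derivative f') (at x)" unfolding f'_def by (rule poly_has_derivative[OF f])
  then have lin: "linear f'" by (rule has_derivative_linear)
  have "(rot_field j f has_derivative (\<lambda>h. f x *\<^sub>R rot j h + f' h *\<^sub>R rot j x)) (at x)"
    unfolding rot_field_def[abs_def]
    by (rule has_derivative_scaleR[OF f' bounded_linear_imp_has_derivative[OF bounded_linear_rot]])
  then have D: "frechet_derivative (rot_field j f) (at x) = (\<lambda>h. f x *\<^sub>R rot j h + f' h *\<^sub>R rot j x)"
    by (rule frechet_derivative_at[symmetric])
  have "f' (rot j x) = f' (\<Sum>b\<in>Basis. (rot j x \<bullet> b) *\<^sub>R b)" by (simp add: euclidean_representation)
  also have "\<dots> = (\<Sum>b\<in>Basis. (rot j x \<bullet> b) * f' b)"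
    using lin by (simp add: linear_sum linear_cmul)
  finally have "f' (rot j x) = (\<Sum>b\<in>Basis. (rot j x \<bullet> b) * f' b)" .
  then show ?thesis
    unfolding S2_div_def D Lie_eqI[OF f'] by (simp add: inner_add_left mult.commute)
qed

lemma L2_rot_field:
  assumes f: "real_polynomial_function f"
  shows "S2_Lp 2 (rot_field j f)"
proof -
  have "continuous_on S2 (rot_field j f)"
    unfolding rot_field_def[abs_def]
    by (intro continuous_on_scaleR poly_continuous_on f linear_continuous_on bounded_linear_rot)
  then show ?thesis
    unfolding S2_Lp_2_iff by (auto intro!: integrable_surface_continuous continuous_on_inner)
qed

lemma weak_gradient_rot_field:
  assumes "S2_weak_gradient \<phi> g" "real_polynomial_function f"
  shows "S2_inner \<phi> (Lie j f) = - S2_inner g (rot_field j f)"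
  using assms(1) rot_field_C1[OF assms(2)] rot_field_tangent rot_field_div[OF assms(2), of j]
  unfolding S2_weak_gradient_def
  by (metis (no_types, lifting) ext)

text \<open>At a point of the sphere this is the tangential part of the Euclidean gradient: the sum
  equals (x \<times> \<nabla>f) \<times> x, that is, |x|^2 \<nabla>f - (x \<bullet> \<nabla>f)
  x.\<close>

definition grad :: "(real^3 \<Rightarrow> real) \<Rightarrow> real^3 \<Rightarrow> real^3" where
  "grad f x = (\<Sum>j\<in>UNIV. Lie j f x *\<^sub>R rot j x)"

lemma L2_grad:
  assumes f: "real_polynomial_function f"
  shows "S2_Lp 2 (grad f)"
  using L2_sum[of UNIV "\<lambda>j. rot_field j (Lie j f)" "\<lambda>_. 1"] L2_rot_field[OF poly_Lie[OF f]]
  by (simp add: grad_def[abs_def] rot_field_def)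

text \<open>Green's formula. The weak gradient is tested with the fields
  \<open>rot_field j (Lie j f)\<close>, which add up to \<open>grad f\<close> and whose divergences
  add up to \<open>Lap f\<close>.\<close>

lemma weak_gradient_Lap:
  assumes \<phi>: "S2_Lp 2 \<phi>" and g: "S2_weak_gradient \<phi> g" and f: "real_polynomial_function f"
  shows "S2_inner \<phi> (Lap f) = - S2_inner g (grad f)"
proof -
  have "S2_inner \<phi> (Lap f) = S2_inner \<phi> (\<lambda>x. \<Sum>j\<in>UNIV. 1 *\<^sub>R Lie j (Lie j f) x)"
    by (simp add: Lap_def[abs_def])
  also have "\<dots> = (\<Sum>j\<in>UNIV. 1 * S2_inner \<phi> (Lie j (Lie j f)))"
    by (intro S2_inner_sum_right \<phi> poly_L2 poly_Lie f)
  also have "\<dots> = - (\<Sum>j\<in>UNIV. 1 * S2_inner g (rot_field j (Lie j f)))"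
    using weak_gradient_rot_field[OF g poly_Lie[OF f]] by (simp add: sum_negf)
  also have "(\<Sum>j\<in>UNIV. 1 * S2_inner g (rot_field j (Lie j f)))
      = S2_inner g (\<lambda>x. \<Sum>j\<in>UNIV. 1 *\<^sub>R rot_field j (Lie j f) x)"
    using g by (intro S2_inner_sum_right[symmetric] L2_rot_field poly_Lie f) (simp add: S2_weak_gradient_def)
  also have "\<dots> = S2_inner g (grad f)" by (simp add: grad_def[abs_def] rot_field_def)
  finally show ?thesis .
qed

text \<open>The combination of the fields \<open>rot j x\<close> with coefficients
  \<open>x $ j\<close> is x \<times> x = 0.\<close>

lemma Lie_radial:
  assumes f: "real_polynomial_function f"
  shows "(\<Sum>j\<in>UNIV. x $ j * Lie j f x) = 0"
proof -
  have lin: "linear (frechet_derivative f (at x))"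
    using poly_has_derivative[OF f] by (rule has_derivative_linear)
  have "(\<Sum>j\<in>UNIV. x $ j * Lie j f x) = frechet_derivative f (at x) (\<Sum>j\<in>UNIV. x $ j *\<^sub>R rot j x)"
    using lin by (simp add: Lie_def linear_sum linear_cmul)
  also have "(\<Sum>j\<in>UNIV. x $ j *\<^sub>R rot j x) = 0"
    by (simp add: vec_eq_iff forall_3 sum_3 rot_components)
  finally show ?thesis using lin by (simp add: linear_0)
qed

text \<open>With a and b the vectors of the \<open>Lie j f x\<close> and the
  \<open>Lie j g x\<close>, the gradients are a \<times> x and b \<times> x. Lagrange's identity
  gives the claim, because a and b are orthogonal to x by \<open>Lie_radial\<close>.\<close>

lemma grad_inner:
  assumes x: "x \<in> S2" and f: "real_polynomial_function f" and g: "real_polynomial_function g"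
  shows "grad f x \<bullet> grad g x = (\<Sum>j\<in>UNIV. Lie j f x * Lie j g x)"
proof -
  have lagrange: "grad f x \<bullet> grad g x = (x \<bullet> x) * (\<Sum>j\<in>UNIV. Lie j f x * Lie j g x)
      - (\<Sum>j\<in>UNIV. x $ j * Lie j f x) * (\<Sum>j\<in>UNIV. x $ j * Lie j g x)"
    unfolding grad_def inner_vec_def sum_3
    by (simp add: rot_components algebra_simps)
  moreover have "x \<bullet> x = 1" using x by (simp add: dot_square_norm)
  ultimately show ?thesis by (simp add: Lie_radial[OF f] Lie_radial[OF g])
qed

lemma S2_inner_grad:
  assumes f: "real_polynomial_function f" and g: "real_polynomial_function g"
  shows "S2_inner (grad f) (grad g) = - S2_inner (Lap f) g"
proof -
  have "S2_inner (grad f) (grad g) = (\<integral>x. (\<Sum>j\<in>UNIV. Lie j f x * Lie j g x) \<partial>surface_measure)"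
    unfolding S2_inner_def by (intro Bochner_Integration.integral_cong) (auto simp: grad_inner[OF _ f g])
  also have "\<dots> = (\<Sum>j\<in>UNIV. S2_inner (Lie j f) (Lie j g))"
    unfolding S2_inner_def inner_real_def
    by (intro Bochner_Integration.integral_sum integrable_surface_continuous continuous_intros
        poly_continuous_on poly_Lie f g)
  finally show ?thesis by (simp add: Lap_adjoint[OF f g])
qed

text \<open>The form \<open>m\<^sup>2 (\<phi>, \<psi>) + (\<nabla>\<phi>, \<nabla>\<psi>)\<close> is the \<open>L\<^sup>2\<close> product of the pairs \<open>(m \<phi>, \<nabla>\<phi>)\<close>.\<close>

definition energy_pair :: "real \<Rightarrow> (real^3 \<Rightarrow> real) \<Rightarrow> (real^3 \<Rightarrow> real^3) \<Rightarrow> real^3 \<Rightarrow> real \<times> (real^3)" where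
  "energy_pair m \<phi> g x = (m * \<phi> x, g x)"

lemma L2_energy_pair:
  assumes "S2_Lp 2 \<phi>" "S2_Lp 2 g"
  shows "S2_Lp 2 (energy_pair m \<phi> g)"
proof -
  have "integrable surface_measure (\<lambda>x. m\<^sup>2 * (\<phi> x \<bullet> \<phi> x) + g x \<bullet> g x)"
    using assms by (simp add: S2_Lp_2_iff)
  moreover have "energy_pair m \<phi> g \<in> borel_measurable surface_measure"
    unfolding energy_pair_def[abs_def] using assms[THEN L2_measurable] by measurable
  ultimately show ?thesis
    unfolding S2_Lp_2_iff by (simp add: energy_pair_def power2_eq_square algebra_simps)
qed

lemma S2_inner_energy_pair:
  assumes "S2_Lp 2 \<phi>" "S2_Lp 2 g" "S2_Lp 2 \<psi>" "S2_Lp 2 h"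
  shows "S2_inner (energy_pair m \<phi> g) (energy_pair m \<psi> h) = m\<^sup>2 * S2_inner \<phi> \<psi> + S2_inner g h"
proof -
  have "S2_inner (energy_pair m \<phi> g) (energy_pair m \<psi> h)
    = (\<integral>x. m\<^sup>2 * (\<phi> x \<bullet> \<psi> x) + g x \<bullet> h x \<partial>surface_measure)"
    unfolding S2_inner_def energy_pair_def
    by (intro Bochner_Integration.integral_cong) (auto simp: power2_eq_square)
  then show ?thesis
    using L2_integrable_inner[OF assms(1,3)] L2_integrable_inner[OF assms(2,4)]
    by (simp add: S2_inner_def)
qed

text \<open>The squared norm of the energy pair of a unit eigenfunction is its eigenvalue for m^2 -
  \<Delta>; the factor normalizes it.\<close>

definition eigenpair :: "real \<Rightarrow> nat \<Rightarrow> real^3 \<Rightarrow> real \<times> (real^3)" where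
  "eigenpair m s x = (1 / sqrt (m\<^sup>2 + ev (lev s))) *\<^sub>R energy_pair m (sph_harm s) (grad (sph_harm s)) x"

lemma ev_nonneg: "ev k \<ge> 0"
  by (simp add: ev_def)

lemma S2_inner_scaleR_right: "S2_inner f (\<lambda>x. c *\<^sub>R g x) = c * S2_inner f g"
  using S2_inner_scaleR_left[of c g f] by (simp add: S2_inner_commute)

lemma S2_inner_eigenpair:
  assumes m: "m > 0" and \<phi>: "S2_Lp 2 \<phi>" and g: "S2_weak_gradient \<phi> g"
  shows "S2_inner (energy_pair m \<phi> g) (eigenpair m s) = sqrt (m\<^sup>2 + ev (lev s)) * S2_inner \<phi> (sph_harm s)"
proof -
  define a where "a = m\<^sup>2 + ev (lev s)"
  have a: "a > 0" using m ev_nonneg[of "lev s"] by (simp add: a_def add_pos_nonneg)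
  have gL: "S2_Lp 2 g" using g by (simp add: S2_weak_gradient_def)
  have "S2_inner g (grad (sph_harm s)) = - S2_inner \<phi> (Lap (sph_harm s))"
    using weak_gradient_Lap[OF \<phi> g poly_sph_harm] by simp
  also have "S2_inner \<phi> (Lap (sph_harm s)) = S2_inner \<phi> (\<lambda>x. (- ev (lev s)) *\<^sub>R sph_harm s x)"
    by (rule S2_inner_cong) (simp_all add: Lap_sph_harm)
  also have "\<dots> = - ev (lev s) * S2_inner \<phi> (sph_harm s)"
    by (rule S2_inner_scaleR_right)
  finally have "S2_inner (energy_pair m \<phi> g) (energy_pair m (sph_harm s) (grad (sph_harm s))) = a * S2_inner \<phi> (sph_harm s)"
    using S2_inner_energy_pair[OF \<phi> gL poly_L2[OF poly_sph_harm] L2_grad[OF poly_sph_harm]]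
    by (simp add: a_def algebra_simps)
  then have "S2_inner (energy_pair m \<phi> g) (eigenpair m s) = 1 / sqrt a * (a * S2_inner \<phi> (sph_harm s))"
    unfolding eigenpair_def[abs_def] S2_inner_scaleR_right a_def by simp
  also have "\<dots> = sqrt a * S2_inner \<phi> (sph_harm s)"
    using a real_div_sqrt[of a] by (simp add: field_simps)
  finally show ?thesis by (simp add: a_def)
qed

lemma orthonormal0_eigenpair:
  assumes m: "m > 0"
  shows "orthonormal0 I (eigenpair m)"
proof -
  have L: "S2_Lp 2 (energy_pair m (sph_harm s) (grad (sph_harm s)))" for s
    by (intro L2_energy_pair poly_L2 L2_grad poly_sph_harm)
  have "S2_inner (eigenpair m s) (eigenpair m t) = S2_inner (sph_harm s) (sph_harm t)" for s t
  proof -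
    define a where "a r = m\<^sup>2 + ev (lev r)" for r
    have a: "a r > 0" for r using m ev_nonneg[of "lev r"] by (simp add: a_def add_pos_nonneg)
    have "S2_inner (grad (sph_harm s)) (grad (sph_harm t)) = - S2_inner (Lap (sph_harm s)) (sph_harm t)"
      by (rule S2_inner_grad[OF poly_sph_harm poly_sph_harm])
    also have "S2_inner (Lap (sph_harm s)) (sph_harm t) = S2_inner (\<lambda>x. (- ev (lev s)) *\<^sub>R sph_harm s x) (sph_harm t)"
      by (rule S2_inner_cong) (simp_all add: Lap_sph_harm)
    also have "\<dots> = - ev (lev s) * S2_inner (sph_harm s) (sph_harm t)" by (rule S2_inner_scaleR_left)
    finally have "S2_inner (energy_pair m (sph_harm s) (grad (sph_harm s))) (energy_pair m (sph_harm t) (grad (sph_harm t)))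
        = a s * S2_inner (sph_harm s) (sph_harm t)"
      using S2_inner_energy_pair[OF poly_L2[OF poly_sph_harm] L2_grad[OF poly_sph_harm] poly_L2[OF poly_sph_harm] L2_grad[OF poly_sph_harm]]
      by (simp add: a_def algebra_simps)
    then have "S2_inner (eigenpair m s) (eigenpair m t)
        = 1 / sqrt (a s) * (1 / sqrt (a t) * (a s * S2_inner (sph_harm s) (sph_harm t)))"
      unfolding eigenpair_def[abs_def] S2_inner_scaleR_right S2_inner_scaleR_left a_def by simp
    also have "\<dots> = S2_inner (sph_harm s) (sph_harm t)"
      using a[of s] sph_harm_orthogonal[of s t] by (cases "s = t") (simp_all add: field_simps)
    finally show ?thesis .
  qed
  moreover have "S2_Lp 2 (eigenpair m s)" for s
    unfolding eigenpair_def[abs_def] by (rule L2_scaleR[OF L])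
  ultimately show ?thesis
    using sph_harm_norm sph_harm_orthogonal by (simp add: orthonormal0_def)
qed

text \<open>Bessel's inequality for a single \<open>\<phi>\<close> against the system of eigenpairs.
  It serves the line Re z = 0.\<close>

lemma coefficient_bound:
  assumes m: "m > 0" and I: "finite I" and \<phi>: "S2_Lp 2 \<phi>" and g: "S2_weak_gradient \<phi> g"
  shows "(\<Sum>s\<in>I. (m\<^sup>2 + ev (lev s)) * (S2_inner \<phi> (sph_harm s))\<^sup>2) \<le> m\<^sup>2 * S2_inner \<phi> \<phi> + S2_inner g g"
proof -
  have gL: "S2_Lp 2 g" using g by (simp add: S2_weak_gradient_def)
  have "(\<Sum>s\<in>I. (S2_inner (energy_pair m \<phi> g) (eigenpair m s))\<^sup>2)
      \<le> S2_inner (energy_pair m \<phi> g) (energy_pair m \<phi> g)"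
    by (intro bessel orthonormal0_eigenpair m I L2_energy_pair \<phi> gL)
  then show ?thesis
    unfolding S2_inner_eigenpair[OF m \<phi> g] S2_inner_energy_pair[OF \<phi> gL \<phi> gL]
    by (simp add: power_mult_distrib ev_nonneg)
qed

text \<open>Here Bessel's inequality is used with exchanged roles: the energy pairs of the
  \<open>\<phi> j\<close> form the orthonormal system, and a combination of eigenpairs is tested
  against it. Later the weights contain the values of the harmonics at a fixed point, which makes
  the bound pointwise.\<close>

lemma dual_coefficient_bound:
  assumes m: "m > 0" and I: "finite I" and J: "finite J"
    and \<phi>: "\<And>j. j \<in> J \<Longrightarrow> S2_Lp 2 (\<phi> j)" and g: "\<And>j. j \<in> J \<Longrightarrow> S2_weak_gradient (\<phi> j) (g j)"
    and orth: "\<And>i j. i \<in> J \<Longrightarrow> j \<in> J \<Longrightarrow>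
      m\<^sup>2 * S2_inner (\<phi> i) (\<phi> j) + S2_inner (g i) (g j) = (if i = j then 1 else 0)"
  shows "(\<Sum>j\<in>J. (\<Sum>s\<in>I. w s * (sqrt (m\<^sup>2 + ev (lev s)) * S2_inner (\<phi> j) (sph_harm s)))\<^sup>2) \<le> (\<Sum>s\<in>I. (w s)\<^sup>2)"
proof -
  define h where "h x = (\<Sum>s\<in>I. w s *\<^sub>R eigenpair m s x)" for x
  define \<Phi> where "\<Phi> j = energy_pair m (\<phi> j) (g j)" for j
  have gL: "S2_Lp 2 (g j)" if "j \<in> J" for j using g[OF that] by (simp add: S2_weak_gradient_def)
  have \<Phi>: "S2_Lp 2 (\<Phi> j)" if "j \<in> J" for j
    unfolding \<Phi>_def by (rule L2_energy_pair[OF \<phi>[OF that] gL[OF that]])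
  have "orthonormal0 J \<Phi>"
    using \<Phi> orth \<phi> gL by (auto simp: orthonormal0_def \<Phi>_def S2_inner_energy_pair)
  note E = orthonormal0_eigenpair[OF m, of I]
  have EL: "S2_Lp 2 (eigenpair m s)" if "s \<in> I" for s using E that by (simp add: orthonormal0_def)
  have h: "S2_Lp 2 h" unfolding h_def[abs_def] by (intro L2_sum EL)
  have "S2_inner h (\<Phi> j) = (\<Sum>s\<in>I. w s * (sqrt (m\<^sup>2 + ev (lev s)) * S2_inner (\<phi> j) (sph_harm s)))" if j: "j \<in> J" for j
  proof -
    have "S2_inner h (\<Phi> j) = (\<Sum>s\<in>I. w s * S2_inner (eigenpair m s) (\<Phi> j))"
      unfolding h_def[abs_def] by (intro S2_inner_sum_left EL \<Phi> j)
    then show ?thesis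
      unfolding S2_inner_commute[of _ "\<Phi> j"] by (simp add: \<Phi>_def S2_inner_eigenpair[OF m \<phi>[OF j] g[OF j]])
  qed
  then have "(\<Sum>j\<in>J. (\<Sum>s\<in>I. w s * (sqrt (m\<^sup>2 + ev (lev s)) * S2_inner (\<phi> j) (sph_harm s)))\<^sup>2)
      = (\<Sum>j\<in>J. (S2_inner h (\<Phi> j))\<^sup>2)" by simp
  also have "\<dots> \<le> S2_inner h h" by (rule bessel[OF \<open>orthonormal0 J \<Phi>\<close> J h])
  also have "\<dots> = (\<Sum>s\<in>I. w s * w s * S2_inner (eigenpair m s) (eigenpair m s))"
    unfolding h_def[abs_def] by (rule S2_inner_sums[OF E I])
  also have "\<dots> \<le> (\<Sum>s\<in>I. (w s)\<^sup>2)"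
    using E by (intro sum_mono) (auto simp: orthonormal0_def power2_eq_square)
  finally show ?thesis .
qed

section \<open>The three lines theorem and the eigenvalue sum\<close>

text \<open>The factor exp (e (z^2 - 1)) has modulus at most 1 on the strip and decays as |Im z|
  grows, so the maximum principle on a tall rectangle suffices; then e tends to 0.\<close>

lemma three_lines_normalized:
  fixes G :: "complex \<Rightarrow> complex"
  assumes hol: "G holomorphic_on UNIV"
    and bnd: "\<And>z. 0 \<le> Re z \<Longrightarrow> Re z \<le> 1 \<Longrightarrow> norm (G z) \<le> M"
    and left: "\<And>z. Re z = 0 \<Longrightarrow> norm (G z) \<le> 1"
    and right: "\<And>z. Re z = 1 \<Longrightarrow> norm (G z) \<le> 1"
    and t: "0 \<le> t" "t \<le> 1"
  shows "norm (G (of_real t)) \<le> 1"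
proof -
  have eps: "norm (G (of_real t)) \<le> exp e" if e: "e > 0" for e
  proof -
    define H where "H z = G z * exp (of_real e * (z\<^sup>2 - 1))" for z
    have normH: "norm (H z) = norm (G z) * exp (e * ((Re z)\<^sup>2 - (Im z)\<^sup>2 - 1))" for z
      by (simp add: H_def norm_mult norm_exp_eq_Re Re_power2)
    \<comment> \<open>Tall enough for the decay exp (- e R^2) on the horizontal edges to be at most
      exp (- |M|), which beats the bound M.\<close>
    define R where "R = sqrt (\<bar>M\<bar> / e) + 1"
    have R: "R > 0" "\<bar>M\<bar> \<le> e * R\<^sup>2"
    proof -
      have s: "sqrt (\<bar>M\<bar> / e) \<ge> 0" using e by simp
      then show "R > 0" unfolding R_def by (rule add_nonneg_pos) simp
      have "\<bar>M\<bar> / e = (sqrt (\<bar>M\<bar> / e))\<^sup>2" using e by simp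
      also have "\<dots> \<le> R\<^sup>2" unfolding R_def using s by (intro power_mono) auto
      finally show "\<bar>M\<bar> \<le> e * R\<^sup>2" using e by (simp add: field_simps)
    qed
    define S where "S = cbox (Complex 0 (- R)) (Complex 1 R)"
    have holH: "H holomorphic_on A" for A
      unfolding H_def by (intro holomorphic_intros holomorphic_on_subset[OF hol]) auto
    have "norm (H (of_real t)) \<le> 1"
    proof (rule maximum_modulus_frontier[of H S])
      show "H holomorphic_on interior S" by (rule holH)
      show "continuous_on (closure S) H" by (rule holomorphic_on_imp_continuous_on[OF holH])
      show "bounded S" by (simp add: S_def)
      show "complex_of_real t \<in> S" using t R by (simp add: S_def in_cbox_complex_iff)
      fix z assume "z \<in> frontier S"
      then have z: "0 \<le> Re z" "Re z \<le> 1" "\<bar>Im z\<bar> \<le> R" "Re z = 0 \<or> Re z = 1 \<or> \<bar>Im z\<bar> = R"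
        unfolding S_def frontier_cbox by (auto simp: in_cbox_complex_iff in_box_complex_iff)
      have x: "(Re z)\<^sup>2 \<le> 1" using z by (simp add: power_le_one)
      have e1: "exp (e * ((Re z)\<^sup>2 - (Im z)\<^sup>2 - 1)) \<le> 1"
      proof -
        have "(Re z)\<^sup>2 - (Im z)\<^sup>2 - 1 \<le> 0" using x zero_le_power2[of "Im z"] by linarith
        then show ?thesis using e by (simp add: mult_nonneg_nonpos)
      qed
      show "norm (H z) \<le> 1"
      proof (cases "\<bar>Im z\<bar> = R")
        case False
        then have "norm (G z) \<le> 1" using z left right by blast
        then show ?thesis unfolding normH using mult_mono[OF _ e1, of "norm (G z)" 1] by simp
      next
        case True
        then have "(Im z)\<^sup>2 = R\<^sup>2" by (metis power2_abs)
        then have "e * ((Re z)\<^sup>2 - (Im z)\<^sup>2 - 1) \<le> e * (- R\<^sup>2)"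
          using e x by (intro mult_left_mono) auto
        then have "exp (e * ((Re z)\<^sup>2 - (Im z)\<^sup>2 - 1)) \<le> exp (- \<bar>M\<bar>)" using R by simp
        then have "norm (H z) \<le> \<bar>M\<bar> * exp (- \<bar>M\<bar>)"
          unfolding normH using bnd[OF z(1,2)] by (intro mult_mono) auto
        also have "\<dots> \<le> exp \<bar>M\<bar> * exp (- \<bar>M\<bar>)"
        proof (rule mult_right_mono)
          have "\<bar>M\<bar> \<le> 1 + \<bar>M\<bar>" by simp
          also have "\<dots> \<le> exp \<bar>M\<bar>" by (rule exp_ge_add_one_self)
          finally show "\<bar>M\<bar> \<le> exp \<bar>M\<bar>" .
        qed simp
        also have "\<dots> = 1" by (simp add: exp_minus)
        finally show ?thesis .
      qed
    qed
    then have "norm (G (of_real t)) * exp (e * (t\<^sup>2 - 1)) \<le> 1"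
      by (simp add: normH)
    then have "norm (G (of_real t)) \<le> exp (e * (1 - t\<^sup>2))"
      by (simp add: exp_minus[symmetric] field_simps exp_add[symmetric] exp_diff)
    also have "\<dots> \<le> exp e"
    proof -
      have "e * (1 - t\<^sup>2) \<le> e * 1" using e by (intro mult_left_mono) auto
      then show ?thesis by simp
    qed
    finally show ?thesis .
  qed
  have "((\<lambda>e. exp e) \<longlongrightarrow> exp (0::real)) (at_right 0)"
    by (intro tendsto_intros)
  moreover have "eventually (\<lambda>e. norm (G (of_real t)) \<le> exp e) (at_right 0)"
    using eps by (auto simp: eventually_at_right_field intro!: exI[of _ 1])
  ultimately show ?thesis
    using tendsto_lowerbound[of exp "exp 0" "at_right (0::real)" "norm (G (of_real t))"] by simp
qed

text \<open>Division by A^(1 - z) B^z reduces to bound 1 on both lines. As \<open>B\<close> may be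
  0, which happens for \<open>V = 0\<close>, a larger \<open>B'\<close> is used first and then
  lowered to \<open>B\<close>.\<close>

theorem three_lines:
  fixes F :: "complex \<Rightarrow> complex"
  assumes hol: "F holomorphic_on UNIV"
    and bnd: "\<And>z. 0 \<le> Re z \<Longrightarrow> Re z \<le> 1 \<Longrightarrow> norm (F z) \<le> K"
    and left: "\<And>z. Re z = 0 \<Longrightarrow> norm (F z) \<le> A"
    and right: "\<And>z. Re z = 1 \<Longrightarrow> norm (F z) \<le> B"
    and A: "A > 0" and B: "B \<ge> 0" and t: "0 < t" "t < 1"
  shows "norm (F (of_real t)) \<le> A powr (1 - t) * B powr t"
proof -
  have pos: "norm (F (of_real t)) \<le> A powr (1 - t) * B' powr t" if B': "B' > B" for B'
  proof -
    have B0: "B' > 0" using B B' by simp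
    define E where "E z = exp (- ((1 - z) * of_real (ln A)) - z * of_real (ln B'))" for z :: complex
    have normE: "norm (E z) = exp (- ((1 - Re z) * ln A) - Re z * ln B')" for z
      by (simp add: E_def norm_exp_eq_Re)
    have "norm (F (of_real t) * E (of_real t)) \<le> 1"
    proof (rule three_lines_normalized[where G = "\<lambda>z. F z * E z"])
      show "(\<lambda>z. F z * E z) holomorphic_on UNIV"
        unfolding E_def by (intro holomorphic_intros hol)
      show "norm (F z * E z) \<le> \<bar>K\<bar> * exp (\<bar>ln A\<bar> + \<bar>ln B'\<bar>)" if z: "0 \<le> Re z" "Re z \<le> 1" for z
      proof -
        have "\<bar>(1 - Re z) * ln A\<bar> \<le> \<bar>ln A\<bar>" "\<bar>Re z * ln B'\<bar> \<le> \<bar>ln B'\<bar>"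
          using z by (auto simp: abs_mult intro!: mult_left_le_one_le)
        then have "- ((1 - Re z) * ln A) - Re z * ln B' \<le> \<bar>ln A\<bar> + \<bar>ln B'\<bar>" by linarith
        then show ?thesis
          unfolding norm_mult normE using bnd[OF z] by (intro mult_mono) auto
      qed
      show "norm (F z * E z) \<le> 1" if z: "Re z = 0" for z
        using left[OF z] A by (simp add: norm_mult normE z exp_minus field_simps)
      show "norm (F z * E z) \<le> 1" if z: "Re z = 1" for z
        using right[OF z] B' B0 by (simp add: norm_mult normE z exp_minus field_simps)
    qed (use t in auto)
    then have "norm (F (of_real t)) \<le> exp ((1 - t) * ln A + t * ln B')"
      by (simp add: norm_mult normE exp_diff exp_minus exp_add field_simps)
    then show ?thesis using A B0 by (simp add: powr_def exp_add)
  qed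
  have "((\<lambda>B'. A powr (1 - t) * B' powr t) \<longlongrightarrow> A powr (1 - t) * B powr t) (at_right B)"
    using t B by (intro tendsto_intros tendsto_powr') (auto simp: eventually_at_right_field intro!: exI[of _ "B + 1"])
  moreover have "eventually (\<lambda>B'. norm (F (of_real t)) \<le> A powr (1 - t) * B' powr t) (at_right B)"
    using pos by (auto simp: eventually_at_right_field intro!: exI[of _ "B + 1"])
  ultimately show ?thesis by (rule tendsto_lowerbound) simp
qed

text \<open>The midpoint rule for the convex function s^(-q): the right side is its integral over
  [c - h, c + h]. The proof differentiates in the half-length, where a symmetric second difference
  appears.\<close>

lemma powr_midpoint:
  fixes c h q :: real
  assumes q: "q > 1" and h: "0 \<le> h" "h < c"
  shows "2 * h * c powr (- q) \<le> ((c - h) powr (1 - q) - (c + h) powr (1 - q)) / (q - 1)"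
proof -
  define \<psi> where "\<psi> t = (c - t) powr (1 - q) - (c + t) powr (1 - q) - (q - 1) * (2 * t * c powr (- q))" for t
  have "\<psi> 0 \<le> \<psi> h"
  proof (rule DERIV_nonneg_imp_nondecreasing[OF h(1)])
    fix t assume t: "0 \<le> t" "t \<le> h"
    define d where "d = (c - t) powr (- q) + (c + t) powr (- q) - 2 * c powr (- q)"
    have pos: "c - t > 0" "c + t > 0" "c > 0" using t h by auto
    have "(\<psi> has_real_derivative (q - 1) * d) (at t)"
      unfolding \<psi>_def d_def using pos
      by (auto intro!: derivative_eq_intros simp: algebra_simps)
    moreover have "d \<ge> 0"
    proof -
      \<comment> \<open>Convexity by means of the inequality between arithmetic and geometric means:
        (c - t) (c + t) \<le> c^2 bounds c^(-q) by \<open>u * v\<close>.\<close>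
      define u where "u = (c - t) powr (- q / 2)"
      define v where "v = (c + t) powr (- q / 2)"
      have uv: "u * u = (c - t) powr (- q)" "v * v = (c + t) powr (- q)"
        unfolding u_def v_def by (simp_all add: powr_add[symmetric])
      have "c powr (- q) = (c * c) powr (- q / 2)"
        using pos by (simp add: powr_mult powr_add[symmetric])
      also have "\<dots> \<le> ((c - t) * (c + t)) powr (- q / 2)"
      proof (rule powr_mono2')
        show "0 < (c - t) * (c + t)" using pos by simp
      qed (use q in \<open>auto simp: algebra_simps\<close>)
      also have "\<dots> = u * v" using pos by (simp add: u_def v_def powr_mult)
      finally have "c powr (- q) \<le> u * v" .
      moreover have "2 * (u * v) \<le> u * u + v * v"
        using zero_le_square[of "u - v"] by (simp add: algebra_simps)
      ultimately show ?thesis unfolding d_def uv[symmetric] by linarith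
    qed
    ultimately show "\<exists>y. (\<psi> has_real_derivative y) (at t) \<and> 0 \<le> y"
      using q by (intro exI[of _ "(q - 1) * d"]) simp
  qed
  then have "(q - 1) * (2 * h * c powr (- q)) \<le> (c - h) powr (1 - q) - (c + h) powr (1 - q)"
    by (simp add: \<psi>_def)
  then show ?thesis using q by (simp add: pos_le_divide_eq mult.commute)
qed

text \<open>The intervals \<open>[k\<^sup>2 - 1/2, (k + 1)\<^sup>2 - 1/2]\<close> have length \<open>2 k + 1\<close> and midpoint \<open>k (k + 1)\<close>,
  so by convexity the sum is at most an integral over \<open>[1/2, \<infinity>)\<close>.\<close>

lemma eigenvalue_sum_le:
  fixes M q :: real
  assumes M: "M > 0" and q: "q > 1"
  shows "(\<Sum>k=1..N. (2 * real k + 1) * (M + ev k) powr (- q)) \<le> M powr (1 - q) / (q - 1)"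
proof -
  \<comment> \<open>The integral of (M + t)^(-q) over t from k^2 - 1/2 to infinity.\<close>
  define g where "g k = (M + (real k)\<^sup>2 - 1/2) powr (1 - q) / (q - 1)" for k :: nat
  have step: "(2 * real k + 1) * (M + ev k) powr (- q) \<le> g k - g (Suc k)" if k: "k \<ge> 1" for k
  proof -
    \<comment> \<open>The interval must stay where the base is positive. This uses k \<ge> 1; for k
      = 0 it would fail when M \<le> 1/2.\<close>
    have "real k + 1/2 < M + ev k"
    proof -
      have "real k * real k \<ge> 1" using k by (simp add: mult_ge1_I)
      then show ?thesis using M by (simp add: ev_def algebra_simps)
    qed
    from powr_midpoint[OF q _ this]
    have "2 * (real k + 1/2) * (M + ev k) powr (- q)
      \<le> ((M + ev k - (real k + 1/2)) powr (1 - q) - (M + ev k + (real k + 1/2)) powr (1 - q)) / (q - 1)"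
      by simp
    moreover have "M + ev k - (real k + 1/2) = M + (real k)\<^sup>2 - 1/2"
      "M + ev k + (real k + 1/2) = M + (real (Suc k))\<^sup>2 - 1/2"
      by (simp_all add: ev_def power2_eq_square algebra_simps)
    moreover have "2 * (real k + 1/2) = 2 * real k + 1" by simp
    ultimately show ?thesis by (simp only: g_def diff_divide_distrib)
  qed
  have "(\<Sum>k=1..N. (2 * real k + 1) * (M + ev k) powr (- q)) \<le> (\<Sum>k=1..N. g k - g (Suc k))"
    by (intro sum_mono step) simp
  also have "\<dots> = g 1 - g (Suc N)"
    by (induction N) simp_all
  also have "\<dots> \<le> g 1" using q by (simp add: g_def)
  also have "\<dots> \<le> M powr (1 - q) / (q - 1)"
    unfolding g_def using M q by (intro divide_right_mono powr_mono2') auto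
  finally show ?thesis .
qed

section \<open>Interpolation for truncated families\<close>

lemma sum_shells:
  fixes f :: "nat \<Rightarrow> 'a::comm_monoid_add"
  shows "(\<Sum>k=1..N. \<Sum>s\<in>shell k. f s) = (\<Sum>s\<in>{1..<(Suc N)\<^sup>2}. f s)"
proof (induction N)
  case (Suc N)
  have "1 \<le> (Suc N)\<^sup>2" "(Suc N)\<^sup>2 \<le> (Suc (Suc N))\<^sup>2" by (simp_all add: power_mono)
  then have "(\<Sum>s\<in>{1..<(Suc (Suc N))\<^sup>2}. f s) = (\<Sum>s\<in>{1..<(Suc N)\<^sup>2}. f s) + (\<Sum>s\<in>shell (Suc N). f s)"
    unfolding shell_def by (rule sum.atLeastLessThan_concat[symmetric])
  with Suc show ?case by simp
qed simp

text \<open>The weak gradients are parameters, so the choice made by \<open>S2_grad\<close> enters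
  only when the locale is interpreted.\<close>

locale orthonormal_family =
  fixes m :: real and n :: nat and \<phi> :: "nat \<Rightarrow> real^3 \<Rightarrow> real" and g :: "nat \<Rightarrow> real^3 \<Rightarrow> real^3"
  assumes m: "m > 0" and n: "n \<ge> 1"
    and L2: "\<And>j. j \<in> {1..n} \<Longrightarrow> S2_Lp 2 (\<phi> j)"
    and weak: "\<And>j. j \<in> {1..n} \<Longrightarrow> S2_weak_gradient (\<phi> j) (g j)"
    and mean: "\<And>j. j \<in> {1..n} \<Longrightarrow> (\<integral>x. \<phi> j x \<partial>surface_measure) = 0"
    and orth: "\<And>i j. i \<in> {1..n} \<Longrightarrow> j \<in> {1..n} \<Longrightarrow>
      m\<^sup>2 * S2_inner (\<phi> i) (\<phi> j) + S2_inner (g i) (g j) = (if i = j then 1 else 0)"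
begin

definition cf :: "nat \<Rightarrow> nat \<Rightarrow> real" where "cf j s = S2_inner (\<phi> j) (sph_harm s)"

definition layer :: "nat \<Rightarrow> nat \<Rightarrow> real^3 \<Rightarrow> real" where
  "layer j k x = (\<Sum>s\<in>shell k. cf j s * sph_harm s x)"

text \<open>The sum starts at degree 1; \<open>cf_0\<close> shows that nothing is lost.\<close>

definition trunc :: "nat \<Rightarrow> nat \<Rightarrow> real^3 \<Rightarrow> real" where
  "trunc N j x = (\<Sum>k=1..N. layer j k x)"

definition dens :: "nat \<Rightarrow> real^3 \<Rightarrow> real" where
  "dens N x = (\<Sum>j=1..n. (trunc N j x)\<^sup>2)"

definition lam :: "nat \<Rightarrow> real" where "lam k = m\<^sup>2 + ev k"

lemma lam_pos: "lam k > 0"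
  using m ev_nonneg[of k] by (simp add: lam_def add_pos_nonneg)

lemma continuous_sph_harm: "continuous_on A (sph_harm s)"
  by (rule poly_continuous_on[OF poly_sph_harm])

lemma continuous_layer: "continuous_on A (layer j k)"
  unfolding layer_def[abs_def] by (intro continuous_intros continuous_sph_harm)

lemma continuous_trunc: "continuous_on A (trunc N j)"
  unfolding trunc_def[abs_def] by (intro continuous_intros continuous_layer)

lemma continuous_dens: "continuous_on A (dens N)"
  unfolding dens_def[abs_def] by (intro continuous_intros continuous_trunc)

lemma dens_nonneg: "dens N x \<ge> 0"
  unfolding dens_def by (intro sum_nonneg) simp

lemma layer_sum:
  "(\<Sum>k=1..N. c k * layer j k x) = (\<Sum>s\<in>{1..<(Suc N)\<^sup>2}. (c (lev s) * cf j s) * sph_harm s x)"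
proof -
  have "(\<Sum>k=1..N. c k * layer j k x) = (\<Sum>k=1..N. \<Sum>s\<in>shell k. (c (lev s) * cf j s) * sph_harm s x)"
    unfolding layer_def sum_distrib_left by (intro sum.cong refl) (simp add: lev_shell mult.assoc)
  then show ?thesis by (simp only: sum_shells)
qed

lemma integral_layer_sum_le:
  "(\<integral>x. (\<Sum>k=1..N. c k * layer j k x)\<^sup>2 \<partial>surface_measure) \<le> (\<Sum>s\<in>{1..<(Suc N)\<^sup>2}. (c (lev s))\<^sup>2 * (cf j s)\<^sup>2)"
proof -
  let ?I = "{1..<(Suc N)\<^sup>2}"
  let ?f = "\<lambda>x. \<Sum>s\<in>?I. (c (lev s) * cf j s) *\<^sub>R sph_harm s x"
  have "(\<integral>x. (\<Sum>k=1..N. c k * layer j k x)\<^sup>2 \<partial>surface_measure) = S2_inner ?f ?f"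
    unfolding layer_sum S2_inner_def by (simp add: power2_eq_square)
  also have "\<dots> = (\<Sum>s\<in>?I. (c (lev s) * cf j s) * (c (lev s) * cf j s) * S2_inner (sph_harm s) (sph_harm s))"
    by (rule S2_inner_sums[OF orthonormal0_sph_harm]) simp
  also have "\<dots> \<le> (\<Sum>s\<in>?I. (c (lev s))\<^sup>2 * (cf j s)\<^sup>2)"
  proof (rule sum_mono)
    fix s
    show "(c (lev s) * cf j s) * (c (lev s) * cf j s) * S2_inner (sph_harm s) (sph_harm s) \<le> (c (lev s))\<^sup>2 * (cf j s)\<^sup>2"
      using sph_harm_norm[of s] by (auto simp: power2_eq_square)
  qed
  finally show ?thesis .
qed

text \<open>At a fixed point this is \<open>dual_coefficient_bound\<close> with the weights
  \<open>d (lev s) * sph_harm s x\<close>, whose squares add up to multiples of the shell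
  sums.\<close>

lemma layer_sum_pointwise_le:
  "(\<Sum>j=1..n. (\<Sum>k=1..N. (d k * sqrt (lam k)) * layer j k x)\<^sup>2) \<le> (\<Sum>k=1..N. (d k)\<^sup>2 * shell_sum k x)"
proof -
  let ?I = "{1..<(Suc N)\<^sup>2}"
  have "(\<Sum>j=1..n. (\<Sum>k=1..N. (d k * sqrt (lam k)) * layer j k x)\<^sup>2)
    = (\<Sum>j=1..n. (\<Sum>s\<in>?I. (d (lev s) * sph_harm s x) * (sqrt (m\<^sup>2 + ev (lev s)) * S2_inner (\<phi> j) (sph_harm s)))\<^sup>2)"
    unfolding layer_sum by (intro sum.cong refl arg_cong[where f = "\<lambda>u. u\<^sup>2"]) (simp add: lam_def cf_def)
  also have "\<dots> \<le> (\<Sum>s\<in>?I. (d (lev s) * sph_harm s x)\<^sup>2)"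
    by (intro dual_coefficient_bound[where g = g] m L2 weak orth) auto
  also have "\<dots> = (\<Sum>k=1..N. \<Sum>s\<in>shell k. (d (lev s) * sph_harm s x)\<^sup>2)"
    by (rule sum_shells[symmetric])
  also have "\<dots> = (\<Sum>k=1..N. (d k)\<^sup>2 * shell_sum k x)"
    unfolding shell_sum_def sum_distrib_left
    by (intro sum.cong refl) (simp add: lev_shell power2_eq_square mult_ac)
  finally show ?thesis .
qed

definition layers :: "nat \<Rightarrow> (nat \<Rightarrow> complex) \<Rightarrow> nat \<Rightarrow> real^3 \<Rightarrow> complex" where
  "layers N w j x = (\<Sum>k=1..N. w k * of_real (layer j k x))"

lemma norm_layers_square:
  "(norm (layers N w j x))\<^sup>2 =
    (\<Sum>k=1..N. Re (w k) * layer j k x)\<^sup>2 + (\<Sum>k=1..N. Im (w k) * layer j k x)\<^sup>2"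
  by (simp add: layers_def cmod_power2 Re_sum Im_sum)

lemma continuous_layers: "continuous_on A (layers N w j)"
  unfolding layers_def[abs_def] by (intro continuous_intros continuous_layer)

text \<open>The line Re z = 0, where the multipliers have modulus \<open>sqrt (lam k)\<close>: by
  \<open>coefficient_bound\<close> each member of the family contributes at most its energy, which
  is 1.\<close>

lemma integral_layers_le:
  assumes w: "\<And>k. (norm (w k))\<^sup>2 = lam k"
  shows "(\<integral>x. (\<Sum>j=1..n. (norm (layers N w j x))\<^sup>2) \<partial>surface_measure) \<le> real n"
proof -
  let ?I = "{1..<(Suc N)\<^sup>2}"
  have one: "(\<integral>x. (norm (layers N w j x))\<^sup>2 \<partial>surface_measure) \<le> 1" if j: "j \<in> {1..n}" for j
  proof -
    have i: "integrable surface_measure (\<lambda>x. (\<Sum>k=1..N. c k * layer j k x)\<^sup>2)" for c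
      by (intro integrable_surface_continuous continuous_intros continuous_layer)
    have "(\<integral>x. (norm (layers N w j x))\<^sup>2 \<partial>surface_measure)
      = (\<integral>x. (\<Sum>k=1..N. Re (w k) * layer j k x)\<^sup>2 \<partial>surface_measure)
      + (\<integral>x. (\<Sum>k=1..N. Im (w k) * layer j k x)\<^sup>2 \<partial>surface_measure)"
      unfolding norm_layers_square by (intro Bochner_Integration.integral_add i)
    also have "\<dots> \<le> (\<Sum>s\<in>?I. (Re (w (lev s)))\<^sup>2 * (cf j s)\<^sup>2) + (\<Sum>s\<in>?I. (Im (w (lev s)))\<^sup>2 * (cf j s)\<^sup>2)"
      by (intro add_mono integral_layer_sum_le)
    also have "\<dots> = (\<Sum>s\<in>?I. lam (lev s) * (cf j s)\<^sup>2)"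
      unfolding sum.distrib[symmetric] w[symmetric] cmod_power2 by (simp add: algebra_simps)
    also have "\<dots> \<le> m\<^sup>2 * S2_inner (\<phi> j) (\<phi> j) + S2_inner (g j) (g j)"
      unfolding lam_def cf_def by (intro coefficient_bound m L2 weak j) simp
    also have "\<dots> = 1" using orth[OF j j] by simp
    finally show ?thesis .
  qed
  have "(\<integral>x. (\<Sum>j=1..n. (norm (layers N w j x))\<^sup>2) \<partial>surface_measure)
    = (\<Sum>j=1..n. \<integral>x. (norm (layers N w j x))\<^sup>2 \<partial>surface_measure)"
    by (intro Bochner_Integration.integral_sum integrable_surface_continuous continuous_intros continuous_layers)
  also have "\<dots> \<le> (\<Sum>j=1..n. 1)" by (intro sum_mono one)
  finally show ?thesis by simp
qed

text \<open>The upper bound C for the diagonal of the kernel: 4 pi comes from the addition theorem,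
  the rest from \<open>eigenvalue_sum_le\<close> with M = m^2.\<close>

definition trace_const :: "real \<Rightarrow> real" where
  "trace_const q = m powr (2 * (1 - q)) / (q - 1) / (4 * pi)"

text \<open>The line Re z = 1, where the squared multipliers have modulus lam^(1 - q).\<close>

lemma layers_pointwise_le:
  assumes x: "x \<in> S2" and q: "q > 1" and w: "\<And>k. (norm (w k))\<^sup>2 = lam k * lam k powr (- q)"
  shows "(\<Sum>j=1..n. (norm (layers N w j x))\<^sup>2) \<le> trace_const q"
proof -
  \<comment> \<open>Bessel's inequality is available over the reals, so real and imaginary parts are
    treated separately; the factor \<open>sqrt (lam k)\<close> is split off to fit
    \<open>layer_sum_pointwise_le\<close>.\<close>
  define d e where "d k = Re (w k) / sqrt (lam k)" and "e k = Im (w k) / sqrt (lam k)" for k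
  have s: "sqrt (lam k) > 0" for k using lam_pos by simp
  have re: "Re (w k) = d k * sqrt (lam k)" and im: "Im (w k) = e k * sqrt (lam k)" for k
    using less_imp_neq[OF s[of k]] by (simp_all add: d_def e_def)
  have de: "(d k)\<^sup>2 + (e k)\<^sup>2 = lam k powr (- q)" for k
  proof -
    have "lam k * ((d k)\<^sup>2 + (e k)\<^sup>2) = (norm (w k))\<^sup>2"
      using lam_pos[of k] unfolding cmod_power2 re im by (simp add: power_mult_distrib algebra_simps)
    then show ?thesis using w[of k] lam_pos[of k] by simp
  qed
  have "(\<Sum>j=1..n. (norm (layers N w j x))\<^sup>2)
    = (\<Sum>j=1..n. (\<Sum>k=1..N. (d k * sqrt (lam k)) * layer j k x)\<^sup>2)
    + (\<Sum>j=1..n. (\<Sum>k=1..N. (e k * sqrt (lam k)) * layer j k x)\<^sup>2)"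
    unfolding norm_layers_square sum.distrib re im ..
  also have "\<dots> \<le> (\<Sum>k=1..N. (d k)\<^sup>2 * shell_sum k x) + (\<Sum>k=1..N. (e k)\<^sup>2 * shell_sum k x)"
    by (intro add_mono layer_sum_pointwise_le)
  also have "\<dots> = (\<Sum>k=1..N. lam k powr (- q) * shell_sum k x)"
    unfolding sum.distrib[symmetric] de[symmetric] by (simp add: algebra_simps)
  also have "\<dots> \<le> (\<Sum>k=1..N. lam k powr (- q) * ((2 * real k + 1) / (4 * pi)))"
    by (intro sum_mono mult_left_mono shell_sum_le x) simp
  also have "\<dots> = (\<Sum>k=1..N. (2 * real k + 1) * (m\<^sup>2 + ev k) powr (- q)) / (4 * pi)"
    by (simp add: sum_divide_distrib lam_def mult.commute)
  also have "\<dots> \<le> ((m\<^sup>2) powr (1 - q) / (q - 1)) / (4 * pi)"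
    using m q by (intro divide_right_mono eigenvalue_sum_le) auto
  also have "(m\<^sup>2) powr (1 - q) = m powr (2 * (1 - q))"
  proof -
    have "m\<^sup>2 = m powr 2" using m by (simp add: powr_numeral)
    then show ?thesis by (simp only: powr_powr)
  qed
  finally show ?thesis by (simp add: trace_const_def)
qed

definition layer_form :: "nat \<Rightarrow> (real^3) set \<Rightarrow> nat \<Rightarrow> nat \<Rightarrow> real" where
  "layer_form N A k l = (\<integral>x. indicator A x * (\<Sum>j=1..n. layer j k x * layer j l x) \<partial>surface_measure)"

text \<open>The squares carry no complex conjugation, so the form is holomorphic in the multipliers.
  Moduli enter only in \<open>norm_layers_form_le\<close>.\<close>

lemma layers_form:
  assumes A: "A \<in> sets surface_measure"
  shows "(\<Sum>k=1..N. \<Sum>l=1..N. w k * w l * of_real (layer_form N A k l))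
    = (\<integral>x. indicator A x *\<^sub>R (\<Sum>j=1..n. (layers N w j x)\<^sup>2) \<partial>surface_measure)"
proof -
  have i: "integrable surface_measure (\<lambda>x. indicator A x * (\<Sum>j=1..n. layer j k x * layer j l x))" for k l
    using integrable_mult_indicator[OF A integrable_surface_continuous, of "\<lambda>x. \<Sum>j=1..n. layer j k x * layer j l x"]
    by (simp add: continuous_layer continuous_on_sum continuous_on_mult)
  have ic: "integrable surface_measure (\<lambda>x. w k * w l * of_real (indicator A x * (\<Sum>j=1..n. layer j k x * layer j l x)))" for k l
    by (intro integrable_mult_right integrable_of_real i)
  have "(\<Sum>k=1..N. \<Sum>l=1..N. w k * w l * of_real (layer_form N A k l))
    = (\<Sum>k=1..N. \<Sum>l=1..N. \<integral>x. w k * w l * of_real (indicator A x * (\<Sum>j=1..n. layer j k x * layer j l x)) \<partial>surface_measure)"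
  proof (intro sum.cong refl)
    fix k l
    have "(\<integral>x. w k * w l * complex_of_real (indicator A x * (\<Sum>j=1..n. layer j k x * layer j l x)) \<partial>surface_measure)
      = w k * w l * (\<integral>x. complex_of_real (indicator A x * (\<Sum>j=1..n. layer j k x * layer j l x)) \<partial>surface_measure)"
      by (rule Bochner_Integration.integral_mult_right) (intro integrable_of_real i)
    then show "w k * w l * of_real (layer_form N A k l)
      = (\<integral>x. w k * w l * complex_of_real (indicator A x * (\<Sum>j=1..n. layer j k x * layer j l x)) \<partial>surface_measure)"
      by (simp only: layer_form_def integral_complex_of_real)
  qed
  also have "\<dots> = (\<integral>x. (\<Sum>k=1..N. \<Sum>l=1..N. w k * w l * of_real (indicator A x * (\<Sum>j=1..n. layer j k x * layer j l x))) \<partial>surface_measure)"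
    by (rule sym, rule trans[OF Bochner_Integration.integral_sum])
      (intro sum.cong refl Bochner_Integration.integral_sum Bochner_Integration.integrable_sum ic)+
  also have "\<dots> = (\<integral>x. indicator A x *\<^sub>R (\<Sum>j=1..n. (layers N w j x)\<^sup>2) \<partial>surface_measure)"
  proof (rule Bochner_Integration.integral_cong[OF refl])
    fix x
    have "(\<Sum>j=1..n. (layers N w j x)\<^sup>2)
      = (\<Sum>j=1..n. \<Sum>k=1..N. \<Sum>l=1..N. (w k * of_real (layer j k x)) * (w l * of_real (layer j l x)))"
      unfolding layers_def power2_eq_square sum_product ..
    also have "\<dots> = (\<Sum>k=1..N. \<Sum>l=1..N. \<Sum>j=1..n. (w k * of_real (layer j k x)) * (w l * of_real (layer j l x)))"
      by (rule trans[OF sum.swap], rule sum.cong[OF refl], rule sum.swap)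
    also have "\<dots> = (\<Sum>k=1..N. \<Sum>l=1..N. w k * w l * of_real (\<Sum>j=1..n. layer j k x * layer j l x))"
      by (simp add: sum_distrib_left mult_ac)
    finally show "(\<Sum>k=1..N. \<Sum>l=1..N. w k * w l * of_real (indicator A x * (\<Sum>j=1..n. layer j k x * layer j l x)))
      = indicator A x *\<^sub>R (\<Sum>j=1..n. (layers N w j x)\<^sup>2)"
      by (cases "x \<in> A") simp_all
  qed
  finally show ?thesis .
qed

lemma norm_layers_form_le:
  assumes A: "A \<in> sets surface_measure"
  shows "norm (\<Sum>k=1..N. \<Sum>l=1..N. w k * w l * of_real (layer_form N A k l))
    \<le> (\<integral>x. indicator A x * (\<Sum>j=1..n. (norm (layers N w j x))\<^sup>2) \<partial>surface_measure)"
  unfolding layers_form[OF A]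
proof (rule Bochner_Integration.integral_norm_bound_integral)
  show "integrable surface_measure (\<lambda>x. indicator A x *\<^sub>R (\<Sum>j=1..n. (layers N w j x)\<^sup>2))"
    by (intro integrable_mult_indicator A integrable_surface_continuous continuous_intros continuous_layers)
  have "integrable surface_measure (\<lambda>x. indicator A x *\<^sub>R (\<Sum>j=1..n. (norm (layers N w j x))\<^sup>2))"
    by (intro integrable_mult_indicator A integrable_surface_continuous continuous_intros continuous_layers)
  then show "integrable surface_measure (\<lambda>x. indicator A x * (\<Sum>j=1..n. (norm (layers N w j x))\<^sup>2))"
    by simp
  show "norm (indicator A x *\<^sub>R (\<Sum>j=1..n. (layers N w j x)\<^sup>2))
      \<le> indicator A x * (\<Sum>j=1..n. (norm (layers N w j x))\<^sup>2)" for x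
    using norm_sum[of "\<lambda>j. (layers N w j x)\<^sup>2" "{1..n}"]
    by (cases "x \<in> A") (simp_all add: norm_power)
qed

text \<open>With \<open>B = (m\<^sup>2 - \<Delta>)\<^sup>-\<^sup>q\<close> and \<open>P\<close> the projection to the span of the \<open>(m\<^sup>2 - \<Delta>)\<^sup>1\<^sup>/\<^sup>2 \<phi>\<^sub>j\<close>, the function
  \<open>G z\<close> of the proof is the trace of \<open>P B\<^sup>z\<^sup>/\<^sup>2 V\<^sup>q\<^sup>z B\<^sup>z\<^sup>/\<^sup>2\<close>, and \<open>w z k\<close> stands for
  \<open>(m\<^sup>2 - \<Delta>)\<^sup>1\<^sup>/\<^sup>2 B\<^sup>z\<^sup>/\<^sup>2\<close> on the eigenspace of degree \<open>k\<close>.\<close>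

lemma simple_weight_bound:
  assumes V: "simple_function surface_measure V" "\<And>x. V x \<ge> 0" and q: "q > 1"
  shows "(\<integral>x. V x * dens N x \<partial>surface_measure)
    \<le> real n powr (1 - 1 / q) * (trace_const q * (\<integral>x. V x powr q \<partial>surface_measure)) powr (1 / q)"
proof -
  define A where "A v = V -` {v} \<inter> S2" for v
  \<comment> \<open>The value 0 is left out: its contribution should vanish, whereas
    \<open>ln 0 = 0\<close> would turn the exponential weight into 1.\<close>
  define R where "R = V ` S2 - {0}"
  have R: "finite R" "\<And>v. v \<in> R \<Longrightarrow> v > 0"
    using simple_functionD(1)[OF V(1)] V(2) by (auto simp: R_def order_less_le)
  have A: "A v \<in> sets surface_measure" for v
    using simple_functionD(2)[OF V(1), of "{v}"] by (simp add: A_def)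
  have decomp: "(\<Sum>v\<in>R. h v * indicator (A v) x) = (if V x = 0 then 0 else h (V x))"
    if "x \<in> S2" for x and h :: "real \<Rightarrow> real"
  proof -
    have "(\<Sum>v\<in>R. h v * indicator (A v) x) = (\<Sum>v\<in>R. if v = V x then h v else 0)"
      using that by (intro sum.cong) (auto simp: A_def indicator_def)
    also have "\<dots> = (if V x = 0 then 0 else h (V x))"
      using that R(1) by (auto simp: R_def)
    finally show ?thesis .
  qed
  have int: "(\<Sum>v\<in>R. h v * (\<integral>x. indicator (A v) x * f x \<partial>surface_measure))
      = (\<integral>x. (if V x = 0 then 0 else h (V x)) * f x \<partial>surface_measure)"
    if f: "continuous_on S2 f" for h :: "real \<Rightarrow> real" and f
  proof -
    have i: "integrable surface_measure (\<lambda>x. indicator (A v) x * f x)" for v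
      using integrable_mult_indicator[OF A integrable_surface_continuous[OF f]] by simp
    have "(\<Sum>v\<in>R. h v * (\<integral>x. indicator (A v) x * f x \<partial>surface_measure))
      = (\<integral>x. (\<Sum>v\<in>R. h v * (indicator (A v) x * f x)) \<partial>surface_measure)"
      using i by (subst Bochner_Integration.integral_sum) auto
    also have "\<dots> = (\<integral>x. (if V x = 0 then 0 else h (V x)) * f x \<partial>surface_measure)"
    proof (rule Bochner_Integration.integral_cong[OF refl])
      fix x assume "x \<in> space surface_measure"
      then have "(\<Sum>v\<in>R. h v * indicator (A v) x) * f x = (if V x = 0 then 0 else h (V x)) * f x"
        by (subst decomp) simp_all
      then show "(\<Sum>v\<in>R. h v * (indicator (A v) x * f x)) = (if V x = 0 then 0 else h (V x)) * f x"
        by (simp add: sum_distrib_right mult.assoc)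
    qed
    finally show ?thesis .
  qed
  \<comment> \<open>This is lam^((1 - q z) / 2): its modulus is lam^(1/2) on Re z = 0 and lam^((1 -
    q) / 2) on Re z = 1, and it equals 1 at z = 1 / q.\<close>
  define w where "w z k = of_real (sqrt (lam k)) * exp (of_real (- (q / 2) * ln (lam k)) * z)" for z :: complex and k
  define Q where "Q z v = (\<Sum>k=1..N. \<Sum>l=1..N. w z k * w z l * complex_of_real (layer_form N (A v) k l))" for z v
  define G where "G z = (\<Sum>v\<in>R. exp (of_real (q * ln v) * z) * Q z v)" for z
  have norm_w: "norm (w z k) = sqrt (lam k) * exp (- (q / 2) * ln (lam k) * Re z)" for z k
    using lam_pos[of k] by (simp add: w_def norm_mult norm_exp_eq_Re)
  have QB: "norm (Q z v) \<le> (\<integral>x. indicator (A v) x * (\<Sum>j=1..n. (norm (layers N (w z) j x))\<^sup>2) \<partial>surface_measure)" for z v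
    unfolding Q_def by (rule norm_layers_form_le[OF A])
  have GB: "norm (G z) \<le> (\<Sum>v\<in>R. exp (q * ln v * Re z) *
      (\<integral>x. indicator (A v) x * (\<Sum>j=1..n. (norm (layers N (w z) j x))\<^sup>2) \<partial>surface_measure))" for z
    unfolding G_def
  proof (rule order_trans[OF norm_sum sum_mono])
    fix v
    show "norm (exp (of_real (q * ln v) * z) * Q z v) \<le> exp (q * ln v * Re z) *
        (\<integral>x. indicator (A v) x * (\<Sum>j=1..n. (norm (layers N (w z) j x))\<^sup>2) \<partial>surface_measure)"
      unfolding norm_mult by (rule mult_mono[OF _ QB]) (simp_all add: norm_exp_eq_Re)
  qed
  have co: "continuous_on S2 (\<lambda>x. \<Sum>j=1..n. (norm (layers N u j x))\<^sup>2)" for u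
    by (intro continuous_intros continuous_layers)
  have "norm (G (of_real (1 / q))) \<le> real n powr (1 - 1 / q) * (trace_const q * (\<integral>x. V x powr q \<partial>surface_measure)) powr (1 / q)"
  proof (rule three_lines)
    show "G holomorphic_on UNIV"
      unfolding G_def[abs_def] Q_def w_def by (intro holomorphic_intros)
    \<comment> \<open>\<open>W\<close> and \<open>L\<close> provide only the crude bound on the
      strip that the three lines theorem asks for; their size does not enter the result.\<close>
    define W where "W k = sqrt (lam k) * exp \<bar>(q / 2) * ln (lam k)\<bar>" for k
    define L where "L v = (\<Sum>k=1..N. \<Sum>l=1..N. W k * W l * \<bar>layer_form N (A v) k l\<bar>)" for v
    have W: "W k \<ge> 0" for k using lam_pos[of k] by (simp add: W_def)
    show "norm (G z) \<le> (\<Sum>v\<in>R. exp \<bar>q * ln v\<bar> * L v)" if z: "0 \<le> Re z" "Re z \<le> 1" for z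
    proof -
      have e: "exp (r * Re z) \<le> exp \<bar>r\<bar>" for r
      proof -
        have "\<bar>r * Re z\<bar> \<le> \<bar>r\<bar>" using z by (auto simp: abs_mult intro!: mult_left_le)
        then show ?thesis by simp
      qed
      have nw: "norm (w z k) \<le> W k" for k
        unfolding norm_w W_def using e[of "- (q / 2) * ln (lam k)"] lam_pos[of k]
        by (intro mult_left_mono) auto
      have nQ: "norm (Q z v) \<le> L v" for v
        unfolding Q_def L_def
      proof (rule order_trans[OF norm_sum sum_mono], rule order_trans[OF norm_sum sum_mono])
        fix k l
        show "norm (w z k * w z l * complex_of_real (layer_form N (A v) k l)) \<le> W k * W l * \<bar>layer_form N (A v) k l\<bar>"
          unfolding norm_mult norm_of_real by (intro mult_right_mono mult_mono nw W) auto
      qed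
      show ?thesis
        unfolding G_def
      proof (rule order_trans[OF norm_sum sum_mono])
        fix v
        have "norm (exp (complex_of_real (q * ln v) * z)) \<le> exp \<bar>q * ln v\<bar>"
          using e[of "q * ln v"] by (simp add: norm_exp_eq_Re)
        then show "norm (exp (complex_of_real (q * ln v) * z) * Q z v) \<le> exp \<bar>q * ln v\<bar> * L v"
          unfolding norm_mult by (rule mult_mono[OF _ nQ]) auto
      qed
    qed
    show "norm (G z) \<le> real n" if z: "Re z = 0" for z
    proof -
      have "norm (G z) \<le> (\<Sum>v\<in>R. 1 * (\<integral>x. indicator (A v) x * (\<Sum>j=1..n. (norm (layers N (w z) j x))\<^sup>2) \<partial>surface_measure))"
        using GB[of z] by (simp add: z)
      also have "\<dots> = (\<integral>x. (if V x = 0 then 0 else 1) * (\<Sum>j=1..n. (norm (layers N (w z) j x))\<^sup>2) \<partial>surface_measure)"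
        by (rule int[OF co])
      also have "\<dots> \<le> (\<integral>x. (\<Sum>j=1..n. (norm (layers N (w z) j x))\<^sup>2) \<partial>surface_measure)"
        by (rule integral_mono'[OF integrable_surface_continuous[OF co]]) (auto intro: sum_nonneg)
      also have "\<dots> \<le> real n"
        by (rule integral_layers_le) (use lam_pos in \<open>simp add: norm_w z less_imp_le\<close>)
      finally show ?thesis .
    qed
    show "norm (G z) \<le> trace_const q * (\<integral>x. V x powr q \<partial>surface_measure)" if z: "Re z = 1" for z
    proof -
      have "norm (G z) \<le> (\<Sum>v\<in>R. v powr q * (\<integral>x. indicator (A v) x * (\<Sum>j=1..n. (norm (layers N (w z) j x))\<^sup>2) \<partial>surface_measure))"
      proof -
        have "exp (q * ln v * Re z) = v powr q" if "v \<in> R" for v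
          using R(2)[OF that] by (simp add: z powr_def)
        then show ?thesis using GB[of z] by (simp cong: sum.cong)
      qed
      also have "\<dots> = (\<integral>x. (if V x = 0 then 0 else V x powr q) * (\<Sum>j=1..n. (norm (layers N (w z) j x))\<^sup>2) \<partial>surface_measure)"
        by (rule int[OF co])
      also have "\<dots> \<le> (\<integral>x. V x powr q * trace_const q \<partial>surface_measure)"
      proof (rule integral_mono')
        have "finite ((\<lambda>x. V x powr q * trace_const q) ` S2)"
          using simple_functionD(1)[OF V(1)] finite_imageI[of "V ` S2" "\<lambda>v. v powr q * trace_const q"]
          by (simp add: image_image)
        then obtain B where "\<forall>x\<in>S2. norm (V x powr q * trace_const q) \<le> B"
          using finite_imp_bounded[of "(\<lambda>x. V x powr q * trace_const q) ` S2"] by (auto simp: bounded_iff)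
        moreover have "V \<in> borel_measurable surface_measure"
          by (rule borel_measurable_simple_function[OF V(1)])
        then have "(\<lambda>x. V x powr q * trace_const q) \<in> borel_measurable surface_measure" by measurable
        ultimately show "integrable surface_measure (\<lambda>x. V x powr q * trace_const q)"
          by (intro bounded_measurable_integrable[where B = B]) auto
        have nw: "(norm (w z k))\<^sup>2 = lam k * lam k powr (- q)" for k
        proof -
          have "(exp (- (q / 2) * ln (lam k)))\<^sup>2 = exp (- q * ln (lam k))"
            by (simp add: power2_eq_square exp_add[symmetric])
          then show ?thesis
            using lam_pos[of k] by (simp add: norm_w z power_mult_distrib powr_def less_imp_le)
        qed
        show "(if V x = 0 then 0 else V x powr q) * (\<Sum>j=1..n. (norm (layers N (w z) j x))\<^sup>2) \<le> V x powr q * trace_const q"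
          if "x \<in> space surface_measure" for x
          using layers_pointwise_le[OF _ q nw, of x N] that by (auto intro!: mult_left_mono)
        show "0 \<le> V x powr q * trace_const q" for x using q by (simp add: trace_const_def)
      qed
      also have "\<dots> = trace_const q * (\<integral>x. V x powr q \<partial>surface_measure)" by simp
      finally show ?thesis .
    qed
    have "trace_const q \<ge> 0" using q by (simp add: trace_const_def)
    then show "trace_const q * (\<integral>x. V x powr q \<partial>surface_measure) \<ge> 0" by simp
  qed (use n q in auto)
  moreover have "G (of_real (1 / q)) = of_real (\<integral>x. V x * dens N x \<partial>surface_measure)"
  proof -
    \<comment> \<open>At this point all multipliers are 1, so the forms become integrals of the
      truncated density.\<close>
    have w1: "w (of_real (1 / q)) k = 1" for k
    proof -
      have "exp (complex_of_real (- (q / 2) * ln (lam k)) * of_real (1 / q)) = of_real (exp (- (1 / 2) * ln (lam k)))"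
      proof -
        have r: "- (q / 2) * ln (lam k) * (1 / q) = - (1 / 2) * ln (lam k)" using q by simp
        show ?thesis unfolding of_real_mult[symmetric] r by (rule exp_of_real)
      qed
      also have "exp (- (1 / 2) * ln (lam k)) = 1 / sqrt (lam k)"
        using lam_pos[of k] by (simp add: powr_half_sqrt[symmetric] powr_def exp_minus field_simps)
      finally show ?thesis using lam_pos[of k] unfolding w_def by (simp flip: of_real_mult)
    qed
    have tr: "layers N (\<lambda>k. 1) j x = of_real (trunc N j x)" for j x
      by (simp add: layers_def trunc_def)
    have Q1: "Q (of_real (1 / q)) v = of_real (\<integral>x. indicator (A v) x * dens N x \<partial>surface_measure)" for v
    proof -
      have "Q (of_real (1 / q)) v
        = (\<integral>x. indicator (A v) x *\<^sub>R (\<Sum>j=1..n. (layers N (\<lambda>k. 1) j x)\<^sup>2) \<partial>surface_measure)"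
        unfolding Q_def w1 by (rule layers_form[OF A])
      also have "\<dots> = of_real (\<integral>x. indicator (A v) x * dens N x \<partial>surface_measure)"
        unfolding tr dens_def integral_complex_of_real[symmetric] by (simp add: scaleR_conv_of_real)
      finally show ?thesis .
    qed
    have "G (of_real (1 / q)) = of_real (\<Sum>v\<in>R. v * (\<integral>x. indicator (A v) x * dens N x \<partial>surface_measure))"
      unfolding G_def Q1 of_real_sum
    proof (intro sum.cong refl)
      fix v assume "v \<in> R"
      have r: "q * ln v * (1 / q) = ln v" using q by simp
      have "exp (complex_of_real (q * ln v) * of_real (1 / q)) = of_real (exp (ln v))"
        unfolding of_real_mult[symmetric] r by (rule exp_of_real)
      also have "exp (ln v) = v" using R(2)[OF \<open>v \<in> R\<close>] by simp
      finally show "exp (complex_of_real (q * ln v) * of_real (1 / q)) *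
          of_real (\<integral>x. indicator (A v) x * dens N x \<partial>surface_measure)
        = of_real (v * (\<integral>x. indicator (A v) x * dens N x \<partial>surface_measure))"
        by (simp only: of_real_mult)
    qed
    also have "(\<Sum>v\<in>R. v * (\<integral>x. indicator (A v) x * dens N x \<partial>surface_measure)) = (\<integral>x. V x * dens N x \<partial>surface_measure)"
      unfolding int[OF continuous_dens] by (intro Bochner_Integration.integral_cong) auto
    finally show ?thesis .
  qed
  ultimately show ?thesis by simp
qed

end

section \<open>The density of the full family\<close>

context orthonormal_family
begin

lemma \<phi>_square_integrable:
  assumes "j \<in> {1..n}"
  shows "\<phi> j \<in> borel_measurable surface_measure" "integrable surface_measure (\<lambda>x. (\<phi> j x)\<^sup>2)"
  using L2[OF assms] by (simp_all add: S2_Lp_2_iff power2_eq_square)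

text \<open>\<open>sph_harm 0\<close> is constant. This is where the zero mean condition
  enters.\<close>

lemma cf_0:
  assumes j: "j \<in> {1..n}"
  shows "cf j 0 = 0"
proof -
  have "cf j 0 = (\<integral>x. \<phi> j x * sph_harm 0 0 \<partial>surface_measure)"
    unfolding cf_def S2_inner_def inner_real_def by (subst sph_harm_0) (rule refl)
  then show ?thesis by (simp add: mean[OF j])
qed

lemma trunc_eq:
  assumes j: "j \<in> {1..n}"
  shows "trunc N j x = (\<Sum>s<(Suc N)\<^sup>2. cf j s * sph_harm s x)"
proof -
  have "trunc N j x = (\<Sum>s\<in>{1..<(Suc N)\<^sup>2}. cf j s * sph_harm s x)"
    using layer_sum[where c = "\<lambda>_. 1"] by (simp add: trunc_def)
  also have "\<dots> = (\<Sum>s<(Suc N)\<^sup>2. cf j s * sph_harm s x)"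
  proof (rule sum.mono_neutral_left)
    show "\<forall>s\<in>{..<(Suc N)\<^sup>2} - {1..<(Suc N)\<^sup>2}. cf j s * sph_harm s x = 0"
      using cf_0[OF j] by (auto simp: not_le)
  qed auto
  finally show ?thesis .
qed

text \<open>Completeness of the harmonics: once the degrees included cover a polynomial close to
  \<open>\<phi> j\<close>, the truncation is at least as close, being the best
  approximation.\<close>

lemma trunc_converges:
  assumes j: "j \<in> {1..n}"
  shows "(\<lambda>N. \<integral>x. (\<phi> j x - trunc N j x)\<^sup>2 \<partial>surface_measure) \<longlonglongrightarrow> 0"
proof (rule LIMSEQ_I)
  fix e :: real assume e: "e > 0"
  obtain h where h: "real_polynomial_function h" "(\<integral>x. (\<phi> j x - h x)\<^sup>2 \<partial>surface_measure) < e"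
    using poly_dense_L2[OF \<phi>_square_integrable[OF j]] e unfolding poly_approximable_def by blast
  obtain n0 where n0: "bspan n0 h" using poly_bspan[OF h(1)] by blast
  have "norm ((\<integral>x. (\<phi> j x - trunc N j x)\<^sup>2 \<partial>surface_measure) - 0) < e" if N: "N \<ge> n0" for N
  proof -
    have "n0 \<le> (Suc N)\<^sup>2" using N by (simp add: power2_eq_square)
    then have b: "bspan ((Suc N)\<^sup>2) h" by (rule bspan_mono[OF n0])
    have "(\<integral>x. (\<phi> j x - trunc N j x)\<^sup>2 \<partial>surface_measure)
      = S2_inner (\<lambda>x. \<phi> j x - (\<Sum>s<(Suc N)\<^sup>2. S2_inner (\<phi> j) (sph_harm s) *\<^sub>R sph_harm s x))
          (\<lambda>x. \<phi> j x - (\<Sum>s<(Suc N)\<^sup>2. S2_inner (\<phi> j) (sph_harm s) *\<^sub>R sph_harm s x))"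
      unfolding S2_inner_def[of "\<lambda>x. \<phi> j x - _ x"] trunc_eq[OF j] cf_def by (simp add: power2_eq_square)
    also have "\<dots> \<le> S2_inner (\<lambda>x. \<phi> j x - (\<Sum>s<(Suc N)\<^sup>2. S2_inner h (sph_harm s) *\<^sub>R sph_harm s x))
          (\<lambda>x. \<phi> j x - (\<Sum>s<(Suc N)\<^sup>2. S2_inner h (sph_harm s) *\<^sub>R sph_harm s x))"
      by (rule best_approximation[OF orthonormal0_sph_harm _ L2[OF j]]) simp
    also have "\<dots> = S2_inner (\<lambda>x. \<phi> j x - h x) (\<lambda>x. \<phi> j x - h x)"
      using bspan_expand[OF b] by (intro S2_inner_cong) (simp_all only: real_scaleR_def)
    also have "\<dots> < e" using h(2) by (simp add: S2_inner_def power2_eq_square)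
    finally show ?thesis by simp
  qed
  then show "\<exists>no. \<forall>N\<ge>no. norm ((\<integral>x. (\<phi> j x - trunc N j x)\<^sup>2 \<partial>surface_measure) - 0) < e" by blast
qed

lemma integrable_dens_powr:
  assumes r: "r \<ge> 0"
  shows "integrable surface_measure (\<lambda>x. dens N x powr r)"
proof -
  have "bounded (dens N ` S2)"
    by (intro compact_imp_bounded compact_continuous_image continuous_dens compact_sphere)
  then obtain B where "\<forall>x\<in>S2. \<bar>dens N x\<bar> \<le> B" by (auto simp: bounded_iff)
  then have B: "dens N x \<le> B" if "x \<in> S2" for x using that by (blast intro: abs_le_D1)
  have "dens N \<in> borel_measurable surface_measure"
    by (rule borel_measurable_surface_continuous[OF continuous_dens])
  then have "(\<lambda>x. dens N x powr r) \<in> borel_measurable surface_measure" by measurable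
  moreover have "norm (dens N x powr r) \<le> B powr r" if "x \<in> S2" for x
    using B[OF that] dens_nonneg r by (simp add: powr_mono2)
  ultimately show ?thesis by (rule bounded_measurable_integrable)
qed

text \<open>Duality with the extremal weight, the power p - 1 of the density: its power q is the
  integrand of \<open>K\<close> again, and so is its product with the density. Thus \<open>K\<close>
  is bounded by a multiple of its own power 1 / q.\<close>

lemma dens_bound:
  assumes p: "p > 1" and q: "q = p / (p - 1)"
  shows "(\<integral>x. dens N x powr p \<partial>surface_measure) \<le> (real n powr (1 / p) * trace_const q powr (1 / q)) powr p"
proof -
  define K where "K = (\<integral>x. dens N x powr p \<partial>surface_measure)"
  have K: "K \<ge> 0" unfolding K_def by simp
  have q1: "q > 1" using p by (simp add: q)
  have pq: "(p - 1) * q = p" "1 - 1 / q = 1 / p" "1 / p + 1 / q = 1"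
    using p by (simp_all add: q field_simps)
  have Cq: "trace_const q > 0" using q1 m by (simp add: trace_const_def)
  have meas: "(\<lambda>x. dens N x powr (p - 1)) \<in> borel_measurable surface_measure"
    using integrable_dens_powr[of "p - 1" N] p by (intro borel_measurable_integrable) simp
  \<comment> \<open>The extremal weight is not simple, so it is approached from below by simple
    functions.\<close>
  obtain V where V: "incseq V" "\<And>i. simple_function surface_measure (V i)"
      "\<And>x. bdd_above (range (\<lambda>i. V i x))" "\<And>i x. 0 \<le> V i x" "(\<lambda>x. dens N x powr (p - 1)) = (SUP i. V i)"
    using borel_measurable_implies_simple_function_sequence_real[OF meas powr_ge_zero] by metis
  have sup: "dens N x powr (p - 1) = (SUP i. V i x)" for x
    using fun_cong[OF V(5), of x] by (simp add: image_image)
  have V_le: "V i x \<le> dens N x powr (p - 1)" for i x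
    unfolding sup by (rule cSUP_upper[OF _ V(3)]) simp
  have V_lim: "(\<lambda>i. V i x) \<longlonglongrightarrow> dens N x powr (p - 1)" for x
    unfolding sup using V(1) by (intro LIMSEQ_incseq_SUP V(3)) (auto simp: incseq_def le_fun_def)
  have split: "dens N x powr (p - 1) * dens N x = dens N x powr p" for x
    using powr_mult_base[OF dens_nonneg, of N x "p - 1"] by (simp add: mult.commute)
  have Vm: "V i \<in> borel_measurable surface_measure" for i
    by (rule borel_measurable_simple_function[OF V(2)])
  have dm: "dens N \<in> borel_measurable surface_measure"
    by (rule borel_measurable_surface_continuous[OF continuous_dens])
  have "(\<lambda>i. \<integral>x. V i x * dens N x \<partial>surface_measure) \<longlonglongrightarrow> K"
    unfolding K_def
  proof (rule integral_dominated_convergence[where w = "\<lambda>x. dens N x powr p"])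
    show "AE x in surface_measure. (\<lambda>i. V i x * dens N x) \<longlonglongrightarrow> dens N x powr p"
      unfolding split[symmetric] by (intro AE_I2 tendsto_mult V_lim tendsto_const)
    show "AE x in surface_measure. norm (V i x * dens N x) \<le> dens N x powr p" for i
      unfolding split[symmetric] using V(4) dens_nonneg V_le
      by (intro AE_I2) (simp add: abs_mult mult_right_mono)
    show "integrable surface_measure (\<lambda>x. dens N x powr p)" using p by (intro integrable_dens_powr) simp
    then show "(\<lambda>x. dens N x powr p) \<in> borel_measurable surface_measure" by simp
    show "(\<lambda>x. V i x * dens N x) \<in> borel_measurable surface_measure" for i
      using Vm dm by measurable
  qed
  moreover have "(\<integral>x. V i x * dens N x \<partial>surface_measure) \<le> real n powr (1 / p) * (trace_const q * K) powr (1 / q)" for i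
  proof -
    have "(\<integral>x. V i x powr q \<partial>surface_measure) \<le> K"
      unfolding K_def
    proof (rule integral_mono')
      show "integrable surface_measure (\<lambda>x. dens N x powr p)" using p by (intro integrable_dens_powr) simp
      show "V i x powr q \<le> dens N x powr p" for x
        using powr_mono2[of q, OF _ V(4) V_le] q1 by (simp add: powr_powr pq)
    qed simp
    then have "real n powr (1 - 1 / q) * (trace_const q * (\<integral>x. V i x powr q \<partial>surface_measure)) powr (1 / q)
        \<le> real n powr (1 - 1 / q) * (trace_const q * K) powr (1 / q)"
      using Cq q1 by (intro mult_left_mono powr_mono2) auto
    with simple_weight_bound[OF V(2,4) q1, of i N] show ?thesis unfolding pq by linarith
  qed
  ultimately have le: "K \<le> real n powr (1 / p) * (trace_const q * K) powr (1 / q)"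
    by (intro LIMSEQ_le_const2) auto
  have "K \<le> (real n powr (1 / p) * trace_const q powr (1 / q)) powr p"
  proof (cases "K = 0")
    case False
    then have K0: "K > 0" using K by simp
    \<comment> \<open>One factor \<open>K powr (1 / q)\<close> is split off so that it can be
      cancelled against the right side.\<close>
    have "K powr (1 / p) * K powr (1 / q) = K"
      using K0 pq by (simp add: powr_add[symmetric])
    also note le
    also have "real n powr (1 / p) * (trace_const q * K) powr (1 / q) = (real n powr (1 / p) * trace_const q powr (1 / q)) * K powr (1 / q)"
      using Cq K0 by (simp add: powr_mult)
    finally have "K powr (1 / p) \<le> real n powr (1 / p) * trace_const q powr (1 / q)"
      using K0 by simp
    then have "(K powr (1 / p)) powr p \<le> (real n powr (1 / p) * trace_const q powr (1 / q)) powr p"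
      using p by (intro powr_mono2) auto
    then show ?thesis using p K0 by (simp add: powr_powr)
  qed simp
  then show ?thesis by (simp add: K_def)
qed

text \<open>The squared errors are summed over j before a subsequence is extracted, so that one
  subsequence serves the whole family.\<close>

lemma dens_AE_subseq:
  obtains r :: "nat \<Rightarrow> nat" where
    "AE x in surface_measure. (\<lambda>i. dens (r i) x) \<longlonglongrightarrow> (\<Sum>j=1..n. (\<phi> j x)\<^sup>2)"
proof -
  define u where "u N x = (\<Sum>j=1..n. (\<phi> j x - trunc N j x)\<^sup>2)" for N x
  have i: "integrable surface_measure (\<lambda>x. (\<phi> j x - trunc N j x)\<^sup>2)" if j: "j \<in> {1..n}" for j N
  proof -
    have "trunc N j \<in> borel_measurable surface_measure" "integrable surface_measure (\<lambda>x. (trunc N j x)\<^sup>2)"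
      by (intro borel_measurable_surface_continuous integrable_surface_continuous continuous_intros continuous_trunc)+
    with \<phi>_square_integrable[OF j] show ?thesis
      using integrable_square_lincomb[of "\<phi> j" "trunc N j" 1 "-1"] by simp
  qed
  have "(\<lambda>N. \<integral>x. norm (u N x) \<partial>surface_measure) = (\<lambda>N. \<Sum>j=1..n. \<integral>x. (\<phi> j x - trunc N j x)\<^sup>2 \<partial>surface_measure)"
  proof
    fix N
    have "(\<integral>x. norm (u N x) \<partial>surface_measure) = (\<integral>x. u N x \<partial>surface_measure)"
      by (intro Bochner_Integration.integral_cong) (simp_all add: u_def sum_nonneg)
    also have "\<dots> = (\<Sum>j=1..n. \<integral>x. (\<phi> j x - trunc N j x)\<^sup>2 \<partial>surface_measure)"
      unfolding u_def by (intro Bochner_Integration.integral_sum i)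
    finally show "(\<integral>x. norm (u N x) \<partial>surface_measure) = (\<Sum>j=1..n. \<integral>x. (\<phi> j x - trunc N j x)\<^sup>2 \<partial>surface_measure)" .
  qed
  moreover have "(\<lambda>N. \<Sum>j=1..n. \<integral>x. (\<phi> j x - trunc N j x)\<^sup>2 \<partial>surface_measure) \<longlonglongrightarrow> (\<Sum>j=1..n. 0)"
    by (intro tendsto_sum trunc_converges)
  ultimately have lim: "(\<lambda>N. \<integral>x. norm (u N x) \<partial>surface_measure) \<longlonglongrightarrow> 0" by simp
  have "integrable surface_measure (u N)" for N
    unfolding u_def by (intro Bochner_Integration.integrable_sum i)
  from tendsto_L1_AE_subseq[OF this lim] obtain r :: "nat \<Rightarrow> nat" where
    ae: "AE x in surface_measure. (\<lambda>i. u (r i) x) \<longlonglongrightarrow> 0" by auto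
  have "(\<lambda>i. dens (r i) x) \<longlonglongrightarrow> (\<Sum>j=1..n. (\<phi> j x)\<^sup>2)" if ux: "(\<lambda>i. u (r i) x) \<longlonglongrightarrow> 0" for x
    unfolding dens_def
  proof (intro tendsto_sum tendsto_power)
    fix j assume j: "j \<in> {1..n}"
    have "(\<lambda>i. (\<phi> j x - trunc (r i) j x)\<^sup>2) \<longlonglongrightarrow> 0"
    proof (rule tendsto_sandwich[OF _ _ tendsto_const ux])
      show "\<forall>\<^sub>F i in sequentially. (\<phi> j x - trunc (r i) j x)\<^sup>2 \<le> u (r i) x"
        unfolding u_def using j by (intro always_eventually allI member_le_sum) auto
    qed auto
    then have "(\<lambda>i. sqrt ((\<phi> j x - trunc (r i) j x)\<^sup>2)) \<longlonglongrightarrow> sqrt 0"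
      by (rule tendsto_real_sqrt)
    then have "(\<lambda>i. \<phi> j x - trunc (r i) j x) \<longlonglongrightarrow> 0"
      by (simp add: tendsto_rabs_zero_iff)
    from tendsto_diff[OF tendsto_const[of "\<phi> j x"] this] show "(\<lambda>i. trunc (r i) j x) \<longlonglongrightarrow> \<phi> j x" by simp
  qed
  with ae have "AE x in surface_measure. (\<lambda>i. dens (r i) x) \<longlonglongrightarrow> (\<Sum>j=1..n. (\<phi> j x)\<^sup>2)"
    by (auto elim: eventually_mono)
  then show ?thesis by (rule that)
qed

lemma density_measurable: "(\<lambda>x. \<Sum>j=1..n. (\<phi> j x)\<^sup>2) \<in> borel_measurable surface_measure"
  using \<phi>_square_integrable(1) by (intro borel_measurable_sum borel_measurable_power) auto

text \<open>Fatou's lemma along that subsequence; integrability comes with the bound, which does not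
  depend on the truncation.\<close>

lemma density_bound:
  assumes p: "p > 1" and q: "q = p / (p - 1)"
  shows "integrable surface_measure (\<lambda>x. (\<Sum>j=1..n. (\<phi> j x)\<^sup>2) powr p)"
    and "(\<integral>x. (\<Sum>j=1..n. (\<phi> j x)\<^sup>2) powr p \<partial>surface_measure) \<le> (real n powr (1 / p) * trace_const q powr (1 / q)) powr p"
proof -
  define \<rho> where "\<rho> x = (\<Sum>j=1..n. (\<phi> j x)\<^sup>2)" for x
  define B where "B = (real n powr (1 / p) * trace_const q powr (1 / q)) powr p"
  have B: "B \<ge> 0" by (simp add: B_def)
  obtain r :: "nat \<Rightarrow> nat" where r: "AE x in surface_measure. (\<lambda>i. dens (r i) x) \<longlonglongrightarrow> \<rho> x"
    using dens_AE_subseq unfolding \<rho>_def by blast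
  have \<rho>m: "(\<lambda>x. \<rho> x powr p) \<in> borel_measurable surface_measure"
    using density_measurable unfolding \<rho>_def by measurable
  have dm: "(\<lambda>x. dens N x powr p) \<in> borel_measurable surface_measure" for N
    using integrable_dens_powr[of p N] p by (intro borel_measurable_integrable) simp
  have "AE x in surface_measure. ennreal (\<rho> x powr p) = liminf (\<lambda>i. ennreal (dens (r i) x powr p))"
    using r
  proof eventually_elim
    case (elim x)
    have "(\<lambda>i. dens (r i) x powr p) \<longlonglongrightarrow> \<rho> x powr p"
      using p dens_nonneg by (intro tendsto_powr'[OF elim tendsto_const]) auto
    then have "(\<lambda>i. ennreal (dens (r i) x powr p)) \<longlonglongrightarrow> ennreal (\<rho> x powr p)"
      by (rule tendsto_ennrealI)
    then show ?case by (rule lim_imp_Liminf[symmetric, rotated]) simp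
  qed
  then have "(\<integral>\<^sup>+x. ennreal (\<rho> x powr p) \<partial>surface_measure)
      = (\<integral>\<^sup>+x. liminf (\<lambda>i. ennreal (dens (r i) x powr p)) \<partial>surface_measure)"
    by (rule nn_integral_cong_AE)
  also have "\<dots> \<le> liminf (\<lambda>i. \<integral>\<^sup>+x. ennreal (dens (r i) x powr p) \<partial>surface_measure)"
    by (intro nn_integral_liminf measurable_compose[OF dm measurable_ennreal])
  also have "\<dots> \<le> liminf (\<lambda>i::nat. ennreal B)"
  proof (intro Liminf_mono always_eventually allI)
    fix i
    have "(\<integral>\<^sup>+x. ennreal (dens (r i) x powr p) \<partial>surface_measure) = ennreal (\<integral>x. dens (r i) x powr p \<partial>surface_measure)"
      using p by (intro nn_integral_eq_integral integrable_dens_powr) auto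
    also have "\<dots> \<le> ennreal B"
      unfolding B_def by (intro ennreal_leI dens_bound p q)
    finally show "(\<integral>\<^sup>+x. ennreal (dens (r i) x powr p) \<partial>surface_measure) \<le> ennreal B" .
  qed
  also have "\<dots> = ennreal B" by (simp add: Liminf_const)
  finally have le: "(\<integral>\<^sup>+x. ennreal (\<rho> x powr p) \<partial>surface_measure) \<le> ennreal B" .
  then have "(\<integral>\<^sup>+x. ennreal (\<rho> x powr p) \<partial>surface_measure) < \<infinity>"
    using ennreal_less_top[of B] by (simp add: order_le_less_trans)
  then have int: "integrable surface_measure (\<lambda>x. \<rho> x powr p)"
    by (intro integrableI_nonneg \<rho>m) auto
  then show "integrable surface_measure (\<lambda>x. (\<Sum>j=1..n. (\<phi> j x)\<^sup>2) powr p)" by (simp add: \<rho>_def)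
  have "ennreal (\<integral>x. \<rho> x powr p \<partial>surface_measure) \<le> ennreal B"
    using nn_integral_eq_integral[OF int] le by simp
  then show "(\<integral>x. (\<Sum>j=1..n. (\<phi> j x)\<^sup>2) powr p \<partial>surface_measure) \<le> (real n powr (1 / p) * trace_const q powr (1 / q)) powr p"
    using B by (simp add: \<rho>_def B_def)
qed

text \<open>The endpoint p = 1 is outside the interpolation. Dropping the gradient term from the
  normalization leaves m^2 times the squared norm of each member at most 1.\<close>

lemma density_bound_1:
  "integrable surface_measure (\<lambda>x. \<Sum>j=1..n. (\<phi> j x)\<^sup>2)"
  "(\<integral>x. (\<Sum>j=1..n. (\<phi> j x)\<^sup>2) \<partial>surface_measure) \<le> real n / m\<^sup>2"
proof -
  show "integrable surface_measure (\<lambda>x. \<Sum>j=1..n. (\<phi> j x)\<^sup>2)"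
    by (intro Bochner_Integration.integrable_sum \<phi>_square_integrable)
  have "(\<integral>x. (\<Sum>j=1..n. (\<phi> j x)\<^sup>2) \<partial>surface_measure) = (\<Sum>j=1..n. \<integral>x. (\<phi> j x)\<^sup>2 \<partial>surface_measure)"
    by (intro Bochner_Integration.integral_sum \<phi>_square_integrable)
  also have "\<dots> \<le> (\<Sum>j=1..n. 1 / m\<^sup>2)"
  proof (rule sum_mono)
    fix j assume j: "j \<in> {1..n}"
    have "m\<^sup>2 * S2_inner (\<phi> j) (\<phi> j) \<le> 1"
      using orth[OF j j] S2_inner_nonneg[of "g j"] by simp
    then show "(\<integral>x. (\<phi> j x)\<^sup>2 \<partial>surface_measure) \<le> 1 / m\<^sup>2"
      using m by (simp add: S2_inner_def power2_eq_square field_simps)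
  qed
  finally show "(\<integral>x. (\<Sum>j=1..n. (\<phi> j x)\<^sup>2) \<partial>surface_measure) \<le> real n / m\<^sup>2" by simp
qed

text \<open>For conjugate exponents 1 / (q - 1) = p - 1 and 2 (1 - q) / q = - 2 / p.\<close>

lemma trace_const_powr:
  assumes p: "p > 1" and q: "q = p / (p - 1)"
  shows "trace_const q powr (1 / q) = ((p - 1) / (4 * pi)) powr ((p - 1) / p) * m powr (- 2 / p)"
proof -
  have e: "1 - q = - 1 / (p - 1)" "1 / (q - 1) = p - 1" "1 / q = (p - 1) / p"
    using p by (simp_all add: q field_simps)
  have "trace_const q = m powr (2 * (1 - q)) * (1 / (q - 1)) / (4 * pi)" by (simp add: trace_const_def)
  also have "\<dots> = ((p - 1) / (4 * pi)) * m powr (2 * (1 - q))" unfolding e(2) by simp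
  finally have "trace_const q powr (1 / q) = ((p - 1) / (4 * pi)) powr (1 / q) * (m powr (2 * (1 - q))) powr (1 / q)"
    using p by (simp only: powr_mult[of "(p - 1) / (4 * pi)" "m powr (2 * (1 - q))"])
  also have "(m powr (2 * (1 - q))) powr (1 / q) = m powr (- 2 / p)"
  proof -
    have "2 * (- 1 / d) * (d / p) = - 2 / p" if "d \<noteq> 0" for d using that by simp
    from this[of "p - 1"] show ?thesis using p unfolding powr_powr e(1) e(3) by simp
  qed
  finally show ?thesis by (simp only: e(3))
qed

end

theorem theorem1p1:
  fixes m p :: real and n :: nat and \<phi> :: "nat \<Rightarrow> real^3 \<Rightarrow> real" and \<rho> :: "real^3 \<Rightarrow> real"
  assumes "m > 0" and "n \<ge> 1"
    and "\<And>j. j \<in> {1..n} \<Longrightarrow> S2_H1_dot (\<phi> j)"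
    and "\<And>i j. i \<in> {1..n} \<Longrightarrow> j \<in> {1..n} \<Longrightarrow>
      m\<^sup>2 * S2_inner (\<phi> i) (\<phi> j) + S2_inner (S2_grad (\<phi> i)) (S2_grad (\<phi> j))
        = (if i = j then 1 else 0)"
    and "p \<ge> 1"
    and "\<And>x. \<rho> x = (\<Sum>j=1..n. \<bar>\<phi> j x\<bar>\<^sup>2)"
  shows "S2_Lp p \<rho> \<and>
    S2_Lp_norm p \<rho>
      \<le> (if p = 1 then 1 else ((p - 1) / (4 * pi)) powr ((p - 1) / p))
          * m powr (- 2 / p) * real n powr (1 / p)"
proof -
  interpret orthonormal_family m n \<phi> "\<lambda>j. S2_grad (\<phi> j)"
  proof
    fix j assume "j \<in> {1..n}"
    then have h: "S2_H1_dot (\<phi> j)" by (rule assms(3))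
    then show "S2_Lp 2 (\<phi> j)" "(\<integral>x. \<phi> j x \<partial>surface_measure) = 0"
      by (simp_all add: S2_H1_dot_def S2_H1_def)
    have "\<exists>g. S2_weak_gradient (\<phi> j) g" using h by (simp add: S2_H1_dot_def S2_H1_def)
    then show "S2_weak_gradient (\<phi> j) (S2_grad (\<phi> j))" unfolding S2_grad_def by (rule someI_ex)
  qed (use assms in auto)
  have \<rho>: "\<rho> = (\<lambda>x. \<Sum>j=1..n. (\<phi> j x)\<^sup>2)" using assms(6) by (simp add: fun_eq_iff)
  have nn: "(\<Sum>j=1..n. (\<phi> j x)\<^sup>2) \<ge> 0" for x by (simp add: sum_nonneg)
  show ?thesis
  proof (cases "p = 1")
    case True
    have "m powr - 2 = 1 / m\<^sup>2" using m by (simp add: powr_minus powr_numeral divide_inverse)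
    with True show ?thesis
      using density_bound_1 density_measurable nn m n unfolding \<rho>
      by (simp add: S2_Lp_def S2_Lp_norm_def integral_nonneg)
  next
    case False
    then have p: "p > 1" using assms(5) by simp
    define q where "q = p / (p - 1)"
    note b = density_bound[OF p q_def]
    have "(\<integral>x. norm (\<rho> x) powr p \<partial>surface_measure) powr (1 / p)
        \<le> ((real n powr (1 / p) * trace_const q powr (1 / q)) powr p) powr (1 / p)"
      using b(2) nn p unfolding \<rho> by (intro powr_mono2) simp_all
    also have "\<dots> = real n powr (1 / p) * trace_const q powr (1 / q)"
      using p by (simp add: powr_powr)
    also have "\<dots> = ((p - 1) / (4 * pi)) powr ((p - 1) / p) * m powr (- 2 / p) * real n powr (1 / p)"
      unfolding trace_const_powr[OF p q_def] by simp
    finally have "S2_Lp_norm p \<rho> \<le> ((p - 1) / (4 * pi)) powr ((p - 1) / p) * m powr (- 2 / p) * real n powr (1 / p)"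
      by (simp only: S2_Lp_norm_def)
    moreover have "S2_Lp p \<rho>"
      using b(1) density_measurable nn unfolding S2_Lp_def \<rho> by simp
    ultimately show ?thesis using False by simp
  qed
qed

end
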